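(* Let $R$ be an integral domain, $1\neq q\in R^\times$, $\mathbf{Q}=(Q_1,\dots,Q_\ell)\in R^\ell$, and let $\mathscr{H}_{\ell,n}=\mathscr{H}_{\ell,n}^R(q;\mathbf{Q})$ be the non-degenerate cyclotomic Hecke algebra, with descending map $\varepsilon_n:\mathscr{H}_{\ell,n}\to\mathscr{H}_{\ell,n-1}$ and Murphy basis $\{\mathfrak{m}_{\mathfrak{s}\mathfrak{t}}\}$. Let $\boldsymbol{\lambda}\in\mathscr{P}_{\ell,n}$ and $\mathfrak{s},\mathfrak{t}\in\mathrm{Std}(\boldsymbol{\lambda})$. Then $$\varepsilon_n(\mathfrak{m}_{\mathfrak{s}\mathfrak{t}})=\begin{cases} q^{\,n-n(\mathfrak{t})}\Big(\prod_{i=l(\mathfrak{t},n)+1}^{\ell}(-Q_i)\Big)\,\mathfrak{m}_{\mathfrak{s}_{\downarrow\le(n-1)}\mathfrak{t}_{\downarrow\le(n-1)}}, & \text{if } n(\mathfrak{s})=n(\mathfrak{t}),\\ 0,&\text{if } n(\mathfrak{s})\ne n(\mathfrak{t}).\end{cases}$$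
   Context: Algebra. Let $\ell,n\ge 1$. For $k\ge1$, $\mathscr{H}_{\ell,k}$ is the unital associative $R$-algebra with generators $T_0,T_1,\dots,T_{k-1}$ and relations: $(T_0-Q_1)\cdots(T_0-Q_\ell)=0$; $T_0T_1T_0T_1=T_1T_0T_1T_0$; $(T_i-q)(T_i+1)=0$ for $1\le i\le k-1$; $T_iT_j=T_jT_i$ for $0\le i<j-1<k-1$; $T_iT_{i+1}T_i=T_{i+1}T_iT_{i+1}$ for $1\le i<k-1$. $\mathscr{H}_{\ell,0}=R$, and $\mathscr{H}_{\ell,k-1}$ is regarded as the subalgebra of $\mathscr{H}_{\ell,k}$ generated by $T_0,\dots,T_{k-2}$. Put $\mathcal{L}_1=T_0$, $\mathcal{L}_{k+1}=q^{-1}T_k\mathcal{L}_kT_k$; these commute. $\mathfrak{S}_n$ is the symmetric group with $\sigma_i=(i,i+1)$, acting on $\{1,\dots,n\}$ from the right (in a product the left factor is applied first); for a reduced expression $w=\sigma_{i_1}\cdots\sigma_{i_k}$ put $T_w=T_{i_1}\cdots T_{i_k}$. $*$ is the $R$-algebra anti-automorphism fixing all $T_i$. Descending map. For $k\ge1$, as $(\mathscr{H}_{\ell,k-1},\mathscr{H}_{\ell,k-1})$-bimodules, $\mathscr{H}_{\ell,k}=\mathscr{H}_{\ell,k-1}T_{k-1}\mathscr{H}_{\ell,k-1}\oplus\bigoplus_{j=0}^{\ell-1}\mathscr{H}_{\ell,k-1}\mathcal{L}_k^j$ (for $k=1$ the first summand is absent), where each $\mathscr{H}_{\ell,k-1}\to\mathscr{H}_{\ell,k-1}\mathcal{L}_k^j$,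 $c\mapsto c\mathcal{L}_k^j$, is an isomorphism. So each $h\in\mathscr{H}_{\ell,k}$ is uniquely $h=h'+\sum_{j=0}^{\ell-1}p^{(k)}_j(h)\mathcal{L}_k^j$ with $h'\in\mathscr{H}_{\ell,k-1}T_{k-1}\mathscr{H}_{\ell,k-1}$, $p_j^{(k)}(h)\in\mathscr{H}_{\ell,k-1}$. Define $\varepsilon_k(h)=p_0^{(k)}(h)$. Combinatorics. $\mathscr{P}_{\ell,n}$ is the set of $\ell$-partitions $\boldsymbol{\lambda}=(\lambda^{(1)},\dots,\lambda^{(\ell)})$ of $n$; $[\boldsymbol{\lambda}]=\{(r,c,l)\mid 1\le l\le\ell,\ r\ge1,\ 1\le c\le\lambda^{(l)}_r\}$. A $\boldsymbol{\lambda}$-tableau is a bijection $\mathfrak{t}:[\boldsymbol{\lambda}]\to\{1,\dots,n\}$; it is standard if in every component entries increase along rows and down columns; $\mathrm{Std}(\boldsymbol{\lambda})$ is the set of these. $\mathfrak{t}^{\boldsymbol{\lambda}}$ has $1,\dots,n$ entered in order along successive rows of $\lambda^{(1)}$, then $\lambda^{(2)}$, etc. $d(\mathfrak{t})\in\mathfrak{S}_n$ is the unique element with $\mathfrak{t}=\mathfrak{t}^{\boldsymbol{\lambda}}d(\mathfrak{t})$ (right action on entries). $\mathfrak{t}_{\downarrow\le k}$ is the subtableau of $\mathfrak{t}$ with entries $1,\dots,k$. $n(\mathfrak{t})$ is the unique integer in $\{1,\dots,n\}$ with $\mathfrak{t}^{-1}(n)=(\mathfrak{t}^{\boldsymbol{\lambda}})^{-1}(n(\mathfrak{t}))$.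 $l(\mathfrak{t},n)$ is the component containing $n$: $\mathfrak{t}^{-1}(n)=(r(\mathfrak{t},n),c(\mathfrak{t},n),l(\mathfrak{t},n))$. If $n(\mathfrak{s})=n(\mathfrak{t})$ then $\mathfrak{s}_{\downarrow\le(n-1)}$ and $\mathfrak{t}_{\downarrow\le(n-1)}$ have the same shape. Murphy basis (for every $n$; $\mathfrak{m}=1$ for $n=0$). $\mathfrak{S}_{\boldsymbol{\lambda}}\le\mathfrak{S}_n$ is the Young subgroup of the composition listing all nonzero row lengths of $\lambda^{(1)}$, then $\lambda^{(2)}$, etc. (the row stabilizer of $\mathfrak{t}^{\boldsymbol{\lambda}}$). Put $\mathfrak{a}_s=|\lambda^{(1)}|+\cdots+|\lambda^{(s-1)}|$, $x_{\boldsymbol{\lambda}}=\sum_{w\in\mathfrak{S}_{\boldsymbol{\lambda}}}T_w$, $\mathfrak{u}^+_{\boldsymbol{\lambda}}=\prod_{s=2}^{\ell}\prod_{k=1}^{\mathfrak{a}_s}(\mathcal{L}_k-Q_s)$, $\mathfrak{m}_{\boldsymbol{\lambda}}=x_{\boldsymbol{\lambda}}\mathfrak{u}^+_{\boldsymbol{\lambda}}$, $\mathfrak{m}_{\mathfrak{s}\mathfrak{t}}=T_{d(\mathfrak{s})}^*\mathfrak{m}_{\boldsymbol{\lambda}}T_{d(\mathfrak{t})}$. *)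

theory Defs
  imports
    "HOL-Library.Poly_Mapping"
    "HOL-Library.FuncSet"
    "HOL-Combinatorics.Permutations"
    "HOL-Algebra.QuotRing"
begin

section \<open>Free associative algebras\<close>

datatype word = Word (letters: "nat list")

instantiation word :: monoid_add
begin

definition zero_word :: word where "0 = Word []"
definition plus_word :: "word \<Rightarrow> word \<Rightarrow> word" where "u + v = Word (letters u @ letters v)"

instance
  by standard (auto simp: zero_word_def plus_word_def)

end

text \<open>
  The product of a type of finitely supported functions on a monoid is convolution. As the monoid
  \<^typ>\<open>word\<close> is free, \<open>word \<Rightarrow>\<^sub>0 'a\<close> is the free associative algebra over \<open>'a\<close> on countably
  many generators.
\<close>

type_synonym 'a free = "word \<Rightarrow>\<^sub>0 'a"

definition gen :: "nat \<Rightarrow> 'a::idom free" where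
  "gen i = Poly_Mapping.single (Word [i]) 1"

definition const :: "'a \<Rightarrow> 'a::idom free" where
  "const c = Poly_Mapping.single 0 c"

definition free_alg :: "nat \<Rightarrow> 'a::idom free ring" where
  "free_alg k =
     \<lparr>carrier = {x. \<forall>w \<in> Poly_Mapping.keys x. set (letters w) \<subseteq> {..<k}},
      mult = (*), one = 1, zero = 0, add = (+)\<rparr>"

definition list_mult :: "('r, 'b) ring_scheme \<Rightarrow> 'r list \<Rightarrow> 'r" where
  "list_mult A xs = foldr (mult A) xs (one A)"


section \<open>The symmetric group\<close>

text \<open>Permutations act from the right: the leftmost letter of a word is applied first.\<close>

definition perm_of :: "nat list \<Rightarrow> nat \<Rightarrow> nat" where
  "perm_of is = foldl (\<lambda>w i. transpose i (Suc i) \<circ> w) id is"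

definition expression :: "nat \<Rightarrow> (nat \<Rightarrow> nat) \<Rightarrow> nat list \<Rightarrow> bool" where
  "expression n w is \<longleftrightarrow> set is \<subseteq> {1..<n} \<and> perm_of is = w"

definition reduced_expression :: "nat \<Rightarrow> (nat \<Rightarrow> nat) \<Rightarrow> nat list \<Rightarrow> bool" where
  "reduced_expression n w is \<longleftrightarrow>
     expression n w is \<and> (\<forall>js. expression n w js \<longrightarrow> length is \<le> length js)"


section \<open>Multipartitions and tableaux\<close>

text \<open>
  A multipartition \<open>lam\<close> has the part \<open>lam l r\<close> in row \<open>r\<close> of its component \<open>l\<close>, with components and
  rows counted from 1; the values at all other indices are 0, so that \<open>lam\<close> is determined
  by its diagram.
\<close>

type_synonym mpart = "nat \<Rightarrow> nat \<Rightarrow> nat"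
type_synonym node = "nat \<times> nat \<times> nat"
type_synonym tableau = "node \<Rightarrow> nat"

definition is_partition :: "(nat \<Rightarrow> nat) \<Rightarrow> bool" where
  "is_partition p \<longleftrightarrow> p 0 = 0 \<and> (\<forall>r\<ge>1. p (Suc r) \<le> p r) \<and> finite {r. p r \<noteq> 0}"

definition psize :: "(nat \<Rightarrow> nat) \<Rightarrow> nat" where
  "psize p = (\<Sum>r | p r \<noteq> 0. p r)"

definition multipartitions :: "nat \<Rightarrow> nat \<Rightarrow> mpart set" where
  "multipartitions ell n =
     {lam. (\<forall>l\<in>{1..ell}. is_partition (lam l)) \<and> (\<forall>l. l \<notin> {1..ell} \<longrightarrow> lam l = (\<lambda>_. 0)) \<and>
           (\<Sum>l=1..ell. psize (lam l)) = n}"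

definition diagram :: "nat \<Rightarrow> mpart \<Rightarrow> node set" where
  "diagram ell lam = {(r, c, l). 1 \<le> l \<and> l \<le> ell \<and> 1 \<le> r \<and> 1 \<le> c \<and> c \<le> lam l r}"

definition tableaux :: "nat \<Rightarrow> nat \<Rightarrow> mpart \<Rightarrow> tableau set" where
  "tableaux ell n lam =
     {t \<in> extensional (diagram ell lam). bij_betw t (diagram ell lam) {1..n}}"

definition Std :: "nat \<Rightarrow> nat \<Rightarrow> mpart \<Rightarrow> tableau set" where
  "Std ell n lam =
     {t \<in> tableaux ell n lam.
        (\<forall>r c c' l. (r, c, l) \<in> diagram ell lam \<and> (r, c', l) \<in> diagram ell lam \<and> c < c'
             \<longrightarrow> t (r, c, l) < t (r, c', l)) \<and>
        (\<forall>r r' c l. (r, c, l) \<in> diagram ell lam \<and> (r', c, l) \<in> diagram ell lam \<and> r < r'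
             \<longrightarrow> t (r, c, l) < t (r', c, l))}"

definition frak_a :: "mpart \<Rightarrow> nat \<Rightarrow> nat" where
  "frak_a lam s = (\<Sum>l\<in>{1..<s}. psize (lam l))"

definition init_tab :: "nat \<Rightarrow> mpart \<Rightarrow> tableau" where
  "init_tab ell lam =
     restrict (\<lambda>(r, c, l). frak_a lam l + (\<Sum>r'\<in>{1..<r}. lam l r') + c) (diagram ell lam)"

definition tab_perm :: "nat \<Rightarrow> nat \<Rightarrow> mpart \<Rightarrow> tableau \<Rightarrow> nat \<Rightarrow> nat" where
  "tab_perm ell n lam t =
     (THE w. w permutes {1..n} \<and> (\<forall>x\<in>diagram ell lam. t x = w (init_tab ell lam x)))"

definition row_entries :: "nat \<Rightarrow> mpart \<Rightarrow> nat \<Rightarrow> nat \<Rightarrow> nat set" where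
  "row_entries ell lam l r = init_tab ell lam ` {(r, c, l) | c. (r, c, l) \<in> diagram ell lam}"

text \<open>The Young subgroup, as the row stabilizer of the initial tableau.\<close>

definition young :: "nat \<Rightarrow> nat \<Rightarrow> mpart \<Rightarrow> (nat \<Rightarrow> nat) set" where
  "young ell n lam =
     {w. w permutes {1..n} \<and> (\<forall>l r. w ` row_entries ell lam l r = row_entries ell lam l r)}"

definition node_of :: "nat \<Rightarrow> mpart \<Rightarrow> tableau \<Rightarrow> nat \<Rightarrow> node" where
  "node_of ell lam t m = inv_into (diagram ell lam) t m"

definition comp_of :: "nat \<Rightarrow> mpart \<Rightarrow> tableau \<Rightarrow> nat \<Rightarrow> nat" where
  "comp_of ell lam t m = snd (snd (node_of ell lam t m))"

definition n_of :: "nat \<Rightarrow> nat \<Rightarrow> mpart \<Rightarrow> tableau \<Rightarrow> nat" where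
  "n_of ell n lam t =
     (THE m. m \<in> {1..n} \<and> node_of ell lam t n = node_of ell lam (init_tab ell lam) m)"

definition sub_tab :: "nat \<Rightarrow> mpart \<Rightarrow> nat \<Rightarrow> tableau \<Rightarrow> tableau" where
  "sub_tab ell lam k t = restrict t {x \<in> diagram ell lam. t x \<le> k}"

definition sub_shape :: "nat \<Rightarrow> mpart \<Rightarrow> nat \<Rightarrow> tableau \<Rightarrow> mpart" where
  "sub_shape ell lam k t = (\<lambda>l r. card {c. (r, c, l) \<in> diagram ell lam \<and> t (r, c, l) \<le> k})"


section \<open>The cyclotomic Hecke algebras\<close>

context
  fixes ell :: nat and q :: "'a::idom" and Q :: "nat \<Rightarrow> 'a"
begin

definition hecke_rels :: "nat \<Rightarrow> 'a free set" where
  "hecke_rels k =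
     (if 1 \<le> k then {prod_list (map (\<lambda>i. gen 0 - const (Q i)) [1..<Suc ell])} else {})
   \<union> (if 2 \<le> k then {gen 0 * gen 1 * gen 0 * gen 1 - gen 1 * gen 0 * gen 1 * gen 0} else {})
   \<union> {(gen i - const q) * (gen i + 1) | i. 1 \<le> i \<and> i < k}
   \<union> {gen i * gen j - gen j * gen i | i j. i + 1 < j \<and> j < k}
   \<union> {gen i * gen (i + 1) * gen i - gen (i + 1) * gen i * gen (i + 1) | i. 1 \<le> i \<and> i + 1 < k}"

definition hecke_ideal :: "nat \<Rightarrow> 'a free set" where
  "hecke_ideal k = Idl\<^bsub>free_alg k\<^esub> (hecke_rels k)"

text \<open>For \<open>k = 0\<close> there are neither generators nor relations, and this is the ground ring.\<close>

definition hecke :: "nat \<Rightarrow> 'a free set ring" where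
  "hecke k = free_alg k Quot hecke_ideal k"

definition hT :: "nat \<Rightarrow> nat \<Rightarrow> 'a free set" where
  "hT k i = hecke_ideal k +>\<^bsub>free_alg k\<^esub> gen i"

definition hsmult :: "nat \<Rightarrow> 'a \<Rightarrow> 'a free set \<Rightarrow> 'a free set" where
  "hsmult k c x = (hecke_ideal k +>\<^bsub>free_alg k\<^esub> const c) \<otimes>\<^bsub>hecke k\<^esub> x"

text \<open>
  The map \<open>hecke (k - 1) \<rightarrow> hecke k\<close> fixing the generators: adding the larger ideal to a coset
  \<open>x + hecke_ideal (k - 1)\<close> gives the coset \<open>x + hecke_ideal k\<close>.
\<close>

definition hemb :: "nat \<Rightarrow> 'a free set \<Rightarrow> 'a free set" where
  "hemb k X = hecke_ideal k <+>\<^bsub>free_alg k\<^esub> X"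

definition qinv :: 'a where
  "qinv = (THE r. q * r = 1)"

text \<open>\<open>hL k m\<close> is the \<open>m\<close>-th Jucys--Murphy element in \<open>hecke k\<close>; it is meant for \<open>1 \<le> m \<le> k\<close>.\<close>

fun hL :: "nat \<Rightarrow> nat \<Rightarrow> 'a free set" where
  "hL k 0 = \<zero>\<^bsub>hecke k\<^esub>"
| "hL k (Suc 0) = hT k 0"
| "hL k (Suc (Suc m)) =
     hsmult k qinv (hT k (Suc m) \<otimes>\<^bsub>hecke k\<^esub> hL k (Suc m) \<otimes>\<^bsub>hecke k\<^esub> hT k (Suc m))"

text \<open>By the braid relations the choice of the reduced expression is immaterial.\<close>

definition hTw :: "nat \<Rightarrow> (nat \<Rightarrow> nat) \<Rightarrow> 'a free set" where
  "hTw k w = list_mult (hecke k) (map (hT k) (SOME is. reduced_expression k w is))"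

definition hstar :: "nat \<Rightarrow> 'a free set \<Rightarrow> 'a free set" where
  "hstar k =
     (THE f. f \<in> extensional (carrier (hecke k)) \<and>
        bij_betw f (carrier (hecke k)) (carrier (hecke k)) \<and>
        f \<one>\<^bsub>hecke k\<^esub> = \<one>\<^bsub>hecke k\<^esub> \<and>
        (\<forall>x\<in>carrier (hecke k). \<forall>y\<in>carrier (hecke k). f (x \<oplus>\<^bsub>hecke k\<^esub> y) = f x \<oplus>\<^bsub>hecke k\<^esub> f y) \<and>
        (\<forall>x\<in>carrier (hecke k). \<forall>y\<in>carrier (hecke k). f (x \<otimes>\<^bsub>hecke k\<^esub> y) = f y \<otimes>\<^bsub>hecke k\<^esub> f x) \<and>
        (\<forall>c. \<forall>x\<in>carrier (hecke k). f (hsmult k c x) = hsmult k c (f x)) \<and>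
        (\<forall>i<k. f (hT k i) = hT k i))"


subsection \<open>The descending map\<close>

text \<open>
  The bimodule \<open>H\<^sub>k\<^sub>-\<^sub>1 T\<^sub>k\<^sub>-\<^sub>1 H\<^sub>k\<^sub>-\<^sub>1\<close> consists of the finite sums of products; for \<open>k = 1\<close> this
  summand is absent.
\<close>

definition HTH :: "nat \<Rightarrow> 'a free set set" where
  "HTH k =
     (if k = 1 then {\<zero>\<^bsub>hecke k\<^esub>} else
      {(\<Oplus>\<^bsub>hecke k\<^esub>i\<in>{..<N}. hemb k (a i) \<otimes>\<^bsub>hecke k\<^esub> hT k (k - 1) \<otimes>\<^bsub>hecke k\<^esub> hemb k (b i))
        | (N::nat) a b. a \<in> {..<N} \<rightarrow> carrier (hecke (k - 1)) \<and> b \<in> {..<N} \<rightarrow> carrier (hecke (k - 1))})"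

definition is_desc_coeffs :: "nat \<Rightarrow> 'a free set \<Rightarrow> (nat \<Rightarrow> 'a free set) \<Rightarrow> bool" where
  "is_desc_coeffs k h p \<longleftrightarrow>
     p \<in> {..<ell} \<rightarrow>\<^sub>E carrier (hecke (k - 1)) \<and>
     (\<exists>h'\<in>HTH k. h = h' \<oplus>\<^bsub>hecke k\<^esub>
        (\<Oplus>\<^bsub>hecke k\<^esub>j\<in>{..<ell}. hemb k (p j) \<otimes>\<^bsub>hecke k\<^esub> hL k k [^]\<^bsub>hecke k\<^esub> j))"

definition desc_coeffs :: "nat \<Rightarrow> 'a free set \<Rightarrow> nat \<Rightarrow> 'a free set" where
  "desc_coeffs k h = (THE p. is_desc_coeffs k h p)"

definition descend :: "nat \<Rightarrow> 'a free set \<Rightarrow> 'a free set" where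
  "descend k h = desc_coeffs k h 0"


subsection \<open>The Murphy basis\<close>

definition x_elt :: "nat \<Rightarrow> mpart \<Rightarrow> 'a free set" where
  "x_elt n lam = (\<Oplus>\<^bsub>hecke n\<^esub>w\<in>young ell n lam. hTw n w)"

text \<open>The Jucys--Murphy elements commute, so the order of the factors is immaterial.\<close>

definition u_elt :: "nat \<Rightarrow> mpart \<Rightarrow> 'a free set" where
  "u_elt n lam =
     list_mult (hecke n)
       (concat (map (\<lambda>s. map (\<lambda>k. hL n k \<ominus>\<^bsub>hecke n\<^esub> hsmult n (Q s) \<one>\<^bsub>hecke n\<^esub>)
                           [1..<Suc (frak_a lam s)])
                    [2..<Suc ell]))"

definition m_elt :: "nat \<Rightarrow> mpart \<Rightarrow> 'a free set" where
  "m_elt n lam = x_elt n lam \<otimes>\<^bsub>hecke n\<^esub> u_elt n lam"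

definition murphy :: "nat \<Rightarrow> mpart \<Rightarrow> tableau \<Rightarrow> tableau \<Rightarrow> 'a free set" where
  "murphy n lam s t =
     hstar n (hTw n (tab_perm ell n lam s)) \<otimes>\<^bsub>hecke n\<^esub> m_elt n lam
       \<otimes>\<^bsub>hecke n\<^esub> hTw n (tab_perm ell n lam t)"

end

end

theory Submission
  imports Defs "HOL-Library.Function_Algebras" "HOL-Computational_Algebra.Polynomial"
begin

text \<open>
  For the descending map to be computable one needs the uniqueness of the decomposition of \<open>H\<^sub>k\<^sub>+\<^sub>1\<close> over
  \<open>H\<^sub>k\<close>. It is read off from the free left \<open>H\<^sub>k\<close>-module on
  \<open>T\<^sub>k \<dots> T\<^sub>i L\<^sub>i\<^sup>j\<close> with \<open>1 \<le> i \<le> k + 1\<close>, \<open>0 \<le> j < \<ell>\<close>, on which explicit operators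
  satisfy the relations of \<open>H\<^sub>k\<^sub>+\<^sub>1\<close>; applied to the unit vector, an element shows its coefficients.

  As for the formula, let \<open>d(t) = \<sigma>\<^sub>a \<dots> \<sigma>\<^sub>n\<^sub>-\<^sub>1 v\<close> and \<open>d(s) = \<sigma>\<^sub>b \<dots> \<sigma>\<^sub>n\<^sub>-\<^sub>1 w\<close> with \<open>a = n(t)\<close>, \<open>b = n(s)\<close>
  and \<open>v\<close>, \<open>w\<close> belonging to the tableaux without \<open>n\<close>. As the descending map is a bimodule map, it remains to
  descend \<open>T\<^sub>n\<^sub>-\<^sub>1 \<dots> T\<^sub>b x u\<^sup>+ T\<^sub>a \<dots> T\<^sub>n\<^sub>-\<^sub>1\<close>. If \<open>a = b\<close>, then modulo the kernel each conjugation by some \<open>T\<^sub>i\<close>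
  with \<open>a \<le> i < n\<close> contributes the factor \<open>q\<close>, and each \<open>L\<^sub>i - Q\<^sub>s\<close> not in the smaller algebra
  the factor \<open>- Q\<^sub>s\<close>; there are at most \<open>\<ell> - 1\<close> of the latter, so that no power \<open>L\<^sup>\<ell>\<close> ever
  occurs. If \<open>a \<noteq> b\<close>, an unpaired \<open>T\<close> puts the product into the kernel.
\<close>

subsection \<open>Free algebras and their quotients\<close>

text \<open>The descending map is a \<open>THE\<close>, so nothing about it can be computed before
  uniqueness is known. Over an arbitrary domain no dimension count is at hand; hence the module is
  built explicitly, with coefficients in the smaller algebra itself. The relations of its operators
  then reduce to the relations of that algebra, and no induction on the rank is made. The operators
  are forced: they are what right multiplication by the generators has to be on these basis
  elements.

  Decompositions are exhibited only for the elements at hand. An \<open>L m\<close> with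
  \<open>m >= 2\<close> is in general no root of the cyclotomic polynomial, so rewriting its power
  \<open>ell\<close> would be laborious; a degree bound is therefore carried along with every
  membership in the kernel, and \<open>u\<close> raises it at most once for each
  \<open>s = 2, ..., ell\<close>.

  The locale \<open>hecke_gens\<close> accordingly serves at two levels: at the smaller algebra as
  the coefficients of the module, at the larger one as the place of the computation with
  \<open>x\<close> and \<open>u\<close>.\<close>

abbreviation free_carrier :: "nat \<Rightarrow> 'a::idom free set" where
  "free_carrier k \<equiv> carrier (free_alg k)"

lemma free_carrier_iff:
  "x \<in> free_carrier k \<longleftrightarrow> (\<forall>w \<in> Poly_Mapping.keys x. set (letters w) \<subseteq> {..<k})"
  by (simp add: free_alg_def)

lemma free_alg_simps [simp]:
  "mult (free_alg k) = (*)" "one (free_alg k) = 1"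
  "zero (free_alg k) = 0" "add (free_alg k) = (+)"
  by (simp_all add: free_alg_def)

lemma letters_zero [simp]: "letters 0 = []"
  by (simp add: zero_word_def)

lemma letters_plus [simp]: "letters (u + v) = letters u @ letters v"
  by (simp add: plus_word_def)

lemma free_carrier_zero [simp, intro]: "0 \<in> free_carrier k"
  by (simp add: free_carrier_iff)

lemma free_carrier_single:
  "set (letters w) \<subseteq> {..<k} \<Longrightarrow> Poly_Mapping.single w c \<in> free_carrier k"
  by (simp add: free_carrier_iff)

lemma free_carrier_one [simp, intro]: "1 \<in> free_carrier k"
  by (simp add: free_carrier_iff)

lemma free_carrier_const [simp, intro]: "const c \<in> free_carrier k"
  by (simp add: free_carrier_single const_def)

lemma free_carrier_gen [intro]: "i < k \<Longrightarrow> gen i \<in> free_carrier k"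
  by (simp add: free_carrier_single gen_def)

lemma free_carrier_add [intro]:
  "x \<in> free_carrier k \<Longrightarrow> y \<in> free_carrier k \<Longrightarrow> x + y \<in> free_carrier k"
  using keys_add[of x y] by (auto simp: free_carrier_iff)

lemma free_carrier_uminus [intro]: "x \<in> free_carrier k \<Longrightarrow> - x \<in> free_carrier k"
  by (auto simp: free_carrier_iff in_keys_iff)

lemma free_carrier_diff [intro]:
  "x \<in> free_carrier k \<Longrightarrow> y \<in> free_carrier k \<Longrightarrow> x - y \<in> free_carrier k"
  using free_carrier_add[of x k "- y"] by auto

lemma free_carrier_mult [intro]:
  "x \<in> free_carrier k \<Longrightarrow> y \<in> free_carrier k \<Longrightarrow> x * y \<in> free_carrier k"
  using keys_mult[of x y] by (fastforce simp: free_carrier_iff)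

lemma free_carrier_sum [intro]:
  "(\<And>i. i \<in> I \<Longrightarrow> f i \<in> free_carrier k) \<Longrightarrow> sum f I \<in> free_carrier k"
  by (induction I rule: infinite_finite_induct) auto

lemma free_carrier_prod_list [intro]:
  "(\<And>x. x \<in> set xs \<Longrightarrow> x \<in> free_carrier k) \<Longrightarrow> prod_list xs \<in> free_carrier k"
  by (induction xs) auto

lemma free_carrier_mono: "x \<in> free_carrier k \<Longrightarrow> k \<le> m \<Longrightarrow> x \<in> free_carrier m"
  by (fastforce simp: free_carrier_iff)

lemma free_alg_ring: "ring (free_alg k :: 'a::idom free ring)"
proof (rule ringI)
  show "abelian_group (free_alg k :: 'a free ring)"
  proof (rule abelian_groupI)
    fix x :: "'a free" assume "x \<in> free_carrier k"
    then show "\<exists>y\<in>free_carrier k. y \<oplus>\<^bsub>free_alg k\<^esub> x = \<zero>\<^bsub>free_alg k\<^esub>"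
      by (intro bexI[of _ "- x"]) auto
  qed (auto simp: algebra_simps)
  show "monoid (free_alg k :: 'a free ring)"
    by (rule monoidI) (auto simp: mult.assoc)
qed (auto simp: algebra_simps)

lemma const_add: "const (a + b) = const a + const b"
  by (simp add: const_def single_add)

lemma const_mult: "const (a * b) = const a * const b"
  by (simp add: const_def mult_single)

lemma const_zero [simp]: "const 0 = 0"
  by (simp add: const_def)

lemma const_one [simp]: "const 1 = 1"
  by (simp add: const_def)

lemma single_snoc:
  "Poly_Mapping.single (Word (l @ [i])) (c::'a::idom) = Poly_Mapping.single (Word l) c * gen i"
  by (simp add: gen_def mult_single plus_word_def)

lemma single_Nil: "Poly_Mapping.single (Word []) (c::'a::idom) = const c"
  by (simp add: const_def zero_word_def)

lemma poly_mapping_sum_monomials: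
  "(\<Sum>w\<in>Poly_Mapping.keys x. Poly_Mapping.single w (Poly_Mapping.lookup x w)) = x"
proof (rule poly_mapping_eqI)
  fix v
  have "(\<Sum>w\<in>Poly_Mapping.keys x. Poly_Mapping.lookup x w when w = v) =
      (\<Sum>w\<in>Poly_Mapping.keys x. if w = v then Poly_Mapping.lookup x w else 0)"
    by (simp add: when_def)
  also have "\<dots> = Poly_Mapping.lookup x v"
    by (simp add: in_keys_iff)
  finally show "Poly_Mapping.lookup (\<Sum>w\<in>Poly_Mapping.keys x.
      Poly_Mapping.single w (Poly_Mapping.lookup x w)) v = Poly_Mapping.lookup x v"
    by (simp add: lookup_sum lookup_single)
qed

lemma const_central: "const c * x = x * const (c::'a::idom)"
proof (rule poly_mapping_eqI)
  have *: "const c * Poly_Mapping.single w a = Poly_Mapping.single w a * const c" for w and a :: 'a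
    by (simp add: const_def mult_single mult.commute)
  have "const c * x = const c * (\<Sum>w\<in>Poly_Mapping.keys x. Poly_Mapping.single w (Poly_Mapping.lookup x w))"
    by (simp add: poly_mapping_sum_monomials)
  also have "\<dots> = (\<Sum>w\<in>Poly_Mapping.keys x. Poly_Mapping.single w (Poly_Mapping.lookup x w)) * const c"
    by (simp add: sum_distrib_left sum_distrib_right *)
  also have "\<dots> = x * const c" by (simp add: poly_mapping_sum_monomials)
  finally show "Poly_Mapping.lookup (const c * x) w = Poly_Mapping.lookup (x * const c) w" for w by simp
qed

text \<open>Monomials are built by appending letters on the right, which suits right actions; later
  arguments need not look at supports or coefficients.\<close>

lemma free_carrier_induct [consumes 1, case_names const snoc add]:
  fixes x :: "'a::idom free"
  assumes x: "x \<in> free_carrier k"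
    and c: "\<And>c. P (const c)"
    and m: "\<And>x i. x \<in> free_carrier k \<Longrightarrow> P x \<Longrightarrow> i < k \<Longrightarrow> P (x * gen i)"
    and a: "\<And>x y. x \<in> free_carrier k \<Longrightarrow> y \<in> free_carrier k \<Longrightarrow> P x \<Longrightarrow> P y \<Longrightarrow> P (x + y)"
  shows "P x"
proof -
  have single: "set l \<subseteq> {..<k} \<Longrightarrow> P (Poly_Mapping.single (Word l) c)" for l c
  proof (induction l rule: rev_induct)
    case Nil
    then show ?case by (simp add: single_Nil c)
  next
    case (snoc i l)
    then show ?case unfolding single_snoc by (intro m free_carrier_single) auto
  qed
  have sums: "finite W \<Longrightarrow> (\<And>w. w \<in> W \<Longrightarrow> set (letters w) \<subseteq> {..<k}) \<Longrightarrow>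
      P (\<Sum>w\<in>W. Poly_Mapping.single w (f w))" for W and f :: "word \<Rightarrow> 'a"
  proof (induction W rule: finite_induct)
    case empty
    then show ?case using c[of 0] by simp
  next
    case (insert w W)
    have "P (Poly_Mapping.single w (f w))"
      using single[of "letters w" "f w"] insert.prems[of w] by simp
    then show ?case using insert
      by (subst sum.insert) (auto intro!: a free_carrier_single free_carrier_sum)
  qed
  have "P (\<Sum>w\<in>Poly_Mapping.keys x. Poly_Mapping.single w (Poly_Mapping.lookup x w))"
    by (rule sums) (use x in \<open>auto simp: free_carrier_iff\<close>)
  then show ?thesis by (simp add: poly_mapping_sum_monomials)
qed

lemma free_induct [case_names const snoc add]:
  fixes x :: "'a::idom free"
  assumes c: "\<And>c. P (const c)"
    and m: "\<And>x i. P x \<Longrightarrow> P (x * gen i)"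
    and a: "\<And>x y. P x \<Longrightarrow> P y \<Longrightarrow> P (x + y)"
  shows "P x"
proof -
  have "finite (\<Union>w\<in>Poly_Mapping.keys x. set (letters w))" by auto
  then obtain k where "(\<Union>w\<in>Poly_Mapping.keys x. set (letters w)) \<subseteq> {..<k}"
    using finite_nat_bounded by blast
  then have "x \<in> free_carrier k" by (auto simp: free_carrier_iff)
  then show ?thesis by (induction rule: free_carrier_induct) (auto intro: c m a)
qed

section \<open>Right modules over the free algebra\<close>

locale free_action =
  fixes sc :: "'a::idom \<Rightarrow> 'm::ab_group_add \<Rightarrow> 'm" and op :: "nat \<Rightarrow> 'm \<Rightarrow> 'm"
  assumes sc_add_left: "sc (a + b) v = sc a v + sc b v"
    and sc_add: "sc a (u + v) = sc a u + sc a v"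
    and sc_mult: "sc (a * b) v = sc a (sc b v)"
    and sc_one: "sc 1 v = v"
    and op_add: "op i (u + v) = op i u + op i v"
    and op_sc: "op i (sc a v) = sc a (op i v)"
begin

text \<open>\<open>fold\<close> applies the leftmost letter first, so this is a right action. It is
  used three times: for right multiplication in a ring (\<open>reg\<close>), for the free module
  over the smaller algebra (\<open>mod\<close>), and for left multiplication in the free algebra
  (\<open>lrev\<close>), which reverses words.\<close>

definition act :: "'a free \<Rightarrow> 'm \<Rightarrow> 'm" where
  "act x v = (\<Sum>w\<in>Poly_Mapping.keys x. sc (Poly_Mapping.lookup x w) (fold op (letters w) v))"

lemma sc_zero_left: "sc 0 v = 0"
  using sc_add_left[of 0 0 v] by simp

lemma sc_zero: "sc a 0 = 0"
  using sc_add[of a 0 0] by simp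

lemma op_zero: "op i 0 = 0"
  using op_add[of i 0 0] by simp

lemma act_superset:
  assumes "finite W" "Poly_Mapping.keys x \<subseteq> W"
  shows "act x v = (\<Sum>w\<in>W. sc (Poly_Mapping.lookup x w) (fold op (letters w) v))"
  unfolding act_def
  by (rule sum.mono_neutral_left) (use assms in \<open>auto simp: in_keys_iff sc_zero_left\<close>)

lemma act_add_left: "act (x + y) v = act x v + act y v"
proof -
  let ?W = "Poly_Mapping.keys x \<union> Poly_Mapping.keys y"
  have "act (x + y) v = (\<Sum>w\<in>?W. sc (Poly_Mapping.lookup (x + y) w) (fold op (letters w) v))"
    by (rule act_superset) (use keys_add[of x y] in auto)
  also have "\<dots> = act x v + act y v"
    using act_superset[of ?W x v] act_superset[of ?W y v]
    by (simp add: lookup_add sc_add_left sum.distrib)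
  finally show ?thesis .
qed

lemma act_zero_left [simp]: "act 0 v = 0"
  by (simp add: act_def)

lemma act_uminus_left: "act (- x) v = - act x v"
  using act_add_left[of x "- x" v] by (simp add: eq_neg_iff_add_eq_0 add.commute)

lemma act_diff_left: "act (x - y) v = act x v - act y v"
  using act_add_left[of x "- y" v] by (simp add: act_uminus_left)

lemma act_sum_left: "act (sum f I) v = (\<Sum>i\<in>I. act (f i) v)"
  by (induction I rule: infinite_finite_induct) (auto simp: act_add_left)

lemma act_single: "act (Poly_Mapping.single w c) v = sc c (fold op (letters w) v)"
  by (simp add: act_def sc_zero_left)

lemma act_const [simp]: "act (const c) v = sc c v"
  by (simp add: const_def act_single)

lemma act_one [simp]: "act 1 v = v"
  using act_const[of 1 v] by (simp add: sc_one)

lemma act_gen [simp]: "act (gen i) v = op i v"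
  by (simp add: gen_def act_single sc_one)

lemma fold_op_sc: "fold op l (sc a v) = sc a (fold op l v)"
  by (induction l arbitrary: v) (simp_all add: op_sc)

lemma fold_op_add: "fold op l (u + v) = fold op l u + fold op l v"
  by (induction l arbitrary: u v) (simp_all add: op_add)

lemma act_add: "act x (u + v) = act x u + act x v"
  by (simp add: act_def fold_op_add sc_add sum.distrib)

lemma act_zero [simp]: "act x 0 = 0"
  using act_add[of x 0 0] by simp

lemma act_sum: "act x (sum f I) = (\<Sum>i\<in>I. act x (f i))"
  by (induction I rule: infinite_finite_induct) (auto simp: act_add)

lemma act_sc: "act x (sc a v) = sc a (act x v)"
proof -
  have "sc a (sum f I) = (\<Sum>i\<in>I. sc a (f i))" for f :: "word \<Rightarrow> 'm" and I
    by (induction I rule: infinite_finite_induct) (auto simp: sc_add sc_zero)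
  moreover have "sc b (sc a w) = sc a (sc b w)" for b w
    by (metis sc_mult mult.commute)
  ultimately show ?thesis by (simp add: act_def fold_op_sc)
qed

lemma act_mult_gen: "act (x * gen i) v = op i (act x v)"
proof -
  have *: "act (Poly_Mapping.single w c * gen i) v = op i (act (Poly_Mapping.single w c) v)" for w c
    by (simp add: gen_def mult_single act_single op_sc)
  have op_sum: "op i (sum f I) = (\<Sum>j\<in>I. op i (f j))" for f :: "word \<Rightarrow> 'm" and I
    by (induction I rule: infinite_finite_induct) (auto simp: op_add op_zero)
  have x: "x = (\<Sum>w\<in>Poly_Mapping.keys x. Poly_Mapping.single w (Poly_Mapping.lookup x w))"
    by (simp add: poly_mapping_sum_monomials)
  show ?thesis
    by (subst (1 2) x) (simp only: sum_distrib_right act_sum_left * op_sum)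
qed

lemma act_mult_const: "act (x * const c) v = sc c (act x v)"
proof -
  have *: "act (Poly_Mapping.single w a * const c) v = sc c (act (Poly_Mapping.single w a) v)" for w a
    by (simp add: const_def mult_single act_single sc_mult[symmetric] mult.commute)
  have sc_sum: "sc c (sum f I) = (\<Sum>j\<in>I. sc c (f j))" for f :: "word \<Rightarrow> 'm" and I
    by (induction I rule: infinite_finite_induct) (auto simp: sc_add sc_zero)
  have x: "x = (\<Sum>w\<in>Poly_Mapping.keys x. Poly_Mapping.single w (Poly_Mapping.lookup x w))"
    by (simp add: poly_mapping_sum_monomials)
  show ?thesis
    by (subst (1 2) x) (simp only: sum_distrib_right act_sum_left * sc_sum)
qed

lemma act_mult: "act (x * y) v = act y (act x v)"
proof (induction y rule: free_induct)
  case (const c)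
  then show ?case by (simp add: act_mult_const)
next
  case (snoc y i)
  then show ?case by (simp add: act_mult_gen mult.assoc[symmetric])
next
  case (add y z)
  then show ?case by (simp add: distrib_left act_add_left)
qed

end

section \<open>Cosets of the ideal of relations\<close>

definition hcoset :: "nat \<Rightarrow> 'a::idom \<Rightarrow> (nat \<Rightarrow> 'a) \<Rightarrow> nat \<Rightarrow> 'a free \<Rightarrow> 'a free set" where
  "hcoset ell q Q k x = hecke_ideal ell q Q k +>\<^bsub>free_alg k\<^esub> x"

context
  fixes ell :: nat and q :: "'a::idom" and Q :: "nat \<Rightarrow> 'a"
begin

private abbreviation (input) "I k \<equiv> hecke_ideal ell q Q k"
private abbreviation (input) "H k \<equiv> hecke ell q Q k"
private abbreviation (input) "co k \<equiv> hcoset ell q Q k"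

lemma hecke_rels_carrier: "hecke_rels ell q Q k \<subseteq> free_carrier k"
  unfolding hecke_rels_def
  by (auto intro!: free_carrier_diff free_carrier_mult free_carrier_add free_carrier_gen
      free_carrier_prod_list split: if_splits)

lemma hecke_ideal_ideal: "ideal (I k) (free_alg k)"
  unfolding hecke_ideal_def
  by (rule ring.genideal_ideal[OF free_alg_ring hecke_rels_carrier])

lemma hecke_rels_ideal: "hecke_rels ell q Q k \<subseteq> I k"
  unfolding hecke_ideal_def by (rule ring.genideal_self[OF free_alg_ring hecke_rels_carrier])

lemma free_alg_idealI:
  assumes "J \<subseteq> free_carrier k" "(0 :: 'a free) \<in> J" "\<And>x y. x \<in> J \<Longrightarrow> y \<in> J \<Longrightarrow> x + y \<in> J"
    and "\<And>x y. x \<in> J \<Longrightarrow> y \<in> free_carrier k \<Longrightarrow> y * x \<in> J"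
    and "\<And>x y. x \<in> J \<Longrightarrow> y \<in> free_carrier k \<Longrightarrow> x * y \<in> J"
  shows "ideal J (free_alg k)"
proof (rule idealI[OF free_alg_ring])
  interpret ring "free_alg k :: 'a free ring" by (rule free_alg_ring)
  have inv: "\<ominus>\<^bsub>free_alg k\<^esub> x = - x" if "x \<in> free_carrier k" for x :: "'a free"
    using that minus_equality[of "- x" x] by (auto simp: free_carrier_uminus)
  have neg: "- x \<in> J" if "x \<in> J" for x
    using assms(4)[OF that, of "- 1"] by (simp add: free_carrier_uminus)
  have "inv\<^bsub>add_monoid (free_alg k)\<^esub> x = - x" if "x \<in> J" for x
    using inv[of x] that assms(1) by (auto simp: a_inv_def)
  then show "subgroup J (add_monoid (free_alg k))"
    by (intro subgroup.intro) (use assms neg in auto)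
qed (use assms in auto)

text \<open>The polynomials with \<open>P\<close> form an ideal containing the relators, and
  \<open>hecke_ideal\<close> is the least such ideal. This avoids writing its elements as sums of
  multiples of relators.\<close>

lemma hecke_ideal_induct [consumes 1, case_names rel zero add left right]:
  assumes x: "x \<in> I k"
    and "\<And>x. x \<in> hecke_rels ell q Q k \<Longrightarrow> P x" "P 0"
    and "\<And>x y. P x \<Longrightarrow> P y \<Longrightarrow> P (x + y)"
    and "\<And>x y. x \<in> free_carrier k \<Longrightarrow> y \<in> free_carrier k \<Longrightarrow> P x \<Longrightarrow> P (y * x)"
    and "\<And>x y. x \<in> free_carrier k \<Longrightarrow> y \<in> free_carrier k \<Longrightarrow> P x \<Longrightarrow> P (x * y)"
  shows "P x"
proof -
  have "ideal {x \<in> free_carrier k. P x} (free_alg k)"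
    by (rule free_alg_idealI) (use assms in auto)
  moreover have "hecke_rels ell q Q k \<subseteq> {x \<in> free_carrier k. P x}"
    using hecke_rels_carrier assms(2) by auto
  ultimately have "I k \<subseteq> {x \<in> free_carrier k. P x}"
    unfolding hecke_ideal_def by (rule ring.genideal_minimal[OF free_alg_ring])
  with x show ?thesis by auto
qed

lemma hecke_ideal_add: "x \<in> I k \<Longrightarrow> y \<in> I k \<Longrightarrow> x + y \<in> I k"
  using additive_subgroup.a_closed[OF ideal.axioms(1)[OF hecke_ideal_ideal], of x k y] by simp

lemma hecke_ideal_zero: "0 \<in> I k"
  using additive_subgroup.zero_closed[OF ideal.axioms(1)[OF hecke_ideal_ideal], of k] by simp

text \<open>The set of relators only grows with the number of generators. This is what makes
  \<open>hemb\<close> send the coset of a polynomial to its coset in the larger algebra.\<close>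

lemma hecke_ideal_mono:
  assumes "k \<le> m" shows "I k \<subseteq> I m"
proof -
  interpret J: ideal "I m" "free_alg m :: 'a free ring" by (rule hecke_ideal_ideal)
  have rels: "hecke_rels ell q Q k \<subseteq> hecke_rels ell q Q m"
    unfolding hecke_rels_def
    by (intro Un_mono)
       (use assms in \<open>(auto split: if_splits)[2], (blast intro: order_less_le_trans)+\<close>)
  have "x \<in> I m" if "x \<in> I k" for x
    using that
  proof (induction rule: hecke_ideal_induct)
    case (rel x)
    then show ?case using rels hecke_rels_ideal by blast
  next
    case zero
    then show ?case by (rule hecke_ideal_zero)
  next
    case (add x y)
    then show ?case using hecke_ideal_add by simp
  next
    case (left x y)
    then show ?case using J.I_l_closed[of x y] assms by (simp add: free_carrier_mono)
  next
    case (right x y)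
    then show ?case using J.I_r_closed[of x y] assms by (simp add: free_carrier_mono)
  qed
  then show ?thesis by auto
qed

lemma hecke_ring: "ring (H k)"
  unfolding hecke_def by (rule ideal.quotient_is_ring[OF hecke_ideal_ideal])

lemma carrier_hecke: "carrier (H k) = co k ` free_carrier k"
  by (auto simp: hecke_def FactRing_def A_RCOSETS_def' hcoset_def)

lemma hcoset_carrier [simp, intro]: "x \<in> free_carrier k \<Longrightarrow> co k x \<in> carrier (H k)"
  by (simp add: carrier_hecke)

lemma hcoset_ring_hom: "co k \<in> ring_hom (free_alg k) (H k)"
  using ideal.rcos_ring_hom[OF hecke_ideal_ideal]
  by (simp add: hcoset_def[abs_def] hecke_def)

lemma hcoset_mult:
  "x \<in> free_carrier k \<Longrightarrow> y \<in> free_carrier k \<Longrightarrow> co k (x * y) = co k x \<otimes>\<^bsub>H k\<^esub> co k y"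
  using ring_hom_mult[OF hcoset_ring_hom, of x k y] by simp

lemma hcoset_add:
  "x \<in> free_carrier k \<Longrightarrow> y \<in> free_carrier k \<Longrightarrow> co k (x + y) = co k x \<oplus>\<^bsub>H k\<^esub> co k y"
  using ring_hom_add[OF hcoset_ring_hom, of x k y] by simp

lemma hcoset_one: "co k 1 = \<one>\<^bsub>H k\<^esub>"
  using ring_hom_one[OF hcoset_ring_hom, of k] by simp

lemma hcoset_zero: "co k 0 = \<zero>\<^bsub>H k\<^esub>"
  using ring_hom_zero[OF hcoset_ring_hom free_alg_ring hecke_ring, of k] by simp

lemma hcoset_eq_iff:
  assumes "x \<in> free_carrier k" "y \<in> free_carrier k"
  shows "co k x = co k y \<longleftrightarrow> x - y \<in> I k"
proof -
  interpret J: ideal "I k" "free_alg k :: 'a free ring" by (rule hecke_ideal_ideal)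
  have diff: "u \<ominus>\<^bsub>free_alg k\<^esub> v = u - v" if "u \<in> free_carrier k" "v \<in> free_carrier k"
    for u v :: "'a free"
  proof -
    have "\<ominus>\<^bsub>free_alg k\<^esub> v = - v"
      using that J.minus_equality[of "- v" v] by (auto simp: free_carrier_uminus)
    then show ?thesis by (simp add: a_minus_def)
  qed
  have "x - y \<in> I k \<longleftrightarrow> x \<in> I k +>\<^bsub>free_alg k\<^esub> y"
    using J.a_rcos_module_minus[of y x] J.ring_axioms assms diff[of x y] free_alg_ring by simp
  also have "\<dots> \<longleftrightarrow> co k x = co k y"
    unfolding hcoset_def
    using J.a_repr_independence'[of x y] J.a_rcos_self[of x] assms by auto
  finally show ?thesis by simp
qed

lemma hcoset_uminus:
  assumes "x \<in> free_carrier k" shows "co k (- x) = \<ominus>\<^bsub>H k\<^esub> co k x"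
proof -
  interpret ring "H k" by (rule hecke_ring)
  have "co k (- x) \<oplus>\<^bsub>H k\<^esub> co k x = \<zero>\<^bsub>H k\<^esub>"
    using assms hcoset_add[of "- x" k x] by (simp add: free_carrier_uminus hcoset_zero)
  then show ?thesis using assms minus_equality by (metis free_carrier_uminus hcoset_carrier)
qed

lemma hcoset_diff:
  "x \<in> free_carrier k \<Longrightarrow> y \<in> free_carrier k \<Longrightarrow> co k (x - y) = co k x \<ominus>\<^bsub>H k\<^esub> co k y"
  using hcoset_add[of x k "- y"] by (simp add: a_minus_def hcoset_uminus free_carrier_uminus)

lemma hcoset_sum:
  assumes "finite J" "\<And>i. i \<in> J \<Longrightarrow> f i \<in> free_carrier k"
  shows "co k (sum f J) = (\<Oplus>\<^bsub>H k\<^esub>i\<in>J. co k (f i))"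
proof -
  interpret ring "H k" by (rule hecke_ring)
  show ?thesis using assms
  proof (induction J rule: finite_induct)
    case empty
    then show ?case by (simp add: hcoset_zero)
  next
    case (insert i J)
    then show ?case by (simp add: hcoset_add free_carrier_sum finsum_insert Pi_def)
  qed
qed

lemma hcoset_pow:
  "x \<in> free_carrier k \<Longrightarrow> co k (x ^ m) = co k x [^]\<^bsub>H k\<^esub> m"
proof (induction m)
  case 0
  then show ?case by (simp add: hcoset_one)
next
  case (Suc m)
  have "x ^ m \<in> free_carrier k" for m
    using Suc.prems by (induction m) auto
  with Suc show ?case
    by (simp add: hcoset_mult power_Suc2 del: power_Suc)
qed

lemma hcoset_prod_list:
  "set xs \<subseteq> free_carrier k \<Longrightarrow> co k (prod_list xs) = list_mult (H k) (map (co k) xs)"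
proof (induction xs)
  case Nil
  then show ?case by (simp add: hcoset_one list_mult_def)
next
  case (Cons x xs)
  then show ?case
    by (simp add: hcoset_mult list_mult_def free_carrier_prod_list subset_iff)
qed

lemma hT_eq: "hT ell q Q k i = co k (gen i)"
  by (simp add: hT_def hcoset_def)

lemma hsmult_hcoset: "x \<in> free_carrier k \<Longrightarrow> hsmult ell q Q k c (co k x) = co k (const c * x)"
  by (simp add: hsmult_def hcoset_mult hcoset_def[symmetric])

lemma hemb_hcoset:
  assumes "x \<in> free_carrier m" "m \<le> k"
  shows "hemb ell q Q k (co m x) = co k x"
proof -
  interpret J: ideal "I k" "free_alg k :: 'a free ring" by (rule hecke_ideal_ideal)
  interpret J': ideal "I m" "free_alg m :: 'a free ring" by (rule hecke_ideal_ideal)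
  have "a + b \<in> I k" if "a \<in> I k" "b \<in> I m" for a b
    using that hecke_ideal_mono[OF assms(2)] hecke_ideal_add by auto
  moreover have "0 \<in> I m" by (rule hecke_ideal_zero)
  ultimately show ?thesis
    by (auto simp: hemb_def hcoset_def set_add_def' a_r_coset_def' add.assoc[symmetric])
qed

end

text \<open>
  The product of all the algebras over \<^typ>\<open>'a\<close>. Unlike a single \<^const>\<open>hecke\<close> algebra it can be a type,
  so that computations in a Hecke algebra become computations in a type of class \<^class>\<open>ring_1\<close>.
\<close>

type_synonym 'a param = "nat \<times> nat \<times> 'a \<times> (nat \<Rightarrow> 'a)"

definition param_hecke :: "'a::idom param \<Rightarrow> 'a free set ring" where
  "param_hecke p = (case p of (k, ell, q, Q) \<Rightarrow> hecke ell q Q k)"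

lemma param_hecke_ring: "ring (param_hecke p)"
  by (cases p) (simp add: param_hecke_def hecke_ring)

typedef (overloaded) 'a hfam =
  "{F :: 'a::idom param \<Rightarrow> 'a free set. \<forall>p. F p \<in> carrier (param_hecke p)}"
  morphisms hproj Abs_hfam
proof -
  have "(\<lambda>p. \<zero>\<^bsub>param_hecke p\<^esub>) p \<in> carrier (param_hecke p)" for p :: "'a param"
    by (rule ring.ring_simprules(2)[OF param_hecke_ring])
  then show ?thesis by (intro exI CollectI allI)
qed

setup_lifting type_definition_hfam

lemma hproj_carrier [simp]: "hproj x p \<in> carrier (param_hecke p)"
  using hproj[of x] by (simp del: split_paired_All)

text \<open>The class \<open>ring_1\<close> demands \<open>0 \<noteq> 1\<close>. For a product one
  nontrivial component suffices, and with no generators there are no relators, so the ideal is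
  zero.\<close>

lemma zero_neq_one_hecke_0: "\<zero>\<^bsub>hecke ell q Q 0\<^esub> \<noteq> \<one>\<^bsub>hecke ell q Q 0\<^esub>"
proof -
  have rels: "hecke_rels ell q Q 0 = {}" by (auto simp: hecke_rels_def)
  have x: "x = 0" if "x \<in> hecke_ideal ell q Q 0" for x
    using that by (induction rule: hecke_ideal_induct) (auto simp: rels)
  show ?thesis
    using hcoset_eq_iff[of 0 0 1 ell q Q] x[of "- 1"] by (auto simp: hcoset_zero hcoset_one)
qed

instantiation hfam :: (idom) ring_1
begin

lift_definition zero_hfam :: "'a hfam" is "\<lambda>p. \<zero>\<^bsub>param_hecke p\<^esub>"
  by (simp add: ring.ring_simprules(2)[OF param_hecke_ring])

lift_definition one_hfam :: "'a hfam" is "\<lambda>p. \<one>\<^bsub>param_hecke p\<^esub>"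
  by (simp add: ring.ring_simprules(6)[OF param_hecke_ring])

lift_definition plus_hfam :: "'a hfam \<Rightarrow> 'a hfam \<Rightarrow> 'a hfam" is "\<lambda>x y p. x p \<oplus>\<^bsub>param_hecke p\<^esub> y p"
  by (simp add: ring.ring_simprules(1)[OF param_hecke_ring])

lift_definition times_hfam :: "'a hfam \<Rightarrow> 'a hfam \<Rightarrow> 'a hfam" is "\<lambda>x y p. x p \<otimes>\<^bsub>param_hecke p\<^esub> y p"
  by (simp add: ring.ring_simprules(5)[OF param_hecke_ring])

lift_definition uminus_hfam :: "'a hfam \<Rightarrow> 'a hfam" is "\<lambda>x p. \<ominus>\<^bsub>param_hecke p\<^esub> x p"
  by (simp add: ring.ring_simprules(3)[OF param_hecke_ring])

lift_definition minus_hfam :: "'a hfam \<Rightarrow> 'a hfam \<Rightarrow> 'a hfam" is "\<lambda>x y p. x p \<ominus>\<^bsub>param_hecke p\<^esub> y p"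
  by (simp add: ring.ring_simprules(4)[OF param_hecke_ring])

instance
proof
  fix a b c :: "'a hfam"
  note r = ring.ring_simprules[OF param_hecke_ring]
  show "a + b + c = a + (b + c)" by transfer (simp add: r fun_eq_iff)
  show "a + b = b + a" by transfer (simp add: r fun_eq_iff)
  show "0 + a = a" by transfer (simp add: r fun_eq_iff)
  show "- a + a = 0" by transfer (simp add: r fun_eq_iff)
  show "a - b = a + - b" by transfer (simp add: r fun_eq_iff)
  show "a * b * c = a * (b * c)" by transfer (simp add: r fun_eq_iff)
  show "1 * a = a" by transfer (simp add: r fun_eq_iff)
  show "a * 1 = a"
    by transfer (simp add: fun_eq_iff monoid.r_one[OF ring.is_monoid[OF param_hecke_ring]])
  show "(a + b) * c = a * c + b * c" by transfer (simp add: r fun_eq_iff)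
  show "a * (b + c) = a * b + a * c"
    by transfer (simp add: fun_eq_iff ring.ring_simprules(23)[OF param_hecke_ring])
  have "\<zero>\<^bsub>param_hecke (0, 0, 0, \<lambda>_. 0)\<^esub> \<noteq> \<one>\<^bsub>param_hecke (0, 0, 0, \<lambda>_. 0 :: 'a)\<^esub>"
    by (simp add: param_hecke_def zero_neq_one_hecke_0)
  then show "(0 :: 'a hfam) \<noteq> 1" by transfer (metis (mono_tags))
qed

end

subsection \<open>Jucys--Murphy elements\<close>

lemma commute_left: "a * b = b * a \<Longrightarrow> a * (b * c) = b * (a * c)"
  for a b c :: "'a::semigroup_mult"
  by (metis mult.assoc)

lemma braid_left: "a * b * a = b * a * b \<Longrightarrow> a * (b * (a * c)) = b * (a * (b * c))"
  for a b c :: "'a::semigroup_mult"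
  by (metis mult.assoc)

text \<open>An abstract ring with the relations of \<open>hecke_rels k\<close>: \<open>S\<close> is
  the structure map of the scalars, \<open>qi\<close> the inverse of \<open>q\<close>. The relations
  constrain only the \<open>T i\<close> with \<open>i < k\<close>.\<close>

locale hecke_gens =
  fixes S :: "'a::idom \<Rightarrow> 'b::ring_1" and T :: "nat \<Rightarrow> 'b"
    and q qi :: 'a and Q :: "nat \<Rightarrow> 'a" and ell k :: nat
  assumes S_add: "S (a + b) = S a + S b" and S_mult: "S (a * b) = S a * S b" and S_one: "S 1 = 1"
    and S_central: "S a * x = x * S a"
    and q_qi: "q * qi = 1"
    and ell_pos: "1 \<le> ell"
    and T_cyc: "1 \<le> k \<Longrightarrow> prod_list (map (\<lambda>i. T 0 - S (Q i)) [1..<Suc ell]) = 0"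
    and T_four: "2 \<le> k \<Longrightarrow> T 0 * T 1 * T 0 * T 1 = T 1 * T 0 * T 1 * T 0"
    and T_quad: "1 \<le> i \<Longrightarrow> i < k \<Longrightarrow> (T i - S q) * (T i + 1) = 0"
    and T_comm: "i + 1 < j \<Longrightarrow> j < k \<Longrightarrow> T i * T j = T j * T i"
    and T_braid: "1 \<le> i \<Longrightarrow> i + 1 < k \<Longrightarrow> T i * T (i + 1) * T i = T (i + 1) * T i * T (i + 1)"
begin

definition kap :: 'b where "kap = S q - 1"

fun L :: "nat \<Rightarrow> 'b" where
  "L 0 = 0"
| "L (Suc 0) = T 0"
| "L (Suc (Suc m)) = S qi * (T (Suc m) * L (Suc m) * T (Suc m))"

lemma S_zero: "S 0 = 0"
  using S_add[of 0 0] by simp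

lemma S_uminus: "S (- a) = - S a"
  using S_add[of a "- a"] by (simp add: S_zero eq_neg_iff_add_eq_0 add.commute)

lemma S_q_qi: "S q * S qi = 1"
  by (metis q_qi S_mult S_one)

lemma S_qi_q: "S qi * S q = 1"
  by (metis S_q_qi S_central)

lemma kap_central: "kap * x = x * kap"
  by (simp add: kap_def left_diff_distrib right_diff_distrib S_central[of q])

lemma kap_left_commute: "x * (kap * y) = kap * (x * y)"
  by (metis kap_central mult.assoc)

lemma S_left_commute: "x * (S a * y) = S a * (x * y)"
  by (metis S_central mult.assoc)

lemma T_square: "1 \<le> i \<Longrightarrow> i < k \<Longrightarrow> T i * T i = kap * T i + S q"
  using T_quad[of i] by (simp add: kap_def algebra_simps)

lemma T_commute:
  assumes "i + 1 < j \<or> j + 1 < i" "i < k" "j < k"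
  shows "T i * T j = T j * T i"
  using assms T_comm[of i j] T_comm[of j i] by auto

text \<open>Induction along \<open>L j = qi * T (j-1) * L (j-1) * T (j-1)\<close>. All factors
  commute with \<open>T i\<close> separately except when \<open>i = j - 2\<close>. In that case
  unfolding \<open>L (j-1)\<close> once more brings in the braid relation, and for
  \<open>j = 2\<close> the claim is the relation of length four.\<close>

lemma T_comm_L:
  assumes "i < k" "1 \<le> j" "j \<le> k" "i \<noteq> j" "Suc i \<noteq> j"
  shows "T i * L j = L j * T i"
  using assms
proof (induction j arbitrary: i rule: less_induct)
  case (less j)
  then consider "j = 1" | m where "j = Suc (Suc m)"
    by (metis One_nat_def Suc_le_D not0_implies_Suc)
  then show ?case
  proof cases
    case 1
    with less.prems show ?thesis using T_commute[of i 0] by auto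
  next
    case (2 m)
    let ?t = "T (Suc m)" and ?l = "L (Suc m)"
    have Lj: "L j = S qi * (?t * ?l * ?t)" using 2 by simp
    have "T i * (?t * ?l * ?t) = (?t * ?l * ?t) * T i"
    proof (cases "i = m")
      case False
      then have "i + 1 < Suc m \<or> Suc m + 1 < i"
        using less.prems 2 by linarith
      then have "T i * ?t = ?t * T i"
        using T_commute[of i "Suc m"] less.prems 2 by simp
      moreover have "T i * ?l = ?l * T i"
        using less.IH[of "Suc m" i] less.prems 2 False by auto
      ultimately show ?thesis by (metis mult.assoc)
    next
      case True
      show ?thesis
      proof (cases m)
        case 0
        then show ?thesis using True T_four less.prems 2 by (simp add: mult.assoc)
      next
        case (Suc p)
        let ?a = "T m" and ?y = "L m"
        have l: "?l = S qi * (?a * ?y * ?a)" using Suc by simp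
        have br: "?a * ?t * ?a = ?t * ?a * ?t"
          using T_braid[of m] less.prems 2 Suc by auto
        have cm: "?t * ?y = ?y * ?t"
          using less.IH[of m "Suc m"] less.prems 2 Suc by simp
        have "?a * (?t * (?a * ?y * ?a) * ?t) = ?t * (?a * (?t * (?y * (?a * ?t))))"
          by (simp add: mult.assoc braid_left[OF br])
        also have "\<dots> = ?t * ?a * ?y * (?t * ?a * ?t)"
          by (simp add: mult.assoc commute_left[OF cm])
        also have "?t * ?a * ?t = ?a * ?t * ?a"
          by (simp add: br)
        finally show ?thesis
          using True by (simp add: l mult.assoc S_left_commute)
      qed
    qed
    then show ?thesis
      by (simp add: Lj mult.assoc S_left_commute)
  qed
qed

lemma L_Suc: "1 \<le> i \<Longrightarrow> L (Suc i) = S qi * (T i * L i * T i)"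
  by (cases i) auto

lemma L_Suc_T:
  assumes "1 \<le> i" "i < k"
  shows "L (Suc i) * T i = T i * L i + kap * L (Suc i)"
proof -
  have "L (Suc i) * T i = S qi * (T i * L i * (T i * T i))"
    using assms by (simp add: L_Suc mult.assoc)
  also have "\<dots> = kap * (S qi * (T i * L i * T i)) + S qi * (T i * L i * S q)"
    using assms by (simp add: T_square distrib_left mult.assoc kap_left_commute)
  also have "S qi * (T i * L i * S q) = S qi * S q * (T i * L i)"
    by (simp add: mult.assoc S_central[of q])
  finally show ?thesis using assms by (simp add: L_Suc S_qi_q)
qed

lemma T_L_Suc:
  assumes "1 \<le> i" "i < k"
  shows "T i * L (Suc i) = L i * T i + kap * L (Suc i)"
proof -
  have "T i * L (Suc i) = S qi * ((T i * T i) * (L i * T i))"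
    using assms by (simp add: L_Suc mult.assoc S_left_commute)
  also have "\<dots> = kap * (S qi * (T i * L i * T i)) + S qi * S q * (L i * T i)"
    using assms by (simp add: T_square distrib_left distrib_right mult.assoc kap_left_commute)
  finally show ?thesis using assms by (simp add: L_Suc S_qi_q)
qed

lemma L_comm_L:
  assumes "i \<le> k" "j \<le> k"
  shows "L i * L j = L j * L i"
proof -
  have less: "L i * L j = L j * L i" if "i < j" "j \<le> k" for i j
    using that
  proof (induction i rule: L.induct)
    case 2
    then show ?case using T_comm_L[of 0 j] by auto
  next
    case (3 m)
    then have "L (Suc m) * L j = L j * L (Suc m)" "T (Suc m) * L j = L j * T (Suc m)"
      using T_comm_L[of "Suc m" j] by auto
    then have "(T (Suc m) * L (Suc m) * T (Suc m)) * L j = L j * (T (Suc m) * L (Suc m) * T (Suc m))"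
      by (metis mult.assoc)
    then show ?case by (simp add: mult.assoc S_left_commute)
  qed simp
  then show ?thesis using assms by (metis nat_neq_iff)
qed

lemma L_power_comm: "i \<le> k \<Longrightarrow> j \<le> k \<Longrightarrow> L i ^ a * L j ^ b = L j ^ b * L i ^ a"
  by (intro power_commuting_commutes L_comm_L[symmetric] power_commuting_commutes[symmetric] L_comm_L)

text \<open>Iteration of \<open>L_Suc_T\<close>. The sum starts at \<open>e = 1\<close>, so every
  correction term contains a positive power of \<open>L (Suc i)\<close>; this keeps such terms in
  the kernel of the descending map.\<close>

lemma L_power_T:
  assumes "1 \<le> i" "i < k"
  shows "L (Suc i) ^ d * T i = T i * L i ^ d + kap * (\<Sum>e=1..d. L i ^ (d - e) * L (Suc i) ^ e)"
proof (induction d)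
  case (Suc d)
  let ?y = "L i" and ?z = "L (Suc i)" and ?s = "\<lambda>d. \<Sum>e=1..d. L i ^ (d - e) * L (Suc i) ^ e"
  have zy: "?z ^ n * ?y = ?y * ?z ^ n" for n
    using L_power_comm[of "Suc i" i n 1] assms by simp
  have s: "?s d * ?y = (\<Sum>e=1..d. ?y ^ (Suc d - e) * ?z ^ e)"
  proof -
    have "?y ^ (d - e) * ?z ^ e * ?y = ?y ^ (Suc d - e) * ?z ^ e" if "e \<in> {1..d}" for e
      using that zy[of e] by (simp add: mult.assoc Suc_diff_le power_Suc2 del: power_Suc)
    then show ?thesis unfolding sum_distrib_right by (intro sum.cong refl) blast
  qed
  have "?z ^ Suc d * T i = ?z ^ d * (T i * ?y + kap * ?z)"
    using assms by (simp add: power_Suc2 mult.assoc L_Suc_T del: power_Suc)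
  also have "\<dots> = (?z ^ d * T i) * ?y + kap * (?z ^ Suc d)"
    by (simp add: distrib_left kap_left_commute mult.assoc power_Suc2 del: power_Suc)
  also have "\<dots> = T i * ?y ^ Suc d + kap * (?s d * ?y + ?z ^ Suc d)"
    by (simp add: Suc.IH distrib_right distrib_left mult.assoc power_Suc2 del: power_Suc)
  also have "?s d * ?y + ?z ^ Suc d = ?s (Suc d)"
    unfolding s by simp
  finally show ?case .
qed simp

lemma T_L_power:
  assumes "1 \<le> i" "i < k"
  shows "T i * L i ^ d = L (Suc i) ^ d * T i - kap * (\<Sum>e=1..d. L i ^ (d - e) * L (Suc i) ^ e)"
  using L_power_T[OF assms, of d] by simp

text \<open>\<open>T i\<close> commutes with the sum and with the product of \<open>L i\<close> and
  \<open>L (Suc i)\<close>, hence with every symmetric expression in them.\<close>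

lemma T_comm_L_pair:
  assumes "1 \<le> i" "i < k"
  shows "T i * ((L i - S c) * (L (Suc i) - S c)) = (L i - S c) * (L (Suc i) - S c) * T i"
proof -
  let ?y = "L i" and ?z = "L (Suc i)"
  have yz: "?y * ?z = ?z * ?y" using assms by (simp add: L_comm_L)
  have "T i * ?y * ?z = (?z * T i - kap * ?z) * ?z"
    using L_Suc_T[OF assms] by simp
  also have "\<dots> = ?z * (?y * T i + kap * ?z) - kap * ?z * ?z"
    by (simp add: left_diff_distrib mult.assoc T_L_Suc[OF assms])
  also have "\<dots> = ?y * ?z * T i"
    by (simp add: distrib_left kap_left_commute mult.assoc yz)
  finally have 1: "T i * (?y * ?z) = ?y * ?z * T i" by (simp add: mult.assoc)
  have 2: "T i * (?y + ?z) = (?y + ?z) * T i"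
    by (simp add: distrib_left distrib_right L_Suc_T[OF assms] T_L_Suc[OF assms] algebra_simps)
  have 3: "(?y - S c) * (?z - S c) = ?y * ?z - S c * (?y + ?z) + S c * S c"
    by (simp add: algebra_simps S_central[of c ?y])
  have 4: "T i * (S c * (?y + ?z)) = S c * (?y + ?z) * T i"
    using 2 by (simp only: S_left_commute mult.assoc)
  have 5: "T i * (S c * S c) = S c * S c * T i"
    using S_central[of "c * c" "T i"] by (simp add: S_mult)
  show ?thesis
    unfolding 3
    by (simp only: distrib_left[of "T i"] distrib_right[of _ _ "T i"] right_diff_distrib
        left_diff_distrib 1 4 5)
qed

subsection \<open>The subalgebras generated by the first generators\<close>

text \<open>Only appending a generator is a rule, in accordance with
  \<open>free_carrier_induct\<close>; closure under products is then
  \<open>sub_mult\<close>.\<close>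

inductive_set sub :: "nat \<Rightarrow> 'b set" for m where
  sub_S: "S c \<in> sub m"
| sub_T: "x \<in> sub m \<Longrightarrow> i < m \<Longrightarrow> x * T i \<in> sub m"
| sub_add: "x \<in> sub m \<Longrightarrow> y \<in> sub m \<Longrightarrow> x + y \<in> sub m"

lemma sub_one: "1 \<in> sub m"
  using sub_S[of 1] by (simp add: S_one)

lemma sub_zero: "0 \<in> sub m"
  using sub_S[of 0] by (simp add: S_zero)

lemma sub_gen: "i < m \<Longrightarrow> T i \<in> sub m"
  using sub_T[OF sub_one] by simp

lemma sub_mult: assumes "x \<in> sub m" "y \<in> sub m" shows "x * y \<in> sub m"
  using assms(2)
proof (induction rule: sub.induct)
  case (sub_S c)
  show ?case using assms(1)
  proof (induction rule: sub.induct)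
    case (sub_S c')
    show ?case by (metis S_mult sub.sub_S)
  next
    case (sub_T x i)
    then show ?case by (metis sub.sub_T S_central mult.assoc)
  qed (simp add: distrib_right sub.sub_add)
next
  case (sub_T y i)
  then show ?case by (simp add: mult.assoc[symmetric] sub.sub_T)
qed (simp add: distrib_left sub.sub_add)

lemma sub_uminus: "x \<in> sub m \<Longrightarrow> - x \<in> sub m"
  using sub_mult[OF sub_S[of "- 1"], of x m] by (simp add: S_uminus S_one)

lemma sub_diff: "x \<in> sub m \<Longrightarrow> y \<in> sub m \<Longrightarrow> x - y \<in> sub m"
  using sub_add[OF _ sub_uminus, of x m y] by simp

lemma sub_sum: "(\<And>i. i \<in> I \<Longrightarrow> f i \<in> sub m) \<Longrightarrow> sum f I \<in> sub m"
  by (induction I rule: infinite_finite_induct) (auto intro: sub_add sub_zero)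

lemma sub_prod_list: "(\<And>x. x \<in> set xs \<Longrightarrow> x \<in> sub m) \<Longrightarrow> prod_list xs \<in> sub m"
  by (induction xs) (auto intro: sub_mult sub_one)

lemma sub_power: "x \<in> sub m \<Longrightarrow> x ^ n \<in> sub m"
  by (induction n) (auto intro: sub_mult sub_one)

lemma sub_mono: "x \<in> sub m \<Longrightarrow> m \<le> n \<Longrightarrow> x \<in> sub n"
  by (induction rule: sub.induct) (auto intro: sub.intros)

lemma sub_kap: "kap \<in> sub m"
  unfolding kap_def by (intro sub_diff sub_S sub_one)

lemma sub_L: "i \<le> m \<Longrightarrow> L i \<in> sub m"
  by (induction i rule: L.induct) (auto intro!: sub_zero sub_gen sub_mult sub_S)

lemma sub_commute:
  assumes "x \<in> sub m" "\<And>i. i < m \<Longrightarrow> T i * y = y * T i"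
  shows "x * y = y * x"
  using assms
proof (induction rule: sub.induct)
  case (sub_S c)
  then show ?case by (simp add: S_central)
next
  case (sub_T x i)
  then show ?case by (metis mult.assoc)
qed (simp add: distrib_left distrib_right)

lemma sub_comm_T: "x \<in> sub m \<Longrightarrow> m < j \<Longrightarrow> j < k \<Longrightarrow> x * T j = T j * x"
  by (rule sub_commute) (auto intro: T_commute)

lemma sub_comm_L: "x \<in> sub m \<Longrightarrow> m < j \<Longrightarrow> j \<le> k \<Longrightarrow> x * L j = L j * x"
  by (rule sub_commute) (auto intro: T_comm_L)

lemma sub_comm_L_power: "x \<in> sub m \<Longrightarrow> m < j \<Longrightarrow> j \<le> k \<Longrightarrow> x * L j ^ d = L j ^ d * x"
  by (metis power_commuting_commutes sub_comm_L)

text \<open>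
  \<open>AP m d\<close> is the sum of the bimodule \<open>A T\<^sub>m A\<close> and of the \<open>A L\<^sub>m\<^sub>+\<^sub>1\<^sup>j\<close> with \<open>1 \<le> j \<le> d\<close>, where
  \<open>A = sub m\<close>: for \<open>d < ell\<close> it lies in the kernel of the descending map.
\<close>

inductive_set AP :: "nat \<Rightarrow> nat \<Rightarrow> 'b set" for m d where
  AP_zero: "0 \<in> AP m d"
| AP_T: "x \<in> AP m d \<Longrightarrow> 0 < m \<Longrightarrow> a \<in> sub m \<Longrightarrow> b \<in> sub m \<Longrightarrow> x + a * T m * b \<in> AP m d"
| AP_L: "x \<in> AP m d \<Longrightarrow> 0 < j \<Longrightarrow> j \<le> d \<Longrightarrow> a \<in> sub m \<Longrightarrow> x + a * L (Suc m) ^ j \<in> AP m d"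

lemma AP_T': "0 < m \<Longrightarrow> a \<in> sub m \<Longrightarrow> b \<in> sub m \<Longrightarrow> a * T m * b \<in> AP m d"
  using AP_T[OF AP_zero] by simp

lemma AP_L': "0 < j \<Longrightarrow> j \<le> d \<Longrightarrow> a \<in> sub m \<Longrightarrow> a * L (Suc m) ^ j \<in> AP m d"
  using AP_L[OF AP_zero] by simp

lemma AP_L_one: "x \<in> AP m d \<Longrightarrow> 0 < d \<Longrightarrow> a \<in> sub m \<Longrightarrow> x + a * L (Suc m) \<in> AP m d"
  using AP_L[of x m d 1] by simp

lemma AP_add: assumes "x \<in> AP m d" "y \<in> AP m d" shows "x + y \<in> AP m d"
  using assms(2) by (induction rule: AP.induct) (auto intro: AP.intros assms(1) simp: add.assoc[symmetric])

lemma AP_left: "x \<in> AP m d \<Longrightarrow> c \<in> sub m \<Longrightarrow> c * x \<in> AP m d"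
  by (induction rule: AP.induct)
     (auto simp: distrib_left mult.assoc[symmetric] intro: AP.intros sub_mult)

lemma AP_right:
  assumes "m < k"
  shows "x \<in> AP m d \<Longrightarrow> c \<in> sub m \<Longrightarrow> x * c \<in> AP m d"
proof (induction rule: AP.induct)
  case (AP_T x a b)
  then show ?case
    using AP.AP_T[of "x * c" m d a "b * c"] by (simp add: distrib_right mult.assoc sub_mult)
next
  case (AP_L x j a)
  have "L (Suc m) ^ j * c = c * L (Suc m) ^ j"
    using sub_comm_L_power[of c m "Suc m" j] AP_L assms by simp
  then show ?case
    using AP.AP_L[of "x * c" m d j "a * c"] AP_L by (simp add: distrib_right mult.assoc sub_mult)
qed (auto intro: AP.intros)

lemma AP_mono: "x \<in> AP m d \<Longrightarrow> d \<le> e \<Longrightarrow> x \<in> AP m e"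
  by (induction rule: AP.induct) (auto intro: AP.intros)

lemma AP_uminus: "x \<in> AP m d \<Longrightarrow> - x \<in> AP m d"
  using AP_left[of x m d "- 1"] by (simp add: sub_uminus sub_one)

lemma AP_diff: "x \<in> AP m d \<Longrightarrow> y \<in> AP m d \<Longrightarrow> x - y \<in> AP m d"
  using AP_add[OF _ AP_uminus, of x m d y] by simp

lemma AP_sum: "(\<And>j. j \<in> J \<Longrightarrow> f j \<in> AP m d) \<Longrightarrow> sum f J \<in> AP m d"
  by (induction J rule: infinite_finite_induct) (auto intro: AP_add AP_zero)

text \<open>A power of \<open>L (Suc m)\<close> rises by one, whence \<open>Suc d\<close>. A summand
  with \<open>T m\<close> stays such a summand up to a term of degree one, since
  \<open>T m * L (Suc m) = L m * T m + kap * L (Suc m)\<close>.\<close>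

lemma AP_mult_L:
  assumes "m < k" "x \<in> AP m d"
  shows "x * L (Suc m) \<in> AP m (Suc d)"
  using assms(2)
proof (induction rule: AP.induct)
  case (AP_T x a b)
  have b: "b * L (Suc m) = L (Suc m) * b"
    using sub_comm_L[of b m "Suc m"] AP_T assms by simp
  have TL: "T m * L (Suc m) = L m * T m + kap * L (Suc m)"
    using T_L_Suc[of m] AP_T assms by simp
  have "a * T m * b * L (Suc m) = a * (T m * L (Suc m)) * b"
    by (simp add: mult.assoc b)
  also have "\<dots> = (a * L m) * T m * b + (a * kap) * (L (Suc m) * b)"
    by (simp add: TL distrib_left distrib_right mult.assoc)
  also have "(a * kap) * (L (Suc m) * b) = (a * kap * b) * L (Suc m)"
    by (simp add: mult.assoc b)
  finally have "(x + a * T m * b) * L (Suc m) =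
      x * L (Suc m) + (a * L m) * T m * b + (a * kap * b) * L (Suc m)"
    by (simp add: distrib_right)
  moreover have "a * L m \<in> sub m" "a * kap * b \<in> sub m"
    using AP_T by (auto intro!: sub_mult sub_kap sub_L)
  ultimately show ?case
    using AP_T by (auto intro!: AP_L_one AP.AP_T)
next
  case (AP_L x j a)
  then have "x * L (Suc m) + a * L (Suc m) ^ Suc j \<in> AP m (Suc d)"
    by (intro AP.AP_L) auto
  then show ?case by (simp add: distrib_right mult.assoc power_Suc2 del: power_Suc)
qed (auto intro: AP.intros)

lemma AP_L_power_T:
  assumes "0 < i" "i < k" "j \<le> d"
  shows "L (Suc i) ^ j * T i \<in> AP i d"
proof -
  have "T i * L i ^ j \<in> AP i d"
    using AP_T'[of i 1 "L i ^ j" d] assms by (simp add: sub_one sub_power sub_L)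
  moreover have "kap * (\<Sum>e=1..j. L i ^ (j - e) * L (Suc i) ^ e) \<in> AP i d"
    using assms by (intro AP_left AP_sum AP_L') (auto intro: sub_kap sub_power sub_L)
  ultimately show ?thesis
    using L_power_T[of i j] assms by (simp add: AP_add)
qed

text \<open>Moving the left \<open>T i\<close> across turns \<open>L i ^ j\<close> into
  \<open>L (Suc i) ^ j\<close>. Here \<open>0 < j\<close> is essential: the remaining
  \<open>T i * T i\<close> has the constant part \<open>S q\<close>, which must be multiplied by a
  positive power.\<close>

lemma AP_T_conj_power:
  assumes "0 < i" "i < k" "0 < j" "j \<le> d"
  shows "T i * L i ^ j * T i \<in> AP i d"
proof -
  let ?y = "L i" and ?z = "L (Suc i)"
  have "T i * ?y ^ j * T i = ?z ^ j * (T i * T i) - kap * (\<Sum>e=1..j. ?y ^ (j - e) * (?z ^ e * T i))"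
    using assms by (simp add: T_L_power left_diff_distrib mult.assoc sum_distrib_right)
  moreover have "?z ^ j * (T i * T i) = kap * (?z ^ j * T i) + S q * ?z ^ j"
    using assms by (simp add: T_square distrib_left kap_left_commute S_central[of q])
  moreover have "kap * (?z ^ j * T i) \<in> AP i d" "S q * ?z ^ j \<in> AP i d"
    using assms by (intro AP_left AP_L' AP_L_power_T sub_kap sub_S; simp)+
  moreover have "kap * (\<Sum>e=1..j. ?y ^ (j - e) * (?z ^ e * T i)) \<in> AP i d"
    using assms by (intro AP_left AP_sum AP_L_power_T sub_kap sub_power sub_L) auto
  ultimately show ?thesis
    by (simp add: AP_add AP_diff)
qed

text \<open>Conjugation carries the kernel of one level into that of the next without raising the
  degree: \<open>T (Suc m) * T m * T (Suc m)\<close> becomes \<open>T m * T (Suc m) * T m\<close> by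
  the braid relation, and \<open>a\<close>, \<open>b\<close> commute with
  \<open>T (Suc m)\<close>.\<close>

lemma AP_T_conj:
  assumes "Suc m < k" "x \<in> AP m d"
  shows "T (Suc m) * x * T (Suc m) \<in> AP (Suc m) d"
  using assms(2)
proof (induction rule: AP.induct)
  case AP_zero
  then show ?case by (simp add: AP.AP_zero)
next
  case (AP_T x a b)
  let ?t = "T (Suc m)"
  have ab: "a * ?t = ?t * a" "b * ?t = ?t * b"
    using sub_comm_T[of _ m "Suc m"] AP_T assms by auto
  have br: "T m * ?t * T m = ?t * T m * ?t"
    using T_braid[of m] AP_T assms by simp
  have "?t * (a * T m * b) * ?t = a * (?t * T m * ?t) * b"
    by (simp add: mult.assoc ab(2) ab(1)[symmetric] commute_left[OF ab(1)[symmetric]])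
  also have "\<dots> = (a * T m) * ?t * (T m * b)"
    by (simp add: mult.assoc braid_left[OF br[symmetric]])
  also have "\<dots> \<in> AP (Suc m) d"
    using AP_T sub_mono[of _ m "Suc m"] by (intro AP_T' sub_mult sub_gen) auto
  finally show ?case
    using AP_T by (auto simp: distrib_left distrib_right intro: AP_add)
next
  case (AP_L x j a)
  let ?t = "T (Suc m)"
  have "a * ?t = ?t * a"
    using sub_comm_T[of a m "Suc m"] AP_L assms by auto
  then have "?t * (a * L (Suc m) ^ j) * ?t = a * (?t * L (Suc m) ^ j * ?t)"
    by (metis mult.assoc)
  moreover have "a \<in> sub (Suc m)" using AP_L sub_mono[of a m "Suc m"] by simp
  ultimately have "?t * (a * L (Suc m) ^ j) * ?t \<in> AP (Suc m) d"
    using AP_T_conj_power[of "Suc m" j d] AP_L assms by (simp add: AP_left)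
  then show ?case
    using AP_L by (auto simp: distrib_left distrib_right intro: AP_add)
qed

text \<open>A relational form of the descending map, in which \<open>c\<close> is not yet known to
  be determined by \<open>z\<close>. The bound \<open>d\<close> counts the powers of
  \<open>L (Suc m)\<close> that may have arisen; the relation bears on \<open>descend\<close> when
  \<open>d < ell\<close>.\<close>

definition desc :: "nat \<Rightarrow> nat \<Rightarrow> 'b \<Rightarrow> 'b \<Rightarrow> bool" where
  "desc m d z c \<longleftrightarrow> c \<in> sub m \<and> z - c \<in> AP m d"

lemma desc_mono: "desc m d z c \<Longrightarrow> d \<le> e \<Longrightarrow> desc m e z c"
  by (auto simp: desc_def intro: AP_mono)

lemma desc_left: "desc m d z c \<Longrightarrow> a \<in> sub m \<Longrightarrow> desc m d (a * z) (a * c)"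
  using AP_left[of "z - c" m d a] by (simp add: desc_def sub_mult right_diff_distrib)

lemma desc_right: "m < k \<Longrightarrow> desc m d z c \<Longrightarrow> a \<in> sub m \<Longrightarrow> desc m d (z * a) (c * a)"
  using AP_right[of m "z - c" d a] by (simp add: desc_def sub_mult left_diff_distrib)

text \<open>The term \<open>c * L (Suc m)\<close> already lies in the kernel, having degree one; so
  the factor contributes only its constant \<open>- S a\<close>.\<close>

lemma desc_mult_L:
  assumes "m < k" "desc m d z c"
  shows "desc m (Suc d) (z * (L (Suc m) - S a)) (- S a * c)"
proof -
  have "z * (L (Suc m) - S a) - - S a * c = (z - c) * L (Suc m) + c * L (Suc m) - S a * (z - c)"
    by (simp add: algebra_simps S_central[of a])
  also have "\<dots> \<in> AP m (Suc d)"
    using assms AP_mono[of "z - c" m d "Suc d"]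
    by (intro AP_diff[OF AP_L_one[OF AP_mult_L] AP_left] sub_S) (auto simp: desc_def)
  finally show ?thesis
    using assms by (auto simp: desc_def intro!: sub_uminus sub_mult sub_S)
qed

text \<open>As \<open>c\<close> commutes with \<open>T (Suc m)\<close>, its conjugate is
  \<open>c\<close> times the square of \<open>T (Suc m)\<close>, that is, \<open>q * c\<close> plus
  a multiple of \<open>T (Suc m)\<close>. This is the source of each factor
  \<open>q\<close>.\<close>

lemma desc_T_conj:
  assumes "Suc m < k" "desc m d z c"
  shows "desc (Suc m) d (T (Suc m) * z * T (Suc m)) (S q * c)"
proof -
  let ?t = "T (Suc m)"
  have c: "c \<in> sub m" "c * ?t = ?t * c"
    using assms sub_comm_T[of c m "Suc m"] by (auto simp: desc_def)
  have "?t * c * ?t = c * (?t * ?t)"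
    by (metis c(2) mult.assoc)
  also have "\<dots> = kap * c * ?t * 1 + S q * c"
    using assms by (simp add: T_square distrib_left mult.assoc kap_left_commute S_central[of q])
  finally have "?t * z * ?t - S q * c = ?t * (z - c) * ?t + kap * c * ?t * 1"
    by (simp add: left_diff_distrib right_diff_distrib)
  moreover have c': "c \<in> sub (Suc m)"
    using c sub_mono[of c m "Suc m"] by simp
  then have "kap * c * ?t * 1 \<in> AP (Suc m) d"
    by (intro AP_T' sub_mult sub_kap sub_one) auto
  moreover have "?t * (z - c) * ?t \<in> AP (Suc m) d"
    using AP_T_conj assms by (auto simp: desc_def)
  ultimately show ?thesis
    using c' by (auto simp: desc_def intro: AP_add sub_mult sub_S)
qed

end

fun free_L :: "'a::idom \<Rightarrow> nat \<Rightarrow> 'a free" where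
  "free_L qi 0 = 0"
| "free_L qi (Suc 0) = gen 0"
| "free_L qi (Suc (Suc m)) = const qi * (gen (Suc m) * free_L qi (Suc m) * gen (Suc m))"

lemma free_L_Suc: "1 \<le> i \<Longrightarrow> free_L qi (Suc i) = const qi * (gen i * free_L qi i * gen i)"
  by (cases i) auto

lemma free_L_carrier: "m \<le> k \<Longrightarrow> free_L qi m \<in> free_carrier k"
  by (induction qi m rule: free_L.induct) (auto intro!: free_carrier_mult free_carrier_gen)

section \<open>Evaluation of free polynomials at the generators\<close>

context hecke_gens
begin

sublocale reg: free_action "\<lambda>c v. S c * v" "\<lambda>i v. v * T i"
  by standard (auto simp: S_add S_mult S_one distrib_right distrib_left mult.assoc)

definition ev :: "'a free \<Rightarrow> 'b" where "ev x = reg.act x 1"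

lemma reg_act: "reg.act x v = v * ev x"
proof (induction x rule: free_induct)
  case (const c)
  then show ?case using S_central[of c v] by (simp add: ev_def)
next
  case (snoc x i)
  then show ?case by (simp add: ev_def reg.act_mult mult.assoc)
next
  case (add x y)
  then show ?case by (simp add: ev_def reg.act_add_left distrib_left)
qed

lemma ev_mult: "ev (x * y) = ev x * ev y"
proof -
  have "ev (x * y) = reg.act y (reg.act x 1)"
    by (simp add: ev_def reg.act_mult)
  then show ?thesis by (simp only: reg_act mult_1_left)
qed

lemma ev_add: "ev (x + y) = ev x + ev y"
  by (simp add: ev_def reg.act_add_left)

lemma ev_diff: "ev (x - y) = ev x - ev y"
  by (simp add: ev_def reg.act_diff_left)

lemma ev_zero [simp]: "ev 0 = 0"
  by (simp add: ev_def)

lemma ev_sum: "ev (sum f I) = (\<Sum>i\<in>I. ev (f i))"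
  by (simp add: ev_def reg.act_sum_left)

lemma ev_const [simp]: "ev (const c) = S c"
  by (simp add: ev_def)

lemma ev_one [simp]: "ev 1 = 1"
  by (simp add: ev_def)

lemma ev_gen [simp]: "ev (gen i) = T i"
  by (simp add: ev_def)

lemma ev_prod_list: "ev (prod_list xs) = prod_list (map ev xs)"
  by (induction xs) (auto simp: ev_mult)

lemma ev_power: "ev (x ^ n) = ev x ^ n"
  by (induction n) (auto simp: ev_mult)

lemma ev_free_L: "ev (free_L qi i) = L i"
  by (induction i rule: L.induct) (auto simp: ev_mult)

text \<open>Allows the coefficients met in a computation to be lifted to polynomials, from which the
  cosets in a descending decomposition are formed.\<close>

lemma sub_iff_ev: "x \<in> sub m \<longleftrightarrow> (\<exists>y\<in>free_carrier m. x = ev y)"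
proof
  show "x \<in> sub m \<Longrightarrow> \<exists>y\<in>free_carrier m. x = ev y"
  proof (induction rule: sub.induct)
    case (sub_S c)
    then show ?case by (intro bexI[of _ "const c"]) auto
  next
    case (sub_T x i)
    then show ?case by (metis ev_mult ev_gen free_carrier_mult free_carrier_gen)
  next
    case (sub_add x y)
    then show ?case by (metis ev_add free_carrier_add)
  qed
  have "ev y \<in> sub m" if "y \<in> free_carrier m" for y
    using that
    by (induction rule: free_carrier_induct) (auto simp: ev_mult ev_add intro: sub.intros)
  then show "\<exists>y\<in>free_carrier m. x = ev y \<Longrightarrow> x \<in> sub m" by auto
qed

subsection \<open>The regular representation over the next smaller algebra\<close>

text \<open>
  With \<open>A\<close> the algebra of \<open>T\<^sub>0, \<dots>, T\<^sub>k\<^sub>-\<^sub>1\<close>, the algebra on one more generator is free as a left \<open>A\<close>-module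
  on \<open>b\<^sub>i\<^sub>j = T\<^sub>k \<dots> T\<^sub>i L\<^sub>i\<^sup>j\<close> with \<open>1 \<le> i \<le> k + 1\<close> and \<open>j < ell\<close>. A vector is written \<open>v i j\<close>; \<open>rop m\<close> is
  the right multiplication by the generator \<open>T\<^sub>m\<close>. Its formulas come from
  \<open>b\<^sub>m\<^sub>+\<^sub>1\<^sub>,\<^sub>j T\<^sub>m = b\<^sub>m\<^sub>,\<^sub>j + (q - 1) \<Sum>\<^bsub>s=1..j\<^esub> L\<^sub>m\<^sup>j\<^sup>-\<^sup>s b\<^sub>m\<^sub>+\<^sub>1\<^sub>,\<^sub>s\<close> and from the quadratic relation.
\<close>

definition cyc_poly :: "'a poly" where "cyc_poly = (\<Prod>i=1..ell. [:- Q i, 1:])"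

abbreviation fc :: "nat \<Rightarrow> 'b" where "fc j \<equiv> S (coeff cyc_poly j)"

definition rmul :: "'b \<Rightarrow> (nat \<Rightarrow> 'b) \<Rightarrow> nat \<Rightarrow> 'b" where "rmul x g = (\<lambda>j. g j * x)"

definition lmul :: "'b \<Rightarrow> (nat \<Rightarrow> 'b) \<Rightarrow> nat \<Rightarrow> 'b" where "lmul c g = (\<lambda>j. c * g j)"

text \<open>The coefficient at \<open>s\<close> of the row obtained from \<open>g\<close> by
  replacing each basis element of exponent \<open>j\<close> by the sum of
  \<open>L m ^ (j - s)\<close> times that of exponent \<open>s\<close>, over
  \<open>s = 1, ..., j\<close>. Exponent 0 never occurs, whence the case distinction.\<close>

definition Yop :: "nat \<Rightarrow> (nat \<Rightarrow> 'b) \<Rightarrow> nat \<Rightarrow> 'b" where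
  "Yop m g = (\<lambda>s. if s = 0 then 0 else \<Sum>j=s..<ell. g j * L m ^ (j - s))"

text \<open>Multiplication by the variable, reduced modulo the monic polynomial
  \<open>cyc_poly\<close>: the companion matrix acting on the row of coefficients.\<close>

definition Xop :: "(nat \<Rightarrow> 'b) \<Rightarrow> nat \<Rightarrow> 'b" where
  "Xop g = (\<lambda>j. if j < ell then (if j = 0 then 0 else g (j - 1)) - fc j * g (ell - 1) else 0)"

definition erow :: "nat \<Rightarrow> (nat \<Rightarrow> 'b) \<Rightarrow> nat \<Rightarrow> nat \<Rightarrow> 'b" where
  "erow r g = (\<lambda>i. if i = r then g else 0)"

text \<open>For \<open>i < m\<close> the braid relations turn \<open>T m\<close> on the right of
  \<open>T k ... T i\<close> into \<open>T (m - 1)\<close> on its left; for \<open>i > m + 1\<close>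
  it commutes with the whole basis element. In row \<open>m + 1\<close> the summand
  \<open>v m + lmul kap (v m)\<close> is \<open>q\<close> times \<open>v m\<close>.\<close>

definition rop :: "nat \<Rightarrow> (nat \<Rightarrow> nat \<Rightarrow> 'b) \<Rightarrow> nat \<Rightarrow> nat \<Rightarrow> 'b" where
  "rop m v = (\<lambda>i.
     if i = 0 then 0 else if i < m then rmul (T (m - 1)) (v i)
     else if i > Suc m then rmul (T m) (v i)
     else if m = 0 then Xop (v i)
     else if i = m then v (Suc m) + lmul kap (v m - Yop m (v m))
     else lmul kap (Yop m (v (Suc m))) + (v m + lmul kap (v m))
          + lmul kap (lmul kap (Yop m (v m) - Yop m (Yop m (v m)))))"

definition msc :: "'b \<Rightarrow> (nat \<Rightarrow> nat \<Rightarrow> 'b) \<Rightarrow> nat \<Rightarrow> nat \<Rightarrow> 'b" where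
  "msc c v = (\<lambda>i. lmul c (v i))"

lemma rmul_add: "rmul x (g + h) = rmul x g + rmul x h"
  by (simp add: rmul_def fun_eq_iff distrib_right)

lemma lmul_add: "lmul x (g + h) = lmul x g + lmul x h"
  by (simp add: lmul_def fun_eq_iff distrib_left)

lemma Yop_add: "Yop m (g + h) = Yop m g + Yop m h"
  by (simp add: Yop_def fun_eq_iff distrib_right sum.distrib)

lemma Xop_add: "Xop (g + h) = Xop g + Xop h"
  by (simp add: Xop_def fun_eq_iff distrib_left algebra_simps)

lemma rmul_diff: "rmul x (g - h) = rmul x g - rmul x h"
  by (simp add: rmul_def fun_eq_iff left_diff_distrib)

lemma lmul_diff: "lmul x (g - h) = lmul x g - lmul x h"
  by (simp add: lmul_def fun_eq_iff right_diff_distrib)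

lemma Yop_diff: "Yop m (g - h) = Yop m g - Yop m h"
  by (simp add: Yop_def fun_eq_iff left_diff_distrib sum_subtractf)

lemma Xop_diff: "Xop (g - h) = Xop g - Xop h"
  by (simp add: Xop_def fun_eq_iff algebra_simps)

lemma rmul_lmul: "rmul x (lmul c g) = lmul c (rmul x g)"
  by (simp add: rmul_def lmul_def mult.assoc)

lemma Yop_lmul: "Yop m (lmul c g) = lmul c (Yop m g)"
  by (simp add: Yop_def lmul_def mult.assoc fun_eq_iff sum_distrib_left)

lemma Xop_lmul: "Xop (lmul c g) = lmul c (Xop g)"
  by (simp add: Xop_def lmul_def fun_eq_iff right_diff_distrib S_left_commute)

lemma row_op_zero: "rmul x 0 = 0" "lmul x 0 = 0" "Yop m 0 = 0" "Xop 0 = 0"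
  by (simp_all add: rmul_def lmul_def Yop_def Xop_def fun_eq_iff)

lemma lmul_kap_commute: "lmul kap (lmul c g) = lmul c (lmul kap g)"
  by (simp add: lmul_def fun_eq_iff kap_left_commute)

lemmas row_simps = rmul_add lmul_add Yop_add Xop_add rmul_diff lmul_diff Yop_diff Xop_diff
  rmul_lmul Yop_lmul Xop_lmul row_op_zero

lemma rmul_rmul: "rmul x (rmul y g) = rmul (y * x) g"
  by (simp add: rmul_def mult.assoc)

lemma rmul_sum_left: "rmul (x + y) g = rmul x g + rmul y g"
  by (simp add: rmul_def fun_eq_iff distrib_left)

lemma rmul_kap: "rmul (kap * x) g = lmul kap (rmul x g)"
  by (simp add: rmul_def lmul_def kap_left_commute)

lemma rmul_S: "rmul (S c) g = lmul (S c) g"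
  by (simp add: rmul_def lmul_def S_central[of c])

lemma lmul_Sq: "lmul (S q) g = g + lmul kap g"
  by (simp add: lmul_def kap_def fun_eq_iff algebra_simps)

lemma rmul_T_T:
  "1 \<le> i \<Longrightarrow> i < k \<Longrightarrow> rmul (T i) (rmul (T i) g) = lmul kap (rmul (T i) g) + (g + lmul kap g)"
  by (simp add: rmul_rmul T_square rmul_sum_left rmul_kap rmul_S lmul_Sq)

lemma rmul_Yop: "x * L m = L m * x \<Longrightarrow> rmul x (Yop m g) = Yop m (rmul x g)"
  using power_commuting_commutes[of "L m" x]
  by (auto simp: Yop_def rmul_def fun_eq_iff sum_distrib_right mult.assoc intro!: sum.cong)

lemma rmul_Xop: "rmul x (Xop g) = Xop (rmul x g)"
  by (simp add: Xop_def rmul_def fun_eq_iff left_diff_distrib mult.assoc)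

text \<open>Coefficientwise this is \<open>L_power_T\<close>. Applying both operators produces the
  sum of \<open>L m ^ (d - e) * L (Suc m) ^ e\<close> over all \<open>e\<close> from 0, whereas
  \<open>L_power_T\<close> starts at 1; the summand \<open>Yop m g\<close> makes up for
  \<open>e = 0\<close>.\<close>

lemma Yop_Yop_commute:
  assumes "1 \<le> m" "m < k"
  shows "rmul (T m) (Yop (Suc m) g) + lmul kap (Yop m g - Yop (Suc m) (Yop m g)) = Yop m (rmul (T m) g)"
proof
  fix s
  let ?y = "L m" and ?z = "L (Suc m)"
  show "(rmul (T m) (Yop (Suc m) g) + lmul kap (Yop m g - Yop (Suc m) (Yop m g))) s = Yop m (rmul (T m) g) s"
  proof (cases "s = 0")
    case True
    then show ?thesis by (simp add: rmul_def lmul_def Yop_def)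
  next
    case False
    have YY: "Yop (Suc m) (Yop m g) s = (\<Sum>j=s..<ell. g j * (\<Sum>e=0..j - s. ?y ^ (j - s - e) * ?z ^ e))"
    proof -
      have "Yop (Suc m) (Yop m g) s = (\<Sum>r=s..<ell. \<Sum>j=r..<ell. g j * ?y ^ (j - r) * ?z ^ (r - s))"
        using False by (auto simp: Yop_def sum_distrib_right intro!: sum.cong)
      also have "\<dots> = (\<Sum>j=s..<ell. \<Sum>r=s..j. g j * ?y ^ (j - r) * ?z ^ (r - s))"
        by (subst sum.Sigma; simp)+
           (rule sum.reindex_bij_witness[of _ prod.swap prod.swap]; auto)
      also have "\<dots> = (\<Sum>j=s..<ell. \<Sum>e=0..j - s. g j * ?y ^ (j - s - e) * ?z ^ e)"
        by (rule sum.cong[OF refl], rule sum.reindex_bij_witness[of _ "\<lambda>e. e + s" "\<lambda>r. r - s"]) auto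
      finally show ?thesis by (simp add: sum_distrib_left mult.assoc)
    qed
    have "?z ^ d * T m + kap * (?y ^ d - (\<Sum>e=0..d. ?y ^ (d - e) * ?z ^ e)) = T m * ?y ^ d" for d
    proof -
      have "(\<Sum>e=0..d. ?y ^ (d - e) * ?z ^ e) = ?y ^ d + (\<Sum>e=1..d. ?y ^ (d - e) * ?z ^ e)"
        by (simp add: sum.atLeast_Suc_atMost)
      then show ?thesis using L_power_T[OF assms, of d] by (simp add: algebra_simps)
    qed
    then have "g j * (?z ^ (j - s) * T m) + (kap * (g j * ?y ^ (j - s))
        - kap * (g j * (\<Sum>e=0..j - s. ?y ^ (j - s - e) * ?z ^ e))) = g j * (T m * ?y ^ (j - s))" for j
      by (simp only: right_diff_distrib[symmetric] kap_left_commute[symmetric] distrib_left[symmetric])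
    then have "(\<Sum>j=s..<ell. g j * (?z ^ (j - s) * T m) + (kap * (g j * ?y ^ (j - s))
        - kap * (g j * (\<Sum>e=0..j - s. ?y ^ (j - s - e) * ?z ^ e)))) = (\<Sum>j=s..<ell. g j * (T m * ?y ^ (j - s)))"
      by simp
    then show ?thesis
      using False
      by (simp add: lmul_def YY rmul_def)
         (simp add: Yop_def sum.distrib sum_subtractf sum_distrib_left sum_distrib_right mult.assoc right_diff_distrib)
  qed
qed

lemma rop_add: "rop m (u + v) = rop m u + rop m v"
  by (rule ext) (simp add: rop_def row_simps algebra_simps)

lemma rop_msc: "rop m (msc c v) = msc c (rop m v)"
  by (rule ext) (simp add: rop_def msc_def row_simps lmul_kap_commute[of c])

lemma msc_add: "msc c (u + v) = msc c u + msc c v"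
  by (simp add: msc_def fun_eq_iff lmul_add)

sublocale mod: free_action "\<lambda>c. msc (S c)" rop
  by standard
     (auto simp: rop_add rop_msc msc_add, auto simp: msc_def lmul_def fun_eq_iff S_add S_mult S_one distrib_right mult.assoc)

lemma rop_diff: "rop m (u - v) = rop m u - rop m v"
  using rop_add[of m "u - v" v] by (simp add: eq_diff_eq)

lemma erow_add: "erow r (g + h) = erow r g + erow r h"
  by (simp add: erow_def fun_eq_iff)

lemma erow_diff: "erow r (g - h) = erow r g - erow r h"
  by (simp add: erow_def fun_eq_iff)

lemma erow_zero: "erow r 0 = 0"
  by (simp add: erow_def fun_eq_iff)

lemma msc_erow: "msc c (erow r g) = erow r (lmul c g)"
  by (simp add: msc_def erow_def fun_eq_iff row_op_zero)

lemma rop_erow_lower: "0 < r \<Longrightarrow> r < m \<Longrightarrow> rop m (erow r g) = erow r (rmul (T (m - 1)) g)"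
  by (rule ext) (auto simp: rop_def erow_def row_simps)

lemma rop_erow_upper: "Suc m < r \<Longrightarrow> rop m (erow r g) = erow r (rmul (T m) g)"
  by (rule ext) (auto simp: rop_def erow_def row_simps)

lemma rop_erow_Suc: "0 < m \<Longrightarrow> rop m (erow (Suc m) g) = erow m g + erow (Suc m) (lmul kap (Yop m g))"
  by (rule ext) (auto simp: rop_def erow_def row_simps)

lemma rop_erow_same:
  "0 < m \<Longrightarrow> rop m (erow m g) = erow m (lmul kap (g - Yop m g))
     + erow (Suc m) (g + lmul kap g + lmul kap (lmul kap (Yop m g - Yop m (Yop m g))))"
  by (rule ext) (auto simp: rop_def erow_def row_simps)

lemma rop_erow_0: "rop 0 (erow (Suc 0) g) = erow (Suc 0) (Xop g)"
  by (rule ext) (auto simp: rop_def erow_def row_simps)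

end

text \<open>Pointwise evaluation is kept apart so that identities between rows and vectors can be
  handled as identities in an abelian group.\<close>

lemmas fun_apply = plus_fun_apply zero_fun_apply minus_apply

context hecke_gens
begin

context
  notes fun_apply [simp del]
begin

definition rrow :: "(nat \<Rightarrow> 'b) \<Rightarrow> bool" where
  "rrow g \<longleftrightarrow> (\<forall>j\<ge>ell. g j = 0)"

text \<open>The rows and exponents that belong to basis elements. The operators are total and lose
  their meaning elsewhere: beyond row \<open>k + 1\<close>, for instance, \<open>rop k\<close>
  multiplies by the unconstrained \<open>T k\<close>.\<close>

definition rmod :: "(nat \<Rightarrow> nat \<Rightarrow> 'b) \<Rightarrow> bool" where
  "rmod v \<longleftrightarrow> (\<forall>i. rrow (v i)) \<and> (\<forall>i. i = 0 \<or> i > Suc k \<longrightarrow> v i = 0)"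

lemma rrow_closed:
  "rrow 0" "rrow g \<Longrightarrow> rrow h \<Longrightarrow> rrow (g + h)" "rrow g \<Longrightarrow> rrow h \<Longrightarrow> rrow (g - h)"
  "rrow g \<Longrightarrow> rrow (lmul c g)" "rrow g \<Longrightarrow> rrow (rmul c g)" "rrow (Yop m g)" "rrow (Xop g)"
  by (auto simp: fun_apply rrow_def lmul_def rmul_def Yop_def Xop_def)

lemma rmod_rop: "rmod v \<Longrightarrow> m \<le> k \<Longrightarrow> rmod (rop m v)"
  by (auto simp: rmod_def rop_def row_simps rrow_closed)

lemma rmod_erow: "rrow g \<Longrightarrow> 0 < r \<Longrightarrow> r \<le> Suc k \<Longrightarrow> rmod (erow r g)"
  by (auto simp: rmod_def erow_def rrow_closed)

lemma rmod_add: "rmod u \<Longrightarrow> rmod v \<Longrightarrow> rmod (u + v)"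
  by (simp add: rmod_def rrow_closed fun_apply)

lemma rmod_diff: "rmod u \<Longrightarrow> rmod v \<Longrightarrow> rmod (u - v)"
  by (simp add: rmod_def rrow_closed fun_apply)

lemma rmod_msc: "rmod v \<Longrightarrow> rmod (msc c v)"
  by (simp add: rmod_def msc_def rrow_closed row_op_zero)

lemma rmod_act:
  assumes "x \<in> free_carrier (Suc k)" "rmod v" shows "rmod (mod.act x v)"
  using assms(1)
proof (induction rule: free_carrier_induct)
  case (const c)
  then show ?case using assms(2) by (simp add: rmod_msc)
next
  case (snoc x i)
  then show ?case by (simp add: mod.act_mult rmod_rop)
next
  case (add x y)
  then show ?case by (simp add: mod.act_add_left rmod_add)
qed

lemma rmod_induct [consumes 1, case_names erow add]:
  assumes v: "rmod v" and e: "\<And>r g. 0 < r \<Longrightarrow> r \<le> Suc k \<Longrightarrow> rrow g \<Longrightarrow> P (erow r g)"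
    and a: "\<And>u v. P u \<Longrightarrow> P v \<Longrightarrow> P (u + v)"
  shows "P v"
proof -
  have "P (\<Sum>r\<in>R. erow r (v r))" if "finite R" "R \<subseteq> {1..Suc k}" for R
    using that
  proof (induction R rule: finite_induct)
    case empty
    then show ?case using e[of 1 0] by (simp add: erow_zero rrow_closed)
  next
    case (insert r R)
    then show ?case using v by (auto simp: rmod_def intro!: a e)
  qed
  moreover have "(\<Sum>r\<in>{1..Suc k}. erow r (v r)) = v"
  proof (rule ext)
    fix i
    have *: "(\<Sum>r\<in>R. erow r (v r)) i = (\<Sum>r\<in>R. erow r (v r) i)" if "finite R" for R
      using that by (induction R rule: finite_induct) (auto simp: fun_apply)
    have "(\<Sum>r\<in>{1..Suc k}. erow r (v r)) i = (\<Sum>r\<in>{1..Suc k}. erow r (v r) i)"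
      by (rule *) simp
    also have "\<dots> = (\<Sum>r\<in>{1..Suc k}. if r = i then v i else 0)"
      by (rule sum.cong) (auto simp: erow_def)
    also have "\<dots> = v i"
      using v by (auto simp: rmod_def not_le)
    finally show "(\<Sum>r\<in>{1..Suc k}. erow r (v r)) i = v i" .
  qed
  ultimately show ?thesis by (metis finite_atLeastAtMost subset_refl)
qed

lemma msc_diff: "msc c (u - v) = msc c u - msc c v"
  by (simp add: msc_def fun_eq_iff fun_apply lmul_diff)

lemmas erow_simps = rop_add rop_diff msc_diff row_simps erow_add erow_diff erow_zero msc_add msc_erow

section \<open>Quadratic, commutation and braid relations of the operators\<close>

lemma rop_quad:
  assumes "1 \<le> m" "m \<le> k" "rmod v"
  shows "rop m (rop m v) = msc kap (rop m v) + (v + msc kap v)"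
  using assms(3)
proof (induction rule: rmod_induct)
  case (erow r g)
  consider "r < m" | "Suc m < r" | "r = m" | "r = Suc m" by linarith
  then show ?case
  proof cases
    case 1
    then show ?thesis
      using erow assms rmul_T_T[of "m - 1" g] by (simp add: rop_erow_lower erow_simps)
  next
    case 2
    then show ?thesis
      using erow assms rmul_T_T[of m g] by (simp add: rop_erow_upper erow_simps)
  next
    case 3
    then show ?thesis
      using assms by (simp add: rop_erow_same rop_erow_Suc erow_simps algebra_simps)
  next
    case 4
    then show ?thesis
      using assms by (simp add: rop_erow_same rop_erow_Suc erow_simps algebra_simps)
  qed
qed (simp add: rop_add msc_add algebra_simps)

lemma rop_comm:
  assumes "i + 1 < j" "j \<le> k" "rmod v"
  shows "rop i (rop j v) = rop j (rop i v)"
  using assms(3)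
proof (induction rule: rmod_induct)
  case (erow r g)
  have Tj: "T (j - 1) * L i = L i * T (j - 1)" if "0 < i"
    using T_comm_L[of "j - 1" i] assms that by auto
  have Ti: "T i * L j = L j * T i"
    using T_comm_L[of i j] assms by auto
  consider "0 < i" "r < i" | "0 < i" "r = i" | "0 < i" "r = Suc i" | "i = 0" "r = Suc 0"
    | "Suc i < r" "r < j" | "r = j" | "r = Suc j" | "Suc j < r"
    using erow by linarith
  then show ?case
  proof cases
    case 1
    show ?thesis
    proof -
      have "T (i - 1) * T (j - 1) = T (j - 1) * T (i - 1)"
        using assms 1 by (intro T_commute) auto
      then show ?thesis
        using erow assms 1 by (simp add: rop_erow_lower rmul_rmul)
    qed
  next
    case 2
    then show ?thesis
      using erow assms Tj
      by (simp add: rop_erow_lower rop_erow_same erow_simps rmul_Yop)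
  next
    case 3
    then show ?thesis
      using erow assms Tj
      by (simp add: rop_erow_lower rop_erow_Suc erow_simps rmul_Yop)
  next
    case 4
    then show ?thesis
      using assms by (simp add: rop_erow_lower rop_erow_0 rmul_Xop)
  next
    case 5
    then show ?thesis
      using assms T_commute[of i "j - 1"] by (simp add: rop_erow_lower rop_erow_upper rmul_rmul)
  next
    case 6
    then show ?thesis
      using assms Ti by (simp add: rop_erow_upper rop_erow_same erow_simps rmul_Yop)
  next
    case 7
    then show ?thesis
      using assms Ti by (simp add: rop_erow_upper rop_erow_Suc erow_simps rmul_Yop)
  next
    case 8
    then show ?thesis
      using assms erow T_commute[of i j] by (simp add: rop_erow_upper rmul_rmul)
  qed
qed (simp add: rop_add)

text \<open>By the quadratic relation the vectors satisfying the braid relation are stable under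
  both operators, and they are closed under differences. Since the operators carry row
  \<open>m + 2\<close> to row \<open>m + 1\<close> and that to row \<open>m\<close>, up to known
  corrections, only row \<open>m + 2\<close> calls for a computation.\<close>

lemma rop_braid:
  assumes m: "1 \<le> m" "Suc m \<le> k" and v: "rmod v"
  shows "rop m (rop (Suc m) (rop m v)) = rop (Suc m) (rop m (rop (Suc m) v))"
proof -
  define N where "N v \<longleftrightarrow> rmod v \<and>
    rop m (rop (Suc m) (rop m v)) = rop (Suc m) (rop m (rop (Suc m) v))" for v
  have N_m: "N (rop m v)" if "N v" for v
  proof -
    have "rop (Suc m) (rop m (rop (Suc m) (rop m v))) = rop (Suc m) (rop (Suc m) (rop m (rop (Suc m) v)))"
      using that by (simp add: N_def)
    also have "\<dots> = msc kap (rop (Suc m) (rop m (rop (Suc m) v)))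
        + (rop m (rop (Suc m) v) + msc kap (rop m (rop (Suc m) v)))"
      using that m by (intro rop_quad rmod_rop) (auto simp: N_def)
    also have "\<dots> = rop m (rop (Suc m) (rop m (rop m v)))"
      using that m rop_quad[of m v] by (simp add: N_def rop_add rop_msc)
    finally show ?thesis
      using that m by (simp add: N_def rmod_rop)
  qed
  have N_Suc: "N (rop (Suc m) v)" if "N v" for v
  proof -
    have "rop m (rop (Suc m) (rop m (rop (Suc m) v))) = rop m (rop m (rop (Suc m) (rop m v)))"
      using that by (simp add: N_def)
    also have "\<dots> = msc kap (rop m (rop (Suc m) (rop m v)))
        + (rop (Suc m) (rop m v) + msc kap (rop (Suc m) (rop m v)))"
      using that m by (intro rop_quad rmod_rop) (auto simp: N_def)
    also have "\<dots> = rop (Suc m) (rop m (rop (Suc m) (rop (Suc m) v)))"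
      using that m rop_quad[of "Suc m" v] by (simp add: N_def rop_add rop_msc)
    finally show ?thesis
      using that m by (simp add: N_def rmod_rop)
  qed
  have N_diff: "N (u - v)" if "N u" "N v" for u v
    using that by (simp add: N_def rop_diff rmod_diff)
  have N_top: "N (erow (Suc (Suc m)) g)" if "rrow g" "Suc (Suc m) \<le> Suc k" for g
  proof -
    let ?K = "lmul kap" and ?Y = "Yop m" and ?Z = "Yop (Suc m)" and ?t = "rmul (T m)"
    have YZ: "?Y (?t h) = ?t (?Z h) + ?K (?Y h - ?Z (?Y h))" for h
      using Yop_Yop_commute[of m h] m by simp
    have tt: "?t (?t h) = ?K (?t h) + (h + ?K h)" for h
      using rmul_T_T[of m h] m by simp
    have tZ: "?t (?Z h) = ?Y (?t h) - ?K (?Y h) + ?K (?Z (?Y h))" for h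
      by (simp add: YZ row_simps algebra_simps)
    \<comment> \<open>In \<open>L\<close> and \<open>R\<close> below the rows \<open>m\<close> and
      \<open>m + 1\<close> agree at sight; this identity matches the entries in row
      \<open>m + 2\<close>.\<close>
    have tZt: "?t (?Z (?t h)) = ?K (?Z (?Y (?t h))) + (?Y h + ?K (?Y h))" for h
      by (simp add: tZ[of "?t h"] tt row_simps algebra_simps)
    have L: "rop (Suc m) (rop m (rop (Suc m) (erow (Suc (Suc m)) g))) =
        erow m (?t g) + erow (Suc m) (?K (?Y (?t g)))
        + erow (Suc (Suc m)) (?K (?Z (?K (?Y (?t g)))) + (?K (?Y g) + ?K (?K (?Y g))))"
      using m by (simp add: rop_erow_Suc rop_erow_same rop_erow_upper rop_erow_lower erow_simps
          tZ algebra_simps)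
    have R: "rop m (rop (Suc m) (rop m (erow (Suc (Suc m)) g))) =
        erow m (?t g) + erow (Suc m) (?K (?Y (?t g)))
        + erow (Suc (Suc m)) (?K (?t (?Z (?t g))))"
      using m by (simp add: rop_erow_Suc rop_erow_same rop_erow_upper rop_erow_lower erow_simps
          algebra_simps)
    have "rmod (erow (Suc (Suc m)) g)" using that by (intro rmod_erow) auto
    then show ?thesis
      unfolding N_def L R by (simp add: tZt row_simps)
  qed
  have N_mid: "N (erow (Suc m) g)" if "rrow g" for g
  proof -
    have "N (rop (Suc m) (erow (Suc (Suc m)) g) - erow (Suc (Suc m)) (lmul kap (Yop (Suc m) g)))"
      using that m by (intro N_diff N_Suc N_top rrow_closed) auto
    then show ?thesis by (simp add: rop_erow_Suc)
  qed
  have N_low: "N (erow m g)" if "rrow g" for g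
  proof -
    have "N (rop m (erow (Suc m) g) - erow (Suc m) (lmul kap (Yop m g)))"
      using that m by (intro N_diff N_m N_mid rrow_closed) auto
    then show ?thesis using m by (simp add: rop_erow_Suc)
  qed
  have "N v"
    using v
  proof (induction rule: rmod_induct)
    case (erow r g)
    consider "r < m" | "Suc (Suc m) < r" | "r = m" | "r = Suc m" | "r = Suc (Suc m)" by linarith
    then show ?case
    proof cases
      case 1
      then show ?thesis
        using erow m T_braid[of "m - 1"] rmod_erow[OF erow(3,1,2)]
        by (simp add: N_def rop_erow_lower rmul_rmul mult.assoc)
    next
      case 2
      then show ?thesis
        using erow m T_braid[of m] rmod_erow[OF erow(3,1,2)]
        by (simp add: N_def rop_erow_upper rmul_rmul mult.assoc)
    qed (use erow N_top N_mid N_low in auto)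
  next
    case (add u v)
    then show ?case by (simp add: N_def rop_add rmod_add)
  qed
  then show ?thesis by (simp add: N_def)
qed

subsection \<open>The cyclotomic relation in the regular representation\<close>

text \<open>The tail of Horner's scheme for \<open>cyc_poly\<close> at \<open>y\<close> from the
  coefficient \<open>s\<close> on; the leading coefficient 1 gives the separate power. Thus
  \<open>horner y 0\<close> is the value of the polynomial.\<close>

definition horner :: "'b \<Rightarrow> nat \<Rightarrow> 'b" where
  "horner y s = y ^ (ell - s) + (\<Sum>j=s..<ell. fc j * y ^ (j - s))"

lemma horner_step: "s < ell \<Longrightarrow> horner y s = fc s + y * horner y (Suc s)"
proof -
  assume s: "s < ell"
  have "(\<Sum>j=s..<ell. fc j * y ^ (j - s)) = fc s + (\<Sum>j=Suc s..<ell. fc j * y ^ (j - s))"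
    using s by (simp add: sum.atLeast_Suc_lessThan)
  also have "(\<Sum>j=Suc s..<ell. fc j * y ^ (j - s)) = y * (\<Sum>j=Suc s..<ell. fc j * y ^ (j - Suc s))"
    unfolding sum_distrib_left
  proof (rule sum.cong[OF refl])
    fix j assume "j \<in> {Suc s..<ell}"
    then have "j - s = Suc (j - Suc s)" by auto
    then show "fc j * y ^ (j - s) = y * (fc j * y ^ (j - Suc s))"
      by (simp add: S_left_commute)
  qed
  moreover have "y ^ (ell - s) = y * y ^ (ell - Suc s)"
    using s by (simp add: Suc_diff_Suc flip: power_Suc)
  ultimately show ?thesis by (simp add: horner_def distrib_left algebra_simps)
qed

lemma horner_ell: "horner y ell = 1"
  by (simp add: horner_def)

lemma horner_commute: "y * horner y s = horner y s * y"
  unfolding horner_def distrib_left distrib_right sum_distrib_left sum_distrib_right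
  by (simp add: mult.assoc S_left_commute power_commutes)

text \<open>The defect of the identity by which \<open>L\<^sub>m\<^sub>+\<^sub>1\<close> raises the exponent in \<open>b\<^sub>m\<^sub>+\<^sub>1\<^sub>,\<^sub>j\<close>.\<close>

definition defect :: "'b \<Rightarrow> nat \<Rightarrow> 'b" where
  "defect y s = (if s < ell then (if s = 0 then 0 else horner y s) - fc s else 0)"

text \<open>With unbounded exponents \<open>Xop\<close> would be a plain shift and the left side
  would vanish. What remains comes from the top coefficient of \<open>g\<close>, which
  \<open>Xop\<close> wraps round through \<open>cyc_poly\<close>.\<close>

lemma Yop_Xop:
  assumes "rrow g"
  shows "rmul (L m) (Yop m g) + Xop g - Yop m (Xop g) = (\<lambda>s. g (ell - 1) * defect (L m) s)"
proof
  fix s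
  let ?y = "L m" and ?a = "g (ell - 1)"
  consider "s = 0" | "ell \<le> s" "0 < s" | "0 < s" "s < ell" by linarith
  then show "(rmul ?y (Yop m g) + Xop g - Yop m (Xop g)) s = ?a * defect ?y s"
  proof cases
    case 1
    then show ?thesis using ell_pos by (simp add: fun_apply rmul_def Yop_def Xop_def defect_def S_central[of "coeff cyc_poly 0"])
  next
    case 2
    then show ?thesis by (simp add: fun_apply rmul_def Yop_def Xop_def defect_def)
  next
    case 3
    have f: "fc j * ?a = ?a * fc j" for j by (rule S_central)
    have "Yop m (Xop g) s = (\<Sum>j=s..<ell. g (j - 1) * ?y ^ (j - s)) - (\<Sum>j=s..<ell. ?a * (fc j * ?y ^ (j - s)))"
      unfolding sum_subtractf[symmetric] using 3
      by (auto simp: Yop_def Xop_def left_diff_distrib S_left_commute mult.assoc intro!: sum.cong)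
    moreover have "(\<Sum>j=s..<ell. g (j - 1) * ?y ^ (j - s)) = g (s - 1) + (\<Sum>j=Suc s..<ell. g (j - 1) * ?y ^ (j - s))"
      using 3 by (simp add: sum.atLeast_Suc_lessThan)
    moreover have "rmul ?y (Yop m g) s = (\<Sum>j=Suc s..<ell. g (j - 1) * ?y ^ (j - s)) + ?a * ?y ^ (ell - s)"
    proof -
      have "rmul ?y (Yop m g) s = (\<Sum>j=s..<ell. g j * ?y ^ Suc (j - s))"
        using 3 by (simp add: fun_apply rmul_def Yop_def sum_distrib_right mult.assoc power_Suc2 del: power_Suc)
      also have "\<dots> = (\<Sum>j=Suc s..<Suc ell. g (j - 1) * ?y ^ (j - s))"
        by (rule sum.reindex_bij_witness[of _ "\<lambda>j. j - 1" Suc]) (auto simp: Suc_diff_le)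
      finally show ?thesis using 3 by simp
    qed
    moreover have "Xop g s = g (s - 1) - fc s * ?a"
      using 3 by (simp add: Xop_def)
    ultimately show ?thesis
      using 3 f[of s] by (simp add: fun_apply defect_def horner_def algebra_simps sum_distrib_left)
  qed
qed

text \<open>If \<open>y\<close> is a root, the tails \<open>horner y (Suc s)\<close> are the
  coefficients of the quotient of \<open>cyc_poly\<close> by the linear factor of \<open>y\<close>,
  and the defect is \<open>y\<close> times this quotient. Modulo \<open>cyc_poly\<close> the
  variable therefore acts on it as \<open>y\<close>.\<close>

lemma Xop_defect:
  assumes "horner y 0 = 0"
  shows "Xop (\<lambda>s. a * defect y s) = rmul y (\<lambda>s. a * defect y s)"
proof
  fix s
  have d: "defect y s = y * horner y (Suc s)" if "s < ell" for s
    using that horner_step[of s y] assms by (auto simp: defect_def neg_eq_iff_add_eq_0)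
  have p: "(if s = 0 then 0 else a * defect y (s - 1)) = a * (y * horner y s)" if "s < ell" for s
    using that d[of "s - 1"] assms by (auto simp: less_imp_diff_less)
  have l: "defect y (ell - 1) = y"
    using d[of "ell - 1"] ell_pos by (simp add: horner_ell)
  show "Xop (\<lambda>s. a * defect y s) s = rmul y (\<lambda>s. a * defect y s) s"
  proof (cases "s < ell")
    case True
    have "Xop (\<lambda>s. a * defect y s) s = a * (y * horner y s) - fc s * (a * y)"
      using True p[of s] by (simp add: Xop_def l[simplified])
    also have "fc s * (a * y) = a * (y * fc s)"
      by (metis S_central mult.assoc)
    also have "a * (y * horner y s) - a * (y * fc s) = a * (y * (y * horner y (Suc s)))"
      using True by (simp add: horner_step right_diff_distrib[symmetric])
    also have "\<dots> = a * defect y s * y"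
      using True by (simp add: d mult.assoc horner_commute[symmetric])
    finally show ?thesis by (simp add: rmul_def)
  qed (simp add: Xop_def rmul_def defect_def)
qed

lemma S_diff: "S (a - b) = S a - S b"
  using S_add[of a "- b"] by (simp add: S_uminus)

lemma coeff_prod_linear:
  "degree (\<Prod>i=1..m. [:- Q i, 1:]) = m \<and> coeff (\<Prod>i=1..m. [:- Q i, 1:]) m = 1"
proof (induction m)
  case (Suc m)
  let ?p = "\<Prod>i=1..m. [:- Q i, 1:]"
  have "?p \<noteq> 0" using Suc by (metis coeff_0 zero_neq_one)
  have "degree (?p * [:- Q (Suc m), 1:]) = Suc m"
    using Suc \<open>?p \<noteq> 0\<close> by (subst degree_mult_eq) auto
  moreover have "coeff (?p * [:- Q (Suc m), 1:]) (Suc m) = 1"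
    using Suc coeff_eq_0[of ?p "Suc m"] by (simp add: mult.commute)
  ultimately show ?case by simp
qed simp

lemma prod_linear_eval:
  "prod_list (map (\<lambda>i. y - S (Q i)) [1..<Suc m]) = (\<Sum>j\<le>m. S (coeff (\<Prod>i=1..m. [:- Q i, 1:]) j) * y ^ j)"
proof (induction m)
  case 0
  then show ?case by (simp add: S_one)
next
  case (Suc m)
  let ?p = "\<Prod>i=1..m. [:- Q i, 1:]" and ?a = "Q (Suc m)"
  have c: "coeff (\<Prod>i=1..Suc m. [:- Q i, 1:]) j = (if j = 0 then 0 else coeff ?p (j - 1)) - ?a * coeff ?p j" for j
    by (cases j) (simp_all add: mult.commute[of _ "[:- ?a, 1:]"])
  have top: "coeff ?p (Suc m) = 0"
    using coeff_prod_linear[of m] by (intro coeff_eq_0) auto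
  have "(\<Sum>j\<le>Suc m. S (coeff (\<Prod>i=1..Suc m. [:- Q i, 1:]) j) * y ^ j)
      = (\<Sum>j\<le>Suc m. S (if j = 0 then 0 else coeff ?p (j - 1)) * y ^ j)
        - (\<Sum>j\<le>Suc m. S ?a * (S (coeff ?p j) * y ^ j))"
    unfolding c sum_subtractf[symmetric]
    by (rule sum.cong) (auto simp: S_mult S_diff S_zero S_uminus left_diff_distrib mult.assoc)
  also have "(\<Sum>j\<le>Suc m. S (if j = 0 then 0 else coeff ?p (j - 1)) * y ^ j) = (\<Sum>j\<le>m. S (coeff ?p j) * y ^ Suc j)"
    by (subst sum.atMost_Suc_shift) (simp add: S_zero)
  also have "\<dots> = (\<Sum>j\<le>m. S (coeff ?p j) * y ^ j) * y"
    by (simp add: sum_distrib_right mult.assoc power_Suc2 del: power_Suc)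
  also have "(\<Sum>j\<le>Suc m. S ?a * (S (coeff ?p j) * y ^ j)) = S ?a * (\<Sum>j\<le>m. S (coeff ?p j) * y ^ j)"
    using top by (simp add: S_zero sum_distrib_left)
  also have "\<dots> = (\<Sum>j\<le>m. S (coeff ?p j) * y ^ j) * S ?a"
    by (rule S_central)
  finally show ?case
    by (simp add: Suc.IH[simplified] right_diff_distrib)
qed

lemma horner_T0: "1 \<le> k \<Longrightarrow> horner (T 0) 0 = 0"
proof -
  assume "1 \<le> k"
  have "horner (T 0) 0 = (\<Sum>j\<le>ell. fc j * T 0 ^ j)"
    using coeff_prod_linear[of ell]
    by (simp add: horner_def cyc_poly_def S_one lessThan_Suc_atMost[symmetric] atLeast0LessThan add.commute)
  then show ?thesis
    using T_cyc[OF \<open>1 \<le> k\<close>] prod_linear_eval[of "T 0" ell] by (simp add: cyc_poly_def)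
qed

text \<open>As for the braid relation, stability under \<open>rop (Suc 0)\<close> reduces the claim
  to row 2. There it amounts to \<open>Xop (W g) = W (rmul (T 0) g)\<close>, where \<open>W\<close>
  is the defect at \<open>T 0\<close>; this holds because \<open>T 0\<close> is a root of
  \<open>cyc_poly\<close> in the coefficient algebra once \<open>k >= 1\<close>.\<close>

lemma rop_four:
  assumes k: "1 \<le> k" and v: "rmod v"
  shows "rop (Suc 0) (rop 0 (rop (Suc 0) (rop 0 v))) = rop 0 (rop (Suc 0) (rop 0 (rop (Suc 0) v)))"
proof -
  define N where "N v \<longleftrightarrow> rmod v \<and>
    rop (Suc 0) (rop 0 (rop (Suc 0) (rop 0 v))) = rop 0 (rop (Suc 0) (rop 0 (rop (Suc 0) v)))" for v
  have N_1: "N (rop (Suc 0) v)" if "N v" for v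
  proof -
    have "rop (Suc 0) (rop 0 (rop (Suc 0) (rop 0 (rop (Suc 0) v)))) = rop (Suc 0) (rop (Suc 0) (rop 0 (rop (Suc 0) (rop 0 v))))"
      using that by (simp add: N_def)
    also have "\<dots> = msc kap (rop (Suc 0) (rop 0 (rop (Suc 0) (rop 0 v))))
        + (rop 0 (rop (Suc 0) (rop 0 v)) + msc kap (rop 0 (rop (Suc 0) (rop 0 v))))"
      using that k by (intro rop_quad rmod_rop) (auto simp: N_def)
    also have "\<dots> = rop 0 (rop (Suc 0) (rop 0 (rop (Suc 0) (rop (Suc 0) v))))"
      using that k rop_quad[of "Suc 0" v] by (simp add: N_def rop_add rop_msc)
    finally show ?thesis
      using that k by (simp add: N_def rmod_rop)
  qed
  have N_diff: "N (u - v)" if "N u" "N v" for u v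
    using that by (simp add: N_def rop_diff rmod_diff)
  have N_top: "N (erow 2 g)" if "rrow g" for g
  proof -
    let ?K = "lmul kap" and ?Y = "Yop (Suc 0)" and ?y = "rmul (T 0)" and ?X = "Xop"
    have yY: "?y (?Y h) = ?Y (?y h)" for h
      by (rule rmul_Yop) simp
    define W where "W h = ?Y (?y h) + ?X h - ?Y (?X h)" for h
    have XW: "?X (W g) = W (?y g)"
    proof -
      have "W g = (\<lambda>s. g (ell - 1) * defect (T 0) s)"
        using Yop_Xop[OF that, of "Suc 0"] yY[of g] by (simp add: W_def)
      then have "?X (W g) = ?y (W g)"
        using Xop_defect[OF horner_T0[OF k], of "g (ell - 1)"] by simp
      then show ?thesis by (simp add: W_def row_simps yY rmul_Xop)
    qed
    have yW: "?y (W h) = W (?y h)" for h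
      by (simp add: W_def row_simps yY rmul_Xop)
    have e: "rop (Suc 0) (erow 2 h) = erow (Suc 0) h + erow 2 (?K (?Y h))"
      "rop (Suc 0) (erow (Suc 0) h) = erow (Suc 0) (?K (h - ?Y h)) + erow 2 (h + ?K h + ?K (?K (?Y h - ?Y (?Y h))))"
      "rop 0 (erow (Suc 0) h) = erow (Suc 0) (?X h)" "rop 0 (erow 2 h) = erow 2 (?y h)" for h
      using rop_erow_Suc[of "Suc 0" h] rop_erow_same[of "Suc 0" h] rop_erow_0[of h] rop_erow_upper[of 0 2 h]
      by (simp_all add: numeral_2_eq_2)
    have D: "rop (Suc 0) (rop 0 (rop (Suc 0) (erow 2 h))) = erow (Suc 0) (?K (W h))
        + erow 2 (?K (?K (?Y (W h))) + (?X h + ?K (?X h)))" for h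
      by (simp add: e erow_simps yY W_def algebra_simps)
    have "rop 0 (rop (Suc 0) (rop 0 (rop (Suc 0) (erow 2 g)))) = rop (Suc 0) (rop 0 (rop (Suc 0) (erow 2 (?y g))))"
      unfolding D by (simp add: e erow_simps yY XW yW rmul_Xop)
    then show ?thesis
      using that k by (simp add: N_def rmod_erow e)
  qed
  have N_low: "N (erow (Suc 0) g)" if "rrow g" for g
  proof -
    have "N (rop (Suc 0) (erow 2 g) - erow 2 (lmul kap (Yop (Suc 0) g)))"
      using that k by (intro N_diff N_1 N_top rrow_closed) auto
    then show ?thesis using rop_erow_Suc[of "Suc 0" g] by (simp add: numeral_2_eq_2)
  qed
  have "N v"
    using v
  proof (induction rule: rmod_induct)
    case (erow r g)
    consider "2 < r" | "r = 1" | "r = 2" using erow by linarith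
    then show ?case
    proof cases
      case 1
      then show ?thesis
        using erow T_four rmod_erow[OF erow(3,1,2)]
        by (simp add: N_def rop_erow_upper rmul_rmul mult.assoc)
    qed (use erow N_top N_low in auto)
  next
    case (add u v)
    then show ?case by (simp add: N_def rop_add rmod_add)
  qed
  then show ?thesis by (simp add: N_def)
qed

text \<open>Generators below \<open>m\<close> commute with \<open>T k ... T r\<close> and with
  \<open>L r\<close>, so they act on the coefficients alone.\<close>

lemma act_erow_upper:
  assumes "x \<in> free_carrier m" "m < r"
  shows "mod.act x (erow r g) = erow r (rmul (ev x) g)"
  using assms(1)
proof (induction rule: free_carrier_induct)
  case (const c)
  then show ?case by (simp add: msc_erow rmul_S)
next
  case (snoc x i)
  then show ?case using assms(2) by (simp add: mod.act_mult rop_erow_upper rmul_rmul ev_mult)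
next
  case (add x y)
  then show ?case by (simp add: mod.act_add_left ev_add rmul_sum_left erow_add)
qed

text \<open>In row 1 the basis elements are \<open>T k ... T 1\<close> times powers of
  \<open>T 0\<close>, and \<open>T 0\<close> acts as the variable of a polynomial modulo
  \<open>cyc_poly\<close>; \<open>a\<close> is a common left coefficient.\<close>

definition prow :: "'b \<Rightarrow> 'a poly \<Rightarrow> nat \<Rightarrow> 'b" where
  "prow a p = (\<lambda>j. if j < ell then a * S (coeff p j) else 0)"

lemma prow_diff: "prow a (p - r) = prow a p - prow a r"
  by (auto simp: prow_def fun_eq_iff fun_apply S_diff right_diff_distrib)

lemma prow_smult: "prow a (smult c p) = lmul (S c) (prow a p)"
  by (auto simp: prow_def fun_eq_iff lmul_def S_mult S_left_commute)

lemma Xop_prow: "Xop (prow a p) = prow a (pCons 0 p - smult (coeff p (ell - 1)) cyc_poly)"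
proof -
  have "fc j * (a * S c) = a * (S c * fc j)" for j c
    using S_central[of _ "a * S c"] by (simp add: mult.assoc)
  then show ?thesis
    using ell_pos
    by (auto simp: Xop_def prow_def fun_eq_iff S_diff S_mult S_zero right_diff_distrib coeff_pCons
        split: nat.split)
qed

abbreviation cyc_rel :: "nat \<Rightarrow> 'a free" where
  "cyc_rel m \<equiv> prod_list (map (\<lambda>i. gen 0 - const (Q i)) [1..<Suc m])"

lemma act_cyc_rel_prow:
  "m < ell \<Longrightarrow> mod.act (cyc_rel m) (erow 1 (prow a 1)) = erow 1 (prow a (\<Prod>i=1..m. [:- Q i, 1:]))"
proof (induction m)
  case (Suc m)
  let ?p = "\<Prod>i=1..m. [:- Q i, 1:]"
  have c: "coeff ?p (ell - 1) = 0"
    using coeff_prod_linear[of m] Suc.prems by (intro coeff_eq_0) auto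
  have "mod.act (cyc_rel (Suc m)) (erow 1 (prow a 1)) = erow 1 (Xop (prow a ?p) - lmul (S (Q (Suc m))) (prow a ?p))"
    using Suc rop_erow_0
    by (simp add: mod.act_mult mod.act_diff_left msc_erow erow_diff)
  also have "Xop (prow a ?p) - lmul (S (Q (Suc m))) (prow a ?p) = prow a (?p * [:- Q (Suc m), 1:])"
    using c by (simp add: Xop_prow prow_smult[symmetric] prow_diff[symmetric] mult.commute[of ?p])
  finally show ?case by simp
qed simp

text \<open>The first \<open>ell - 1\<close> factors stay below degree \<open>ell\<close> and meet
  no reduction. The last one produces \<open>cyc_poly\<close> itself, which \<open>Xop\<close>
  reduces to zero.\<close>

lemma act_cyc_rel_one: "mod.act (cyc_rel ell) (erow 1 (prow a 1)) = 0"
proof -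
  obtain m where m: "ell = Suc m" using ell_pos by (cases ell) auto
  have less: "m < ell" using m by simp
  have r: "cyc_rel ell = cyc_rel m * (gen 0 - const (Q ell))"
  proof -
    have "[1..<Suc ell] = [1..<Suc m] @ [ell]" using m by simp
    then show ?thesis by (simp del: upt_Suc)
  qed
  let ?p = "\<Prod>i=1..m. [:- Q i, 1:]"
  have c: "coeff ?p (ell - 1) = 1"
    using coeff_prod_linear[of m] m by simp
  have f: "cyc_poly = pCons 0 ?p - smult (Q ell) ?p"
    unfolding cyc_poly_def by (simp add: m mult.commute[of ?p])
  have "mod.act (cyc_rel ell) (erow 1 (prow a 1)) = erow 1 (Xop (prow a ?p) - lmul (S (Q ell)) (prow a ?p))"
    using act_cyc_rel_prow[OF less, of a] rop_erow_0
    unfolding r by (simp add: mod.act_mult mod.act_diff_left msc_erow erow_diff del: upt_Suc)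
  also have "Xop (prow a ?p) - lmul (S (Q ell)) (prow a ?p) = 0"
    using c by (simp add: Xop_prow prow_smult[symmetric] prow_diff[symmetric] f)
  finally show ?thesis by (simp add: erow_zero)
qed

lemma gen_0_commute_cyc_rel: "gen 0 ^ j * cyc_rel m = cyc_rel m * gen 0 ^ j"
proof -
  have *: "x * prod_list xs = prod_list xs * x" if "\<And>y. y \<in> set xs \<Longrightarrow> x * y = y * x"
    for x :: "'a free" and xs
    using that by (induction xs) (simp_all add: mult.assoc commute_left)
  have "gen 0 * cyc_rel m = cyc_rel m * gen 0"
    by (rule *) (auto simp: left_diff_distrib right_diff_distrib const_central[of _ "gen 0"] simp del: upt_Suc)
  then show ?thesis by (rule power_commuting_commutes)
qed

lemma prow_monom: "j < ell \<Longrightarrow> erow 1 (prow a (monom 1 j)) = mod.act (gen 0 ^ j) (erow 1 (prow a 1))"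
proof (induction j)
  case 0
  then show ?case by (simp add: monom_0 one_pCons)
next
  case (Suc j)
  then have "coeff (monom (1 :: 'a) j) (ell - 1) = 0" by auto
  with Suc show ?case
    using rop_erow_0[of "prow a (monom 1 j)"]
    by (simp add: power_Suc2 mod.act_mult Xop_prow monom_Suc del: power_Suc)
qed

text \<open>In the higher rows the relation acts through the coefficients. In row 1 a general
  exponent is reached from exponent 0 by powers of \<open>gen 0\<close>, which commute with the
  relator, so that \<open>act_cyc_rel_one\<close> suffices.\<close>

lemma act_cyc_rel:
  assumes "rmod v"
  shows "mod.act (cyc_rel ell) v = 0"
  using assms
proof (induction rule: rmod_induct)
  case (erow r g)
  show ?case
  proof (cases "r = 1")
    case False
    have c: "cyc_rel ell \<in> free_carrier 1"
      by (auto intro!: free_carrier_prod_list free_carrier_diff free_carrier_gen simp del: upt_Suc)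
    \<comment> \<open>A row \<open>r >= 2\<close> with \<open>r <= Suc k\<close> forces
      \<open>k >= 1\<close>, so the cyclotomic relation is available for the coefficients.\<close>
    have "ev (cyc_rel ell) = 0"
      using T_cyc erow False by (simp add: ev_prod_list ev_diff comp_def del: upt_Suc)
    then show ?thesis
      using act_erow_upper[OF c, of r g] erow False by (simp add: rmul_def erow_def fun_eq_iff fun_apply del: upt_Suc)
  next
    case True
    have sum: "erow 1 (sum h J) = (\<Sum>j\<in>J. erow 1 (h j))" for h and J :: "nat set"
      by (induction J rule: infinite_finite_induct) (auto simp: erow_zero erow_add)
    have "g = (\<Sum>j<ell. prow (g j) (monom 1 j))"
    proof
      fix i
      have "(\<Sum>j\<in>J. prow (g j) (monom 1 j)) i = (\<Sum>j\<in>J. prow (g j) (monom 1 j) i)" for J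
        by (induction J rule: infinite_finite_induct) (auto simp: fun_apply)
      also have "(\<Sum>j<ell. prow (g j) (monom 1 j) i) = (\<Sum>j<ell. if j = i then g i else 0)"
        by (rule sum.cong) (auto simp: prow_def S_one S_zero)
      also have "\<dots> = g i" using erow by (auto simp: rrow_def)
      finally show "g i = (\<Sum>j<ell. prow (g j) (monom 1 j)) i" by simp
    qed
    then have "erow 1 g = (\<Sum>j<ell. mod.act (gen 0 ^ j) (erow 1 (prow (g j) 1)))"
      using prow_monom by (metis (mono_tags, lifting) sum lessThan_iff sum.cong)
    then have "mod.act (cyc_rel ell) (erow 1 g) =
        (\<Sum>j<ell. mod.act (gen 0 ^ j * cyc_rel ell) (erow 1 (prow (g j) 1)))"
      by (simp add: mod.act_sum mod.act_mult del: upt_Suc)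
    also have "\<dots> = 0"
      unfolding gen_0_commute_cyc_rel mod.act_mult act_cyc_rel_one by simp
    finally show ?thesis using True by simp
  qed
qed (simp add: mod.act_add del: upt_Suc)

lemma act_hecke_rel:
  assumes "x \<in> hecke_rels ell q Q (Suc k)" "rmod v"
  shows "mod.act x v = 0"
proof -
  have "mod.act ((gen i - const q) * (gen i + 1)) v = 0" if "1 \<le> i" "i < Suc k" for i
  proof -
    have "mod.act ((gen i - const q) * (gen i + 1)) v
        = rop i (rop i v - msc (S q) v) + (rop i v - msc (S q) v)"
      by (simp add: mod.act_mult mod.act_add_left mod.act_diff_left)
    moreover have "msc (S q) w = w + msc kap w" for w
      by (simp add: msc_def lmul_Sq fun_eq_iff fun_apply)
    ultimately show ?thesis
      using rop_quad[of i v] that assms(2) by (simp add: rop_diff rop_add rop_msc algebra_simps)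
  qed
  moreover have "mod.act (gen i * gen j - gen j * gen i) v = 0" if "i + 1 < j" "j < Suc k" for i j
    using that rop_comm[of i j v] assms(2) by (simp add: mod.act_mult mod.act_diff_left)
  moreover have "mod.act (gen i * gen (i + 1) * gen i - gen (i + 1) * gen i * gen (i + 1)) v = 0"
    if "1 \<le> i" "i + 1 < Suc k" for i
    using that rop_braid[of i v] assms(2) by (simp add: mod.act_mult mod.act_diff_left)
  moreover have "mod.act (gen 0 * gen 1 * gen 0 * gen 1 - gen 1 * gen 0 * gen 1 * gen 0) v = 0" if "2 \<le> Suc k"
    using that rop_four[of v] assms(2) by (simp add: mod.act_mult mod.act_diff_left)
  moreover have "mod.act (cyc_rel ell) v = 0"
    using assms(2) by (rule act_cyc_rel)
  ultimately show ?thesis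
    using assms(1) unfolding hecke_rels_def by (auto simp del: upt_Suc split: if_splits)
qed

end

end

section \<open>Coefficients read off from the unit vector\<close>

context hecke_gens
begin

context
  notes fun_apply [simp del]
begin

lemma act_hecke_ideal:
  assumes "x \<in> hecke_ideal ell q Q (Suc k)"
  shows "rmod v \<Longrightarrow> mod.act x v = 0"
  using assms
proof (induction arbitrary: v rule: hecke_ideal_induct)
  case (rel x)
  then show ?case by (rule act_hecke_rel)
next
  case zero
  then show ?case by simp
next
  case (add x y)
  then show ?case by (simp add: mod.act_add_left)
next
  case (left x y)
  then show ?case by (simp add: mod.act_mult rmod_act)
next
  case (right x y)
  then show ?case by (simp add: mod.act_mult)
qed

lemma lmul_uminus: "lmul c (- g) = - lmul c g"
  by (simp add: lmul_def fun_eq_iff)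

lemma erow_uminus: "erow r (- g) = - erow r g"
  by (simp add: erow_def fun_eq_iff fun_apply)

text \<open>\<open>T i\<close> carries row \<open>i + 1\<close> to row \<open>i\<close>, where
  \<open>L i\<close> raises exponents by induction; the second \<open>T i\<close> brings the result
  back with a factor \<open>q\<close>, cancelled by \<open>qi\<close>. The vanishing top coefficient
  excludes a reduction by \<open>cyc_poly\<close>.\<close>

lemma act_free_L:
  assumes "1 \<le> i" "i \<le> Suc k" "rrow g" "g (ell - 1) = 0"
  shows "mod.act (free_L qi i) (erow i g) = erow i (Xop g)"
  using assms
proof (induction i arbitrary: g rule: dec_induct)
  case base
  then show ?case using rop_erow_0[of g] by simp
next
  case (step i)
  let ?K = "lmul kap" and ?Y = "Yop i" and ?y = "rmul (L i)"
  have up: "mod.act (free_L qi i) (erow (Suc i) h) = erow (Suc i) (?y h)" for h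
    using act_erow_upper[of "free_L qi i" i "Suc i" h] by (simp add: free_L_carrier ev_free_L)
  have yY: "?y (?Y g) = ?Y (?y g)"
    by (rule rmul_Yop) simp
  \<comment> \<open>The defect has the coefficient \<open>g (ell - 1)\<close>, which is
    zero.\<close>
  have W: "?Y (?y g) + Xop g - ?Y (Xop g) = 0"
    using Yop_Xop[OF step.prems(2), of i] step.prems(3) yY by (simp add: fun_eq_iff fun_apply)
  then have W': "?Y (Xop g) = ?Y (?y g) + Xop g" by (simp add: algebra_simps)
  have W'': "?Y (?Y (Xop g)) = ?Y (?Y (?y g)) + ?Y (Xop g)"
    by (simp add: W' Yop_add)
  have i: "0 < i" using step by simp
  have "mod.act (free_L qi (Suc i)) (erow (Suc i) g)
      = msc (S qi) (rop i (mod.act (free_L qi i) (rop i (erow (Suc i) g))))"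
    using step i by (simp add: free_L_Suc mod.act_mult rop_msc mod.act_sc)
  also have "mod.act (free_L qi i) (rop i (erow (Suc i) g)) = erow i (Xop g) + erow (Suc i) (?K (?Y (?y g)))"
    using step i by (simp add: rop_erow_Suc mod.act_add up erow_simps yY)
  also have "rop i (erow i (Xop g) + erow (Suc i) (?K (?Y (?y g)))) = erow (Suc i) (Xop g + ?K (Xop g))"
    using i by (simp add: rop_erow_Suc rop_erow_same erow_simps W' W'' lmul_uminus erow_uminus algebra_simps)
  also have "msc (S qi) (erow (Suc i) (Xop g + ?K (Xop g))) = erow (Suc i) (Xop g)"
    unfolding lmul_Sq[symmetric] msc_erow by (simp add: lmul_def mult.assoc[symmetric] S_qi_q)
  finally show ?case .
qed

text \<open>The vector \<open>b\<^sub>k\<^sub>+\<^sub>1\<^sub>,\<^sub>0\<close>, that is, the unit of the algebra.\<close>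

definition e0 :: "nat \<Rightarrow> nat \<Rightarrow> 'b" where
  "e0 = erow (Suc k) (\<lambda>j. if j = 0 then 1 else 0)"

lemma rmod_e0: "rmod e0"
  unfolding e0_def using ell_pos by (intro rmod_erow) (auto simp: rrow_def)

lemma act_e0: "x \<in> free_carrier k \<Longrightarrow> mod.act x e0 = erow (Suc k) (\<lambda>j. if j = 0 then ev x else 0)"
  unfolding e0_def by (subst act_erow_upper[of _ k]) (auto simp: rmul_def intro!: arg_cong[of _ _ "erow (Suc k)"])

lemma act_e0_L_power:
  assumes "x \<in> free_carrier k" "i < ell"
  shows "mod.act (x * free_L qi (Suc k) ^ i) e0 = erow (Suc k) (\<lambda>j. if j = i then ev x else 0)"
  using assms(2)
proof (induction i)
  case 0
  then show ?case by (simp add: act_e0 assms)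
next
  case (Suc i)
  let ?g = "\<lambda>j. if j = i then ev x else 0"
  have "mod.act (x * free_L qi (Suc k) ^ Suc i) e0 = mod.act (free_L qi (Suc k)) (erow (Suc k) ?g)"
    using Suc by (simp add: power_Suc2 mod.act_mult[of "x * _"] flip: mult.assoc del: power_Suc)
  also have "\<dots> = erow (Suc k) (Xop ?g)"
    using Suc.prems by (intro act_free_L) (auto simp: rrow_def)
  also have "Xop ?g = (\<lambda>j. if j = Suc i then ev x else 0)"
    using Suc.prems by (auto simp: Xop_def fun_eq_iff)
  finally show ?case .
qed

lemma rop_upper: "Suc m < i \<Longrightarrow> rop m v i = rmul (T m) (v i)"
  by (simp add: rop_def)

text \<open>\<open>T k\<close> moves the unit vector from row \<open>k + 1\<close> to row
  \<open>k\<close>, without correction because its exponent is 0. The generators below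
  \<open>k\<close> preserve the vanishing of row \<open>k + 1\<close>, so the bimodule summand is
  invisible there.\<close>

lemma act_e0_T:
  assumes "0 < k" "a \<in> free_carrier k" "b \<in> free_carrier k"
  shows "mod.act (a * gen k * b) e0 (Suc k) = 0"
proof -
  let ?g = "\<lambda>j. if j = 0 then ev a else 0"
  have "mod.act (a * gen k) e0 = erow k ?g + erow (Suc k) (lmul kap (Yop k ?g))"
    using assms by (simp add: mod.act_mult act_e0 rop_erow_Suc)
  also have "Yop k ?g = 0"
    by (auto simp: Yop_def fun_eq_iff fun_apply intro!: sum.neutral)
  finally have eq: "mod.act (a * gen k) e0 = erow k ?g + erow (Suc k) (lmul kap 0)" .
  have v: "mod.act (a * gen k) e0 (Suc k) = 0"
    unfolding eq by (simp add: row_op_zero erow_def fun_apply)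
  have "mod.act b v (Suc k) = 0" if "v (Suc k) = 0" for v
    using assms(3)
  proof (induction rule: free_carrier_induct)
    case (const c)
    then show ?case unfolding mod.act_const by (simp add: that msc_def row_op_zero)
  next
    case (snoc x i)
    then show ?case by (simp add: mod.act_mult rop_upper row_op_zero)
  next
    case (add x y)
    then show ?case by (simp add: mod.act_add_left fun_apply)
  qed
  from this[of "mod.act (a * gen k) e0", OF v] show ?thesis by (simp add: mod.act_mult[of "a * gen k"])
qed

end

end

subsection \<open>The Hecke algebras as generated families\<close>

definition pcoset :: "'a::idom param \<Rightarrow> 'a free \<Rightarrow> 'a free set" where
  "pcoset p x = (case p of (k, ell, q, Q) \<Rightarrow> hcoset ell q Q k x)"

definition hfam_of :: "('a::idom param \<Rightarrow> 'a free) \<Rightarrow> 'a hfam" where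
  "hfam_of f = Abs_hfam (\<lambda>p. pcoset p (f p))"

definition fam_carrier :: "('a::idom param \<Rightarrow> 'a free) \<Rightarrow> bool" where
  "fam_carrier f \<longleftrightarrow> (\<forall>p. f p \<in> free_carrier (fst p))"

lemma hproj_hfam_of: "fam_carrier f \<Longrightarrow> hproj (hfam_of f) p = pcoset p (f p)"
  unfolding hfam_of_def
  by (subst Abs_hfam_inverse) (auto simp: pcoset_def param_hecke_def fam_carrier_def)

lemma hfam_eqI: "(\<And>p. hproj x p = hproj y p) \<Longrightarrow> x = y"
  by (metis hproj_inject ext)

lemma fam_carrier_closed:
  "fam_carrier f \<Longrightarrow> fam_carrier g \<Longrightarrow> fam_carrier (\<lambda>p. f p + g p)"
  "fam_carrier f \<Longrightarrow> fam_carrier g \<Longrightarrow> fam_carrier (\<lambda>p. f p - g p)"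
  "fam_carrier f \<Longrightarrow> fam_carrier g \<Longrightarrow> fam_carrier (\<lambda>p. f p * g p)"
  "fam_carrier (\<lambda>p. 1)" "fam_carrier (\<lambda>p. 0)" "fam_carrier (\<lambda>p. const c)"
  by (auto simp: fam_carrier_def simp del: split_paired_All)

lemma fam_carrierD: "fam_carrier f \<Longrightarrow> f (k, ell, q, Q) \<in> free_carrier k"
  unfolding fam_carrier_def by (metis fst_conv)

lemma hfam_of_add: "fam_carrier f \<Longrightarrow> fam_carrier g \<Longrightarrow> hfam_of f + hfam_of g = hfam_of (\<lambda>p. f p + g p)"
  by (rule hfam_eqI, case_tac p)
     (simp add: plus_hfam.rep_eq hproj_hfam_of fam_carrier_closed pcoset_def param_hecke_def
       fam_carrierD hcoset_add)

lemma hfam_of_mult: "fam_carrier f \<Longrightarrow> fam_carrier g \<Longrightarrow> hfam_of f * hfam_of g = hfam_of (\<lambda>p. f p * g p)"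
  by (rule hfam_eqI, case_tac p)
     (simp add: times_hfam.rep_eq hproj_hfam_of fam_carrier_closed pcoset_def param_hecke_def
       fam_carrierD hcoset_mult)

lemma hfam_of_diff: "fam_carrier f \<Longrightarrow> fam_carrier g \<Longrightarrow> hfam_of f - hfam_of g = hfam_of (\<lambda>p. f p - g p)"
  by (rule hfam_eqI, case_tac p)
     (simp add: minus_hfam.rep_eq hproj_hfam_of fam_carrier_closed pcoset_def param_hecke_def
       fam_carrierD hcoset_diff)

lemma hfam_of_one: "hfam_of (\<lambda>p. 1) = 1"
  by (rule hfam_eqI)
     (auto simp: one_hfam.rep_eq hproj_hfam_of fam_carrier_closed pcoset_def param_hecke_def
       hcoset_one split: prod.splits)

lemma hfam_of_zero: "hfam_of (\<lambda>p. 0) = 0"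
  by (rule hfam_eqI)
     (auto simp: zero_hfam.rep_eq hproj_hfam_of fam_carrier_closed pcoset_def param_hecke_def
       hcoset_zero split: prod.splits)

lemma hfam_of_prod_list:
  "(\<And>f. f \<in> set fs \<Longrightarrow> fam_carrier f) \<Longrightarrow>
    prod_list (map hfam_of fs) = hfam_of (\<lambda>p. prod_list (map (\<lambda>f. f p) fs)) \<and>
    fam_carrier (\<lambda>p. prod_list (map (\<lambda>f. f p) fs))"
  by (induction fs) (auto simp: hfam_of_one hfam_of_mult fam_carrier_closed)

definition hS :: "'a::idom \<Rightarrow> 'a hfam" where
  "hS c = hfam_of (\<lambda>p. const c)"

text \<open>\<open>Q 1\<close> kills the first cyclotomic factor and \<open>q\<close> a factor of
  the quadratic relation. At the chosen parameter the indices \<open>i >= k\<close> also get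
  scalars, since \<open>gen i\<close> is then outside the carrier.\<close>

definition free_T :: "nat \<Rightarrow> nat \<Rightarrow> 'a::idom \<Rightarrow> (nat \<Rightarrow> 'a) \<Rightarrow> nat \<Rightarrow> 'a param \<Rightarrow> 'a free" where
  "free_T k ell q Q i = (\<lambda>p. if p = (k, ell, q, Q) \<and> i < k then gen i
     else if i = 0 then const (Q 1) else const q)"

text \<open>
  Away from the parameter \<open>(k, ell, q, Q)\<close> the generators are scalars satisfying the defining relations,
  so that these relations hold in the whole family.
\<close>

definition hfT :: "nat \<Rightarrow> nat \<Rightarrow> 'a::idom \<Rightarrow> (nat \<Rightarrow> 'a) \<Rightarrow> nat \<Rightarrow> 'a hfam" where
  "hfT k ell q Q i = hfam_of (free_T k ell q Q i)"

lemma fam_carrier_free_T: "fam_carrier (free_T k ell q Q i)"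
  by (auto simp: fam_carrier_def free_T_def intro!: free_carrier_gen)

lemma free_T_other:
  "p \<noteq> (k, ell, q, Q) \<Longrightarrow> free_T k ell q Q i p = (if i = 0 then const (Q 1) else const q)"
  by (simp add: free_T_def)

lemma free_T_self: "i < k \<Longrightarrow> free_T k ell q Q i (k, ell, q, Q) = gen i"
  by (simp add: free_T_def)

lemma hfam_of_eqI:
  assumes "fam_carrier f" "fam_carrier g" "\<And>p. p \<noteq> (k, ell, q, Q) \<Longrightarrow> f p = g p"
    and "f (k, ell, q, Q) - g (k, ell, q, Q) \<in> hecke_rels ell q Q k"
  shows "hfam_of f = hfam_of g"
proof (rule hfam_eqI)
  fix p
  have "f (k, ell, q, Q) \<in> free_carrier k" "g (k, ell, q, Q) \<in> free_carrier k"
    using assms(1,2) unfolding fam_carrier_def by (metis fst_conv)+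
  moreover have "f (k, ell, q, Q) - g (k, ell, q, Q) \<in> hecke_ideal ell q Q k"
    using assms(4) hecke_rels_ideal by blast
  ultimately have "pcoset (k, ell, q, Q) (f (k, ell, q, Q)) = pcoset (k, ell, q, Q) (g (k, ell, q, Q))"
    by (simp add: pcoset_def hcoset_eq_iff)
  then show "hproj (hfam_of f) p = hproj (hfam_of g) p"
    using assms(1-3) by (cases "p = (k, ell, q, Q)") (simp_all add: hproj_hfam_of)
qed

lemma hecke_gens_hfam:
  fixes q :: "'a::idom"
  assumes "q * qi = 1" "1 \<le> ell"
  shows "hecke_gens hS (hfT k ell q Q) q qi Q ell k"
proof -
  let ?p = "(k, ell, q, Q)"
  note c = fam_carrier_closed fam_carrier_free_T
  note h = hfT_def hS_def hfam_of_mult hfam_of_add hfam_of_diff hfam_of_one[symmetric] c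
  have const_comm: "const a * const b = const b * (const a :: 'a free)" for a b
    by (rule const_central)
  show ?thesis
  proof
    fix a b :: 'a and x :: "'a hfam"
    show "hS (a + b) = hS a + hS b" by (simp add: h const_add)
    show "hS (a * b) = hS a * hS b" by (simp add: h const_mult)
    show "hS (1 :: 'a) = 1" by (simp add: h)
    show "hS a * x = x * hS a"
    proof (rule hfam_eqI)
      fix p :: "'a param"
      obtain k' ell' q' Q' where p: "p = (k', ell', q', Q')" by (cases p)
      have "hproj x p \<in> carrier (hecke ell' q' Q' k')"
        using hproj_carrier[of x p] by (simp add: p param_hecke_def)
      then obtain y where y: "hproj x p = hcoset ell' q' Q' k' y" "y \<in> free_carrier k'"
        by (auto simp: carrier_hecke)
      have "hproj (hS a) p = hcoset ell' q' Q' k' (const a)"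
        by (simp add: hS_def hproj_hfam_of c pcoset_def p)
      then show "hproj (hS a * x) p = hproj (x * hS a) p"
        using y const_central[of a y]
        by (simp add: times_hfam.rep_eq p param_hecke_def flip: hcoset_mult)
    qed
    show "q * qi = 1" "1 \<le> ell" by (fact assms)+
  next
    assume k: "1 \<le> k"
    let ?f = "\<lambda>i p. free_T k ell q Q 0 p - const (Q i)"
    have "\<And>f. f \<in> set (map ?f [1..<Suc ell]) \<Longrightarrow> fam_carrier f"
      by (auto simp: c simp del: upt_Suc)
    note F = hfam_of_prod_list[OF this]
    have "prod_list (map (\<lambda>i. hfT k ell q Q 0 - hS (Q i)) [1..<Suc ell]) =
        prod_list (map hfam_of (map ?f [1..<Suc ell]))"
      by (simp add: h comp_def del: upt_Suc)
    also have "\<dots> = hfam_of (\<lambda>p. prod_list (map (\<lambda>f. f p) (map ?f [1..<Suc ell])))"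
      using F by (rule conjunct1)
    also have "\<dots> = hfam_of (\<lambda>p. 0)"
    proof (rule hfam_of_eqI[of _ _ k ell q Q])
      show "fam_carrier (\<lambda>p. prod_list (map (\<lambda>f. f p) (map ?f [1..<Suc ell])))"
        using F by (rule conjunct2)
      fix p :: "'a param" assume "p \<noteq> ?p"
      \<comment> \<open>The factor that vanishes away from the parameter is the one for
        \<open>Q 1\<close>; it occurs because \<open>ell >= 1\<close>.\<close>
      moreover have "[1..<Suc ell] = 1 # [2..<Suc ell]"
        using assms(2) upt_conv_Cons[of 1 "Suc ell"] by (simp add: numeral_2_eq_2 del: upt_Suc)
      ultimately show "prod_list (map (\<lambda>f. f p) (map ?f [1..<Suc ell])) = 0"
        by (simp add: free_T_other del: upt_Suc)
    next
      show "prod_list (map (\<lambda>f. f ?p) (map ?f [1..<Suc ell])) - 0 \<in> hecke_rels ell q Q k"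
        using k by (simp add: hecke_rels_def free_T_self comp_def del: upt_Suc)
    qed (rule c)
    finally show "prod_list (map (\<lambda>i. hfT k ell q Q 0 - hS (Q i)) [1..<Suc ell]) = 0"
      by (simp add: hfam_of_zero)
  next
    assume k: "2 \<le> k"
    show "hfT k ell q Q 0 * hfT k ell q Q 1 * hfT k ell q Q 0 * hfT k ell q Q 1 =
        hfT k ell q Q 1 * hfT k ell q Q 0 * hfT k ell q Q 1 * hfT k ell q Q 0"
      by (simp add: h, rule hfam_of_eqI[of _ _ k ell q Q])
         (use k in \<open>auto simp: c free_T_other free_T_self hecke_rels_def const_mult[symmetric] mult_ac\<close>)
  next
    fix i assume i: "1 \<le> i" "i < k"
    show "(hfT k ell q Q i - hS q) * (hfT k ell q Q i + 1) = 0"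
      by (simp add: h hfam_of_zero[symmetric], rule hfam_of_eqI[of _ _ k ell q Q])
         (use i in \<open>auto simp: c free_T_other free_T_self hecke_rels_def\<close>)
  next
    fix i j assume i: "i + 1 < j" "j < k"
    show "hfT k ell q Q i * hfT k ell q Q j = hfT k ell q Q j * hfT k ell q Q i"
      by (simp add: h, rule hfam_of_eqI[of _ _ k ell q Q])
         (use i in \<open>auto simp: c free_T_other free_T_self hecke_rels_def const_mult[symmetric] mult_ac\<close>)
  next
    fix i assume i: "1 \<le> i" "i + 1 < k"
    show "hfT k ell q Q i * hfT k ell q Q (i + 1) * hfT k ell q Q i =
        hfT k ell q Q (i + 1) * hfT k ell q Q i * hfT k ell q Q (i + 1)"
      by (simp add: h, rule hfam_of_eqI[of _ _ k ell q Q])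
         (use i in \<open>auto simp: c free_T_other free_T_self hecke_rels_def\<close>)
  qed
qed

subsection \<open>Uniqueness of the descending decomposition\<close>

lemma qinv_eq: "(q :: 'a::idom) * qi = 1 \<Longrightarrow> qinv q = qi"
  unfolding qinv_def by (rule the_equality) (auto, metis mult.assoc mult.commute mult_1)

text \<open>A lift of \<open>HTH\<close> to polynomials, growing by one summand at a time so that it
  admits induction. For \<open>m = 0\<close> it contains only 0, which is the convention of
  \<open>HTH\<close> for \<open>k = 1\<close>.\<close>

inductive_set free_TT :: "nat \<Rightarrow> 'a::idom free set" for m where
  free_TT_zero: "0 \<in> free_TT m"
| free_TT_add: "x \<in> free_TT m \<Longrightarrow> 0 < m \<Longrightarrow> a \<in> free_carrier m \<Longrightarrow> b \<in> free_carrier m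
    \<Longrightarrow> x + a * gen m * b \<in> free_TT m"

lemma free_carrier_Suc_mult_gen:
  "a \<in> free_carrier m \<Longrightarrow> b \<in> free_carrier m \<Longrightarrow> a * gen m * b \<in> free_carrier (Suc m)"
  by (auto intro!: free_carrier_mult free_carrier_gen elim: free_carrier_mono)

lemma free_TT_carrier: "x \<in> free_TT m \<Longrightarrow> x \<in> free_carrier (Suc m)"
  by (induction rule: free_TT.induct) (auto intro: free_carrier_Suc_mult_gen)

lemma free_carrier_SucI: "x \<in> free_carrier m \<Longrightarrow> x \<in> free_carrier (Suc m)"
  by (rule free_carrier_mono) auto

lemma power_free_carrier: "x \<in> free_carrier k \<Longrightarrow> x ^ i \<in> free_carrier k"
  by (induction i) auto

context
  fixes ell :: nat and q qi :: "'a::idom" and Q :: "nat \<Rightarrow> 'a"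
  assumes q_qi: "q * qi = 1" and ell: "1 \<le> ell"
begin

text \<open>The way back from the family: an equation between values of \<open>ev\<close> becomes,
  in one component, an equation between cosets.\<close>

lemma hproj_ev:
  assumes "x \<in> free_carrier k"
  shows "hproj (hecke_gens.ev hS (hfT k ell q Q) x) (k, ell, q, Q) = hcoset ell q Q k x"
proof -
  interpret hecke_gens hS "hfT k ell q Q" q qi Q ell k
    by (rule hecke_gens_hfam[OF q_qi ell])
  show ?thesis using assms
  proof (induction rule: free_carrier_induct)
    case (const c)
    then show ?case unfolding ev_const by (simp add: hS_def hproj_hfam_of fam_carrier_closed pcoset_def)
  next
    case (snoc x i)
    have "hproj (hfT k ell q Q i) (k, ell, q, Q) = hcoset ell q Q k (gen i)"
      using snoc by (simp add: hfT_def hproj_hfam_of fam_carrier_free_T pcoset_def free_T_self)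
    then show ?case
      using snoc unfolding ev_mult ev_gen
      by (simp add: times_hfam.rep_eq param_hecke_def hcoset_mult free_carrier_gen)
  next
    case (add x y)
    then show ?case unfolding ev_add by (simp add: plus_hfam.rep_eq param_hecke_def hcoset_add)
  qed
qed

lemma hL_eq: "m \<le> k \<Longrightarrow> hL ell q Q k m = hcoset ell q Q k (free_L qi m)"
proof (induction m rule: less_induct)
  case (less m)
  consider "m = 0" | "m = Suc 0" | l where "m = Suc (Suc l)"
    by (metis not0_implies_Suc)
  then show ?case
  proof cases
    case 3
    have c: "(gen (Suc l) :: 'a free) \<in> free_carrier k" "free_L qi (Suc l) \<in> free_carrier k"
      using less.prems 3 by (auto intro: free_carrier_gen free_L_carrier)
    then have "hcoset ell q Q k (gen (Suc l) * free_L qi (Suc l) * gen (Suc l)) =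
        hT ell q Q k (Suc l) \<otimes>\<^bsub>hecke ell q Q k\<^esub> hL ell q Q k (Suc l) \<otimes>\<^bsub>hecke ell q Q k\<^esub> hT ell q Q k (Suc l)"
      using less.IH[of "Suc l"] less.prems 3 by (simp add: hcoset_mult hT_eq free_carrier_mult)
    then show ?thesis
      using c 3 qinv_eq[OF q_qi] hsmult_hcoset[of "gen (Suc l) * free_L qi (Suc l) * gen (Suc l)" k ell q Q qi]
      by (simp add: free_carrier_mult)
  qed (simp_all add: hcoset_zero hT_eq)
qed

lemma hcoset_mult_gen:
  assumes "a \<in> free_carrier m" "b \<in> free_carrier m"
  shows "hcoset ell q Q (Suc m) (a * gen m * b) = hcoset ell q Q (Suc m) a \<otimes>\<^bsub>hecke ell q Q (Suc m)\<^esub> hT ell q Q (Suc m) m \<otimes>\<^bsub>hecke ell q Q (Suc m)\<^esub> hcoset ell q Q (Suc m) b"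
  using assms[THEN free_carrier_SucI]
  by (simp add: hT_eq hcoset_mult free_carrier_mult free_carrier_gen)

lemma HTH_hcoset:
  assumes "x \<in> free_TT m"
  shows "hcoset ell q Q (Suc m) x \<in> HTH ell q Q (Suc m)"
proof (cases "m = 0")
  case True
  then have "x = 0" using assms by (auto elim: free_TT.cases)
  then show ?thesis using True by (simp add: HTH_def hcoset_zero)
next
  case False
  interpret R: ring "hecke ell q Q (Suc m)" by (rule hecke_ring)
  have "\<exists>N a b. a \<in> {..<N::nat} \<rightarrow> carrier (hecke ell q Q m) \<and> b \<in> {..<N} \<rightarrow> carrier (hecke ell q Q m) \<and> hcoset ell q Q (Suc m) x =
      (\<Oplus>\<^bsub>hecke ell q Q (Suc m)\<^esub>i\<in>{..<N}. hemb ell q Q (Suc m) (a i) \<otimes>\<^bsub>hecke ell q Q (Suc m)\<^esub> hT ell q Q (Suc m) m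
        \<otimes>\<^bsub>hecke ell q Q (Suc m)\<^esub> hemb ell q Q (Suc m) (b i))"
    using assms
  proof (induction rule: free_TT.induct)
    case free_TT_zero
    show ?case by (intro exI[of _ 0] exI) (simp add: hcoset_zero)
  next
    case (free_TT_add x a' b')
    then obtain N :: nat and a b where ab: "a \<in> {..<N} \<rightarrow> carrier (hecke ell q Q m)" "b \<in> {..<N} \<rightarrow> carrier (hecke ell q Q m)"
      "hcoset ell q Q (Suc m) x = (\<Oplus>\<^bsub>hecke ell q Q (Suc m)\<^esub>i\<in>{..<N}. hemb ell q Q (Suc m) (a i) \<otimes>\<^bsub>hecke ell q Q (Suc m)\<^esub> hT ell q Q (Suc m) m
        \<otimes>\<^bsub>hecke ell q Q (Suc m)\<^esub> hemb ell q Q (Suc m) (b i))" by blast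
    let ?a = "a(N := hcoset ell q Q m a')" and ?b = "b(N := hcoset ell q Q m b')"
    let ?t = "\<lambda>a b i. hemb ell q Q (Suc m) (a i) \<otimes>\<^bsub>hecke ell q Q (Suc m)\<^esub> hT ell q Q (Suc m) m
        \<otimes>\<^bsub>hecke ell q Q (Suc m)\<^esub> hemb ell q Q (Suc m) (b i)"
    have emb: "hemb ell q Q (Suc m) c \<in> carrier (hecke ell q Q (Suc m))" if "c \<in> carrier (hecke ell q Q m)" for c
      using that by (auto simp: carrier_hecke[of _ _ _ m] hemb_hcoset intro!: hcoset_carrier free_carrier_SucI)
    have T: "hT ell q Q (Suc m) m \<in> carrier (hecke ell q Q (Suc m))"
      by (auto simp: hT_eq intro!: hcoset_carrier free_carrier_gen)
    have car: "?t ?a ?b i \<in> carrier (hecke ell q Q (Suc m))" if "i < Suc N" for i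
      using that ab(1,2) free_TT_add.hyps
      by (cases "i = N") (auto intro!: R.m_closed emb T simp: Pi_iff less_Suc_eq)
    have "(\<Oplus>\<^bsub>hecke ell q Q (Suc m)\<^esub>i\<in>{..<Suc N}. ?t ?a ?b i) = ?t ?a ?b N \<oplus>\<^bsub>hecke ell q Q (Suc m)\<^esub> (\<Oplus>\<^bsub>hecke ell q Q (Suc m)\<^esub>i\<in>{..<N}. ?t ?a ?b i)"
      unfolding lessThan_Suc
      by (rule R.finsum_insert) (auto intro!: Pi_I car simp del: fun_upd_apply)
    also have "(\<Oplus>\<^bsub>hecke ell q Q (Suc m)\<^esub>i\<in>{..<N}. ?t ?a ?b i) = (\<Oplus>\<^bsub>hecke ell q Q (Suc m)\<^esub>i\<in>{..<N}. ?t a b i)"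
    proof (rule R.finsum_cong'[OF refl])
      show "?t a b \<in> {..<N} \<rightarrow> carrier (hecke ell q Q (Suc m))"
        using car by (intro Pi_I) (metis fun_upd_other lessThan_iff less_Suc_eq less_irrefl)
    qed auto
    also have "?t ?a ?b N = hcoset ell q Q (Suc m) (a' * gen m * b')"
      using free_TT_add.hyps by (simp add: hemb_hcoset hcoset_mult_gen)
    also have "hcoset ell q Q (Suc m) (a' * gen m * b') \<oplus>\<^bsub>hecke ell q Q (Suc m)\<^esub> (\<Oplus>\<^bsub>hecke ell q Q (Suc m)\<^esub>i\<in>{..<N}. ?t a b i) = hcoset ell q Q (Suc m) (x + a' * gen m * b')"
      using free_TT_add.hyps ab(3)[symmetric]
      by (simp add: hcoset_add free_TT_carrier free_carrier_Suc_mult_gen add.commute[of x])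
    finally have "hcoset ell q Q (Suc m) (x + a' * gen m * b') = (\<Oplus>\<^bsub>hecke ell q Q (Suc m)\<^esub>i\<in>{..<Suc N}. ?t ?a ?b i)" ..
    moreover have "?a \<in> {..<Suc N} \<rightarrow> carrier (hecke ell q Q m)" "?b \<in> {..<Suc N} \<rightarrow> carrier (hecke ell q Q m)"
      using ab(1,2) free_TT_add.hyps by (auto simp: Pi_iff less_Suc_eq)
    ultimately show ?case by blast
  qed
  then show ?thesis using False unfolding HTH_def by auto
qed

lemma HTH_elim:
  assumes "h \<in> HTH ell q Q (Suc m)"
  obtains x where "x \<in> free_TT m" "h = hcoset ell q Q (Suc m) x"
proof (cases "m = 0")
  case True
  then show ?thesis
    using assms by (intro that[of 0]) (auto simp: HTH_def hcoset_zero free_TT_zero)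
next
  case False
  then obtain N :: nat and a b where ab: "a \<in> {..<N} \<rightarrow> carrier (hecke ell q Q m)" "b \<in> {..<N} \<rightarrow> carrier (hecke ell q Q m)"
    "h = (\<Oplus>\<^bsub>hecke ell q Q (Suc m)\<^esub>i\<in>{..<N}. hemb ell q Q (Suc m) (a i) \<otimes>\<^bsub>hecke ell q Q (Suc m)\<^esub> hT ell q Q (Suc m) m
        \<otimes>\<^bsub>hecke ell q Q (Suc m)\<^esub> hemb ell q Q (Suc m) (b i))"
    using assms unfolding HTH_def by auto
  interpret R: ring "hecke ell q Q (Suc m)" by (rule hecke_ring)
  have "\<forall>i\<in>{..<N}. \<exists>x\<in>free_carrier m. a i = hcoset ell q Q m x" "\<forall>i\<in>{..<N}. \<exists>x\<in>free_carrier m. b i = hcoset ell q Q m x"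
    using ab(1,2) by (auto simp: carrier_hecke Pi_iff image_iff)
  then obtain a' b' where
    a': "\<And>i. i < N \<Longrightarrow> a' i \<in> free_carrier m \<and> a i = hcoset ell q Q m (a' i)" and
    b': "\<And>i. i < N \<Longrightarrow> b' i \<in> free_carrier m \<and> b i = hcoset ell q Q m (b' i)"
    by (metis lessThan_iff)
  have c: "a' i * gen m * b' i \<in> free_carrier (Suc m)" if "i < N" for i
    using a'[OF that] b'[OF that] by (auto intro: free_carrier_Suc_mult_gen)
  have "h = (\<Oplus>\<^bsub>hecke ell q Q (Suc m)\<^esub>i\<in>{..<N}. hcoset ell q Q (Suc m) (a' i * gen m * b' i))"
    unfolding ab(3)
  proof (rule R.finsum_cong'[OF refl])
    show "(\<lambda>i. hcoset ell q Q (Suc m) (a' i * gen m * b' i)) \<in> {..<N} \<rightarrow> carrier (hecke ell q Q (Suc m))"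
      using c by auto
    fix i assume "i \<in> {..<N}"
    then have "a' i \<in> free_carrier m" "b' i \<in> free_carrier m" "a i = hcoset ell q Q m (a' i)" "b i = hcoset ell q Q m (b' i)"
      using a' b' by auto
    then show "hemb ell q Q (Suc m) (a i) \<otimes>\<^bsub>hecke ell q Q (Suc m)\<^esub> hT ell q Q (Suc m) m
        \<otimes>\<^bsub>hecke ell q Q (Suc m)\<^esub> hemb ell q Q (Suc m) (b i) = hcoset ell q Q (Suc m) (a' i * gen m * b' i)"
      by (simp add: hemb_hcoset hcoset_mult_gen)
  qed
  also have "\<dots> = hcoset ell q Q (Suc m) (\<Sum>i<N. a' i * gen m * b' i)"
    using c by (subst hcoset_sum) auto
  finally have h: "h = hcoset ell q Q (Suc m) (\<Sum>i<N. a' i * gen m * b' i)" .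
  have "(\<Sum>i<M. a' i * gen m * b' i) \<in> free_TT m" if "M \<le> N" for M
    using that
  proof (induction M)
    case 0
    then show ?case by (simp add: free_TT_zero)
  next
    case (Suc M)
    then show ?case using a'[of M] b'[of M] False by (auto intro: free_TT_add)
  qed
  then show ?thesis using h that by blast
qed

lemma desc_sum_hcoset:
  assumes "\<And>j. j < ell \<Longrightarrow> P j \<in> free_carrier m" "\<And>j. j < ell \<Longrightarrow> p j = hcoset ell q Q m (P j)"
  shows "(\<Oplus>\<^bsub>hecke ell q Q (Suc m)\<^esub>j\<in>{..<ell}. hemb ell q Q (Suc m) (p j) \<otimes>\<^bsub>hecke ell q Q (Suc m)\<^esub> hL ell q Q (Suc m) (Suc m) [^]\<^bsub>hecke ell q Q (Suc m)\<^esub> j)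
    = hcoset ell q Q (Suc m) (\<Sum>j<ell. P j * free_L qi (Suc m) ^ j)"
proof -
  interpret R: ring "hecke ell q Q (Suc m)" by (rule hecke_ring)
  have L: "free_L qi (Suc m) \<in> free_carrier (Suc m)" by (rule free_L_carrier) simp
  have P: "P j \<in> free_carrier (Suc m)" if "j < ell" for j
    using assms(1)[OF that] by (rule free_carrier_mono) simp
  have "(\<Oplus>\<^bsub>hecke ell q Q (Suc m)\<^esub>j\<in>{..<ell}. hemb ell q Q (Suc m) (p j) \<otimes>\<^bsub>hecke ell q Q (Suc m)\<^esub> hL ell q Q (Suc m) (Suc m) [^]\<^bsub>hecke ell q Q (Suc m)\<^esub> j)
    = (\<Oplus>\<^bsub>hecke ell q Q (Suc m)\<^esub>j\<in>{..<ell}. hcoset ell q Q (Suc m) (P j * free_L qi (Suc m) ^ j))"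
    using assms L P
    by (intro R.finsum_cong') (auto simp: hemb_hcoset hcoset_mult hcoset_pow hL_eq[OF order_refl]
        power_free_carrier intro!: R.m_closed hcoset_carrier simp del: hL.simps)
  then show ?thesis
    using L P by (subst hcoset_sum) (auto intro!: free_carrier_mult power_free_carrier)
qed

text \<open>The right-hand side does not mention \<open>p\<close>, so this is uniqueness. A
  decomposition is lifted to polynomials and applied to the unit vector: in row \<open>m + 1\<close>
  the bimodule part vanishes, while the coefficient of \<open>L ^ j\<close> appears at exponent
  \<open>j\<close>.\<close>

lemma desc_coeffs_coord:
  assumes x: "x \<in> free_carrier (Suc m)" and p: "is_desc_coeffs ell q Q (Suc m) (hcoset ell q Q (Suc m) x) p"
    and j: "j < ell"
  shows "p j = hproj (free_action.act (\<lambda>c. hecke_gens.msc (hS c))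
      (hecke_gens.rop hS (hfT m ell q Q) q qi Q ell) x (hecke_gens.e0 m) (Suc m) j) (m, ell, q, Q)"
proof -
  \<comment> \<open>The coefficients come from level \<open>m\<close>, although \<open>x\<close>
    represents an element of level \<open>m + 1\<close>.\<close>
  interpret A: hecke_gens hS "hfT m ell q Q" q qi Q ell m
    by (rule hecke_gens_hfam[OF q_qi ell])
  obtain h' where p': "p \<in> {..<ell} \<rightarrow>\<^sub>E carrier (hecke ell q Q m)" "h' \<in> HTH ell q Q (Suc m)"
    and x': "hcoset ell q Q (Suc m) x = h' \<oplus>\<^bsub>hecke ell q Q (Suc m)\<^esub> (\<Oplus>\<^bsub>hecke ell q Q (Suc m)\<^esub>j\<in>{..<ell}. hemb ell q Q (Suc m) (p j)
        \<otimes>\<^bsub>hecke ell q Q (Suc m)\<^esub> hL ell q Q (Suc m) (Suc m) [^]\<^bsub>hecke ell q Q (Suc m)\<^esub> j)"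
    using p unfolding is_desc_coeffs_def by auto
  obtain y where y: "y \<in> free_TT m" "h' = hcoset ell q Q (Suc m) y" using p'(2) by (rule HTH_elim)
  have "\<forall>j\<in>{..<ell}. \<exists>x\<in>free_carrier m. p j = hcoset ell q Q m x"
    using p'(1) by (auto simp: carrier_hecke PiE_iff image_iff)
  then obtain P where P: "\<And>j. j < ell \<Longrightarrow> P j \<in> free_carrier m \<and> p j = hcoset ell q Q m (P j)"
    by (metis lessThan_iff)
  let ?s = "\<Sum>j<ell. P j * free_L qi (Suc m) ^ j"
  have s: "?s \<in> free_carrier (Suc m)"
    using P by (intro free_carrier_sum free_carrier_mult power_free_carrier free_L_carrier)
      (auto intro: free_carrier_SucI)
  have "hcoset ell q Q (Suc m) x = hcoset ell q Q (Suc m) (y + ?s)"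
    using P x' y(2) s desc_sum_hcoset[of P m p] free_TT_carrier[OF y(1)] by (simp add: hcoset_add)
  then have "x - (y + ?s) \<in> hecke_ideal ell q Q (Suc m)"
    using hcoset_eq_iff[of x "Suc m" "y + ?s"] x free_carrier_add[OF free_TT_carrier[OF y(1)] s] by blast
  from A.act_hecke_ideal[OF this A.rmod_e0]
  have "A.mod.act x A.e0 (Suc m) j = A.mod.act y A.e0 (Suc m) j + A.mod.act ?s A.e0 (Suc m) j"
    by (simp add: A.mod.act_diff_left A.mod.act_add_left)
  also have "A.mod.act y A.e0 (Suc m) = 0"
    using y(1) by (induction rule: free_TT.induct) (auto simp: A.mod.act_add_left A.act_e0_T)
  also have "A.mod.act ?s A.e0 (Suc m) j = A.ev (P j)"
  proof -
    have "A.mod.act ?s A.e0 = (\<Sum>i<ell. A.erow (Suc m) (\<lambda>j. if j = i then A.ev (P i) else 0))"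
      using P by (simp add: A.mod.act_sum_left A.act_e0_L_power)
    moreover have "(\<Sum>i\<in>I. A.erow (Suc m) (f i)) (Suc m) j = (\<Sum>i\<in>I. f i j)" for I :: "nat set" and f
      by (induction I rule: infinite_finite_induct) (auto simp: A.erow_def)
    ultimately show ?thesis using j by simp
  qed
  finally show ?thesis
    using P[OF j] hproj_ev[of "P j" m] by simp
qed

lemma descend_eqI:
  assumes "x \<in> free_carrier (Suc m)" "is_desc_coeffs ell q Q (Suc m) (hcoset ell q Q (Suc m) x) p"
  shows "descend ell q Q (Suc m) (hcoset ell q Q (Suc m) x) = p 0"
proof -
  have "p' = p" if "is_desc_coeffs ell q Q (Suc m) (hcoset ell q Q (Suc m) x) p'" for p'
  proof (rule PiE_ext)
    show "p' \<in> {..<ell} \<rightarrow>\<^sub>E carrier (hecke ell q Q m)" "p \<in> {..<ell} \<rightarrow>\<^sub>E carrier (hecke ell q Q m)"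
      using that assms(2) by (auto simp: is_desc_coeffs_def)
    show "p' j = p j" if "j \<in> {..<ell}" for j
      using desc_coeffs_coord[OF assms(1) assms(2)] desc_coeffs_coord[OF assms(1)] that
        \<open>is_desc_coeffs ell q Q (Suc m) (hcoset ell q Q (Suc m) x) p'\<close> by auto
  qed
  then have "desc_coeffs ell q Q (Suc m) (hcoset ell q Q (Suc m) x) = p"
    unfolding desc_coeffs_def using assms(2) by (intro the_equality)
  then show ?thesis by (simp add: descend_def)
qed

text \<open>The exponents in \<open>AP\<close> are positive, hence \<open>P 0 = 0\<close>, and at
  most \<open>d < ell\<close>, hence all of them are indices of the sum in
  \<open>is_desc_coeffs\<close>.\<close>

lemma AP_ev:
  assumes "z \<in> hecke_gens.AP hS (hfT n ell q Q) qi m d" "n = Suc m" "d < ell"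
  shows "\<exists>u P. u \<in> free_TT m \<and> (\<forall>j. P j \<in> free_carrier m) \<and> P 0 = 0 \<and>
    z = hecke_gens.ev hS (hfT n ell q Q) (u + (\<Sum>j<ell. P j * free_L qi (Suc m) ^ j))"
proof -
  interpret hecke_gens hS "hfT n ell q Q" q qi Q ell n
    by (rule hecke_gens_hfam[OF q_qi ell])
  show ?thesis using assms(1)
  proof (induction rule: AP.induct)
    case AP_zero
    show ?case
      by (rule exI[of _ 0], rule exI[of _ "\<lambda>_. 0"]) (simp add: free_TT_zero)
  next
    case (AP_T x a b)
    then obtain u P a' b' where "u \<in> free_TT m" "\<forall>j. P j \<in> free_carrier m" "P 0 = 0"
      "x = ev (u + (\<Sum>j<ell. P j * free_L qi (Suc m) ^ j))"
      "a = ev a'" "a' \<in> free_carrier m" "b = ev b'" "b' \<in> free_carrier m"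
      by (auto simp: sub_iff_ev)
    then show ?case
      using AP_T by (intro exI[of _ "u + a' * gen m * b'"] exI[of _ P]) (auto simp: ev_add ev_mult intro: free_TT_add)
  next
    case (AP_L x i a)
    then obtain u P a' where P: "u \<in> free_TT m" "\<forall>j. P j \<in> free_carrier m" "P 0 = 0"
      "x = ev (u + (\<Sum>j<ell. P j * free_L qi (Suc m) ^ j))"
      "a = ev a'" "a' \<in> free_carrier m"
      by (auto simp: sub_iff_ev)
    let ?P = "P(i := P i + a')"
    have i: "i < ell" using AP_L assms by simp
    have "(\<Sum>j<ell. ?P j * free_L qi (Suc m) ^ j) =
        (\<Sum>j<ell. P j * free_L qi (Suc m) ^ j + (if j = i then a' * free_L qi (Suc m) ^ i else 0))"
      by (rule sum.cong) (auto simp: distrib_right)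
    also have "\<dots> = (\<Sum>j<ell. P j * free_L qi (Suc m) ^ j) + a' * free_L qi (Suc m) ^ i"
      using i by (simp add: sum.distrib)
    finally have "x + a * L (Suc m) ^ i = ev (u + (\<Sum>j<ell. ?P j * free_L qi (Suc m) ^ j))"
      using P by (simp add: ev_add ev_mult ev_power ev_free_L)
    moreover have "\<forall>j. ?P j \<in> free_carrier m" "?P 0 = 0"
      using P AP_L by auto
    ultimately show ?case using P(1) by blast
  qed
qed

text \<open>With this, a computation modulo \<open>AP\<close> of degree below \<open>ell\<close>
  determines the descending map; the definite descriptions behind \<open>descend\<close> do not
  reappear.\<close>

lemma descend_desc:
  assumes "hecke_gens.desc hS (hfT n ell q Q) qi m d (hecke_gens.ev hS (hfT n ell q Q) x) (hecke_gens.ev hS (hfT n ell q Q) y)"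
    and n: "n = Suc m" and d: "d < ell" and x: "x \<in> free_carrier n" and y: "y \<in> free_carrier m"
  shows "descend ell q Q n (hcoset ell q Q n x) = hcoset ell q Q m y"
proof -
  interpret hecke_gens hS "hfT n ell q Q" q qi Q ell n
    by (rule hecke_gens_hfam[OF q_qi ell])
  let ?s = "\<lambda>P. \<Sum>j<ell. P j * free_L qi (Suc m) ^ j"
  obtain u P where P: "u \<in> free_TT m" "\<forall>j. P j \<in> free_carrier m" "P 0 = 0" "ev x - ev y = ev (u + ?s P)"
    using assms(1) AP_ev[OF _ n d, of "ev x - ev y"] unfolding desc_def by auto
  \<comment> \<open>The kernel part has coefficient 0 at exponent 0, and this place is taken by
    \<open>y\<close>.\<close>
  let ?P = "P(0 := y)"
  have "?s ?P = (\<Sum>j<ell. P j * free_L qi (Suc m) ^ j + (if j = 0 then y else 0))"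
    by (rule sum.cong) (auto simp: P(3))
  also have "\<dots> = ?s P + y"
    using ell by (simp add: sum.distrib)
  finally have s: "?s ?P = ?s P + y" .
  have c: "?s ?P \<in> free_carrier n"
    using P(2) y n by (intro free_carrier_sum free_carrier_mult power_free_carrier free_L_carrier)
      (auto intro: free_carrier_SucI)
  have u: "u \<in> free_carrier n" using P(1) free_TT_carrier n by auto
  have "ev x = ev (u + ?s ?P)"
    using P(4) unfolding s by (simp add: ev_add algebra_simps)
  then have eq: "hcoset ell q Q n x = hcoset ell q Q n (u + ?s ?P)"
    using hproj_ev[OF x] hproj_ev[of "u + ?s ?P" n] c u by (metis free_carrier_add)
  let ?p = "\<lambda>j\<in>{..<ell}. hcoset ell q Q m (?P j)"
  have "is_desc_coeffs ell q Q (Suc m) (hcoset ell q Q (Suc m) x) ?p"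
    unfolding is_desc_coeffs_def
  proof (intro conjI bexI)
    show "?p \<in> {..<ell} \<rightarrow>\<^sub>E carrier (hecke ell q Q (Suc m - 1))"
      using P(2) y by auto
    show "hcoset ell q Q (Suc m) u \<in> HTH ell q Q (Suc m)"
      using P(1) by (rule HTH_hcoset)
    show "hcoset ell q Q (Suc m) x = hcoset ell q Q (Suc m) u \<oplus>\<^bsub>hecke ell q Q (Suc m)\<^esub> (\<Oplus>\<^bsub>hecke ell q Q (Suc m)\<^esub>j\<in>{..<ell}. hemb ell q Q (Suc m) (?p j)
        \<otimes>\<^bsub>hecke ell q Q (Suc m)\<^esub> hL ell q Q (Suc m) (Suc m) [^]\<^bsub>hecke ell q Q (Suc m)\<^esub> j)"
      using P(2) y eq c u n by (subst desc_sum_hcoset[of ?P]) (auto simp: hcoset_add)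
  qed
  then have "descend ell q Q (Suc m) (hcoset ell q Q (Suc m) x) = ?p 0"
    using x n descend_eqI[of x m ?p] by simp
  then show ?thesis using ell n by simp
qed

end

subsection \<open>Reduced expressions\<close>

text \<open>\<open>dcyc a N\<close> is the permutation of the word \<open>[a..<N]\<close> for the
  right action, see \<open>perm_of_upt\<close>; \<open>ucyc a N\<close> is its inverse.\<close>

definition ucyc :: "nat \<Rightarrow> nat \<Rightarrow> nat \<Rightarrow> nat" where
  "ucyc a N m = (if m = N then a else if a \<le> m \<and> m < N then Suc m else m)"

definition dcyc :: "nat \<Rightarrow> nat \<Rightarrow> nat \<Rightarrow> nat" where
  "dcyc a N m = (if m = a then N else if a < m \<and> m \<le> N then m - 1 else m)"

text \<open>The expression \<open>\<sigma>\<^sub>a \<dots> \<sigma>\<^sub>n w'\<close> where \<open>w\<close> moves \<open>a\<close> to \<open>n + 1\<close> and \<open>w'\<close> fixes \<open>n + 1\<close>.\<close>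

fun nform :: "nat \<Rightarrow> (nat \<Rightarrow> nat) \<Rightarrow> nat list" where
  "nform 0 w = []"
| "nform (Suc n) w = [inv_into UNIV w (Suc n)..<Suc n] @ nform n (w \<circ> ucyc (inv_into UNIV w (Suc n)) (Suc n))"

lemma ucyc_dcyc: "a \<le> N \<Longrightarrow> ucyc a N (dcyc a N m) = m"
  by (auto simp: ucyc_def dcyc_def)

lemma dcyc_ucyc: "a \<le> N \<Longrightarrow> dcyc a N (ucyc a N m) = m"
  by (auto simp: ucyc_def dcyc_def)

lemma ucyc_permutes: "1 \<le> a \<Longrightarrow> a \<le> N \<Longrightarrow> ucyc a N permutes {1..N}"
  by (rule bij_imp_permutes[OF bij_betw_byWitness[of _ "dcyc a N"]])
     (auto simp: ucyc_dcyc dcyc_ucyc, auto simp: ucyc_def dcyc_def)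

lemma dcyc_permutes: "1 \<le> a \<Longrightarrow> a \<le> N \<Longrightarrow> dcyc a N permutes {1..N}"
  by (rule bij_imp_permutes[OF bij_betw_byWitness[of _ "ucyc a N"]])
     (auto simp: ucyc_dcyc dcyc_ucyc, auto simp: ucyc_def dcyc_def)

lemma permutes_fixed_last:
  assumes "w permutes {1..Suc n}" "w (Suc n) = Suc n" shows "w permutes {1..n}"
proof (rule permutes_superset[OF assms(1)])
  fix x assume "x \<in> {1..Suc n} - {1..n}"
  then have "x = Suc n" by auto
  then show "w x = x" using assms(2) by simp
qed

lemma inv_last:
  assumes "w permutes {1..Suc n}"
  shows "inv_into UNIV w (Suc n) \<in> {1..Suc n}" "w (inv_into UNIV w (Suc n)) = Suc n"
  using permutes_in_image[OF permutes_inv[OF assms], of "Suc n"] permutes_inverses(1)[OF assms]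
  by auto

lemma nform_tail_permutes:
  assumes "w permutes {1..Suc n}"
  shows "w \<circ> ucyc (inv_into UNIV w (Suc n)) (Suc n) permutes {1..n}"
proof (rule permutes_fixed_last)
  show "w \<circ> ucyc (inv_into UNIV w (Suc n)) (Suc n) permutes {1..Suc n}"
    using inv_last[OF assms] by (intro permutes_compose[OF ucyc_permutes assms]) auto
  show "(w \<circ> ucyc (inv_into UNIV w (Suc n)) (Suc n)) (Suc n) = Suc n"
    using inv_last[OF assms] by (simp add: ucyc_def)
qed

lemma perm_of_append: "perm_of (xs @ ys) = perm_of ys \<circ> perm_of xs"
proof -
  have "foldl (\<lambda>w i. transpose i (Suc i) \<circ> w) v ys = perm_of ys \<circ> v" for v
    by (induction ys arbitrary: v rule: rev_induct) (simp_all add: perm_of_def comp_assoc)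
  then show ?thesis by (simp add: perm_of_def)
qed

lemma perm_of_Nil: "perm_of [] = id"
  by (simp add: perm_of_def)

lemma perm_of_single: "perm_of [i] = transpose i (Suc i)"
  by (simp add: perm_of_def)

lemma perm_of_Cons: "perm_of (i # is) = perm_of is \<circ> transpose i (Suc i)"
  using perm_of_append[of "[i]" "is"] by (simp add: perm_of_single)

lemma perm_of_upt: "a \<le> N \<Longrightarrow> perm_of [a..<N] = dcyc a N"
proof (induction N rule: dec_induct)
  case base
  then show ?case by (auto simp: perm_of_Nil dcyc_def)
next
  case (step N)
  then show ?case
    by (auto simp: perm_of_append perm_of_single fun_eq_iff dcyc_def transpose_def)
qed

lemma perm_of_nform: "w permutes {1..n} \<Longrightarrow> perm_of (nform n w) = w"
proof (induction n arbitrary: w)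
  case 0
  then show ?case by (simp add: perm_of_Nil)
next
  case (Suc n)
  let ?a = "inv_into UNIV w (Suc n)"
  have "?a \<le> Suc n" using inv_last(1)[OF Suc.prems] by simp
  then have "perm_of [?a..<Suc n] = dcyc ?a (Suc n)" by (rule perm_of_upt)
  then have "perm_of (nform (Suc n) w) = w \<circ> ucyc ?a (Suc n) \<circ> dcyc ?a (Suc n)"
    using Suc.IH[OF nform_tail_permutes[OF Suc.prems]] by (simp only: nform.simps perm_of_append)
  also have "\<dots> = w"
    using ucyc_dcyc[OF \<open>?a \<le> Suc n\<close>] by (simp add: fun_eq_iff)
  finally show ?case .
qed

lemma set_nform: "w permutes {1..n} \<Longrightarrow> set (nform n w) \<subseteq> {1..<n}"
proof (induction n arbitrary: w)
  case (Suc n)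
  have "set [inv_into UNIV w (Suc n)..<Suc n] \<subseteq> {1..<Suc n}"
    using inv_last(1)[OF Suc.prems] by auto
  moreover have "{1..<n} \<subseteq> {1..<Suc n}" by auto
  ultimately show ?case
    using Suc.IH[OF nform_tail_permutes[OF Suc.prems]]
    unfolding nform.simps set_append by blast
qed simp

lemma expression_nform: "w permutes {1..n} \<Longrightarrow> expression n w (nform n w)"
  unfolding expression_def using set_nform perm_of_nform by blast

lemma perm_of_permutes: "set is \<subseteq> {1..<n} \<Longrightarrow> perm_of is permutes {1..n}"
  by (induction "is") (auto simp: perm_of_Nil perm_of_Cons permutes_id intro!: permutes_compose permutes_swap_id)

lemma nform_dcyc:
  assumes "w permutes {1..n}" "1 \<le> a" "a \<le> Suc n"
  shows "nform (Suc n) (w \<circ> dcyc a (Suc n)) = [a..<Suc n] @ nform n w"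
proof -
  have w: "w permutes {1..Suc n}"
    using assms(1) by (rule permutes_subset) auto
  then have p: "w \<circ> dcyc a (Suc n) permutes {1..Suc n}"
    using assms by (intro permutes_compose[OF dcyc_permutes]) auto
  have "w (Suc n) = Suc n"
    using assms(1) by (rule permutes_not_in) auto
  then have "(w \<circ> dcyc a (Suc n)) a = Suc n" by (simp add: dcyc_def)
  then have "inv_into UNIV (w \<circ> dcyc a (Suc n)) (Suc n) = a"
    using permutes_inverses(2)[OF p, of a] by simp
  moreover have "w \<circ> dcyc a (Suc n) \<circ> ucyc a (Suc n) = w"
    using dcyc_ucyc[OF assms(3)] by (simp add: fun_eq_iff)
  ultimately show ?thesis by simp
qed

text \<open>Comparing reduced words takes only the commutation and braid relations. Stated for
  monoids, it yields statements on products and, by a trivial instance, on lengths.\<close>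

locale braid_gens =
  fixes T :: "nat \<Rightarrow> 'b::monoid_mult" and n :: nat
  assumes comm: "1 \<le> i \<Longrightarrow> i + 1 < j \<Longrightarrow> j < n \<Longrightarrow> T i * T j = T j * T i"
    and braid: "1 \<le> i \<Longrightarrow> i + 1 < n \<Longrightarrow> T i * T (i + 1) * T i = T (i + 1) * T i * T (i + 1)"
begin

abbreviation Tprod :: "nat list \<Rightarrow> 'b" where "Tprod is \<equiv> prod_list (map T is)"

lemma T_Tprod_commute:
  assumes "1 \<le> i" "i < n" "\<And>j. j \<in> set js \<Longrightarrow> 1 \<le> j \<and> j < n \<and> (i + 1 < j \<or> j + 1 < i)"
  shows "T i * Tprod js = Tprod js * T i"
  using assms(3)
proof (induction js)
  case (Cons j js)
  then have "1 \<le> j \<and> j < n \<and> (i + 1 < j \<or> j + 1 < i)" by simp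
  then have c: "T i * T j = T j * T i"
    using assms(1,2) comm[of i j] comm[of j i] by (elim conjE disjE) simp_all
  then show ?case using Cons by (simp add: mult.assoc commute_left[OF c])
qed simp

text \<open>The word is cut around the letters \<open>i - 1, i\<close>: \<open>T i\<close> commutes
  with the first part, the braid relation turns it into \<open>T (i - 1)\<close>, and this commutes
  with the last part.\<close>

lemma T_shift:
  assumes "1 \<le> a" "a < i" "i < N" "N \<le> n"
  shows "T i * Tprod [a..<N] = Tprod [a..<N] * T (i - 1)"
proof -
  let ?A = "Tprod [a..<i - 1]" and ?B = "Tprod [Suc i..<N]" and ?s = "T (i - 1)" and ?t = "T i"
  have "[a..<N] = [a..<i - 1] @ [i - 1..<Suc i] @ [Suc i..<N]"
    using assms upt_add_eq_append[of a "i - 1" "N - (i - 1)"] upt_add_eq_append[of "i - 1" "Suc i" "N - Suc i"] by simp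
  also have "[i - 1..<Suc i] = [i - 1, i]"
    using assms by (simp add: upt_rec)
  finally have e: "Tprod [a..<N] = ?A * (?s * (?t * ?B))" by simp
  have A: "?t * ?A = ?A * ?t" using assms by (intro T_Tprod_commute) auto
  have B: "?s * ?B = ?B * ?s" using assms by (intro T_Tprod_commute) auto
  have br: "?t * ?s * ?t = ?s * ?t * ?s" using braid[of "i - 1"] assms by simp
  have "?t * Tprod [a..<N] = ?A * (?t * (?s * (?t * ?B)))"
    unfolding e using commute_left[OF A] by simp
  also have "\<dots> = ?A * (?s * (?t * (?s * ?B)))"
    using braid_left[OF br] by simp
  also have "\<dots> = Tprod [a..<N] * ?s"
    unfolding e B by (simp add: mult.assoc)
  finally show ?thesis .
qed

lemma T_shift_rev:
  assumes "1 \<le> a" "a < i" "i < N" "N \<le> n"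
  shows "Tprod (rev [a..<N]) * T i = T (i - 1) * Tprod (rev [a..<N])"
proof -
  let ?A = "Tprod (rev [a..<i - 1])" and ?B = "Tprod (rev [Suc i..<N])" and ?s = "T (i - 1)" and ?t = "T i"
  have "[a..<N] = [a..<i - 1] @ [i - 1..<Suc i] @ [Suc i..<N]"
    using assms upt_add_eq_append[of a "i - 1" "N - (i - 1)"] upt_add_eq_append[of "i - 1" "Suc i" "N - Suc i"] by simp
  also have "[i - 1..<Suc i] = [i - 1, i]"
    using assms by (simp add: upt_rec)
  finally have e: "Tprod (rev [a..<N]) = ?B * (?t * (?s * ?A))" by (simp add: mult.assoc)
  have A: "?t * ?A = ?A * ?t" using assms by (intro T_Tprod_commute) auto
  have B: "?s * ?B = ?B * ?s" using assms by (intro T_Tprod_commute) auto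
  have br: "?t * ?s * ?t = ?s * ?t * ?s" using braid[of "i - 1"] assms by simp
  have "Tprod (rev [a..<N]) * ?t = ?B * (?t * (?s * (?t * ?A)))"
    unfolding e A by (simp add: mult.assoc)
  also have "\<dots> = ?B * (?s * (?t * (?s * ?A)))"
    using braid_left[OF br] by simp
  also have "\<dots> = ?s * Tprod (rev [a..<N])"
    unfolding e using commute_left[OF B] by simp
  finally show ?thesis .
qed

text \<open>Let \<open>[a..<M]\<close> be the first block of the normal form. If
  \<open>Suc i < a\<close>, the new letter commutes with the block and passes to the tail; if
  \<open>Suc i = a\<close>, it lengthens the block; if \<open>a < i\<close>, it passes to the tail
  as \<open>i - 1\<close> by \<open>T_shift\<close>.\<close>

lemma nform_transpose:
  assumes "w permutes {1..N}" "N \<le> n" "1 \<le> i" "i < N" "w i < w (Suc i)"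
  shows "Tprod (nform N (w \<circ> transpose i (Suc i))) = T i * Tprod (nform N w) \<and>
    length (nform N (w \<circ> transpose i (Suc i))) = Suc (length (nform N w))"
  using assms
proof (induction N arbitrary: w i)
  case (Suc N)
  let ?M = "Suc N" and ?a = "inv_into UNIV w (Suc N)" and ?u = "w \<circ> transpose i (Suc i)"
  let ?w = "w \<circ> ucyc ?a ?M"
  note a = inv_last[OF Suc.prems(1)]
  have w': "?w permutes {1..N}" by (rule nform_tail_permutes[OF Suc.prems(1)])
  have u: "?u permutes {1..?M}"
    using Suc.prems by (intro permutes_compose[OF permutes_swap_id]) auto
  have inv_u: "inv_into UNIV ?u ?M = b" if "?u b = ?M" for b
    using permutes_inverses(2)[OF u, of b] that by simp
  have "w (Suc i) \<le> ?M" using permutes_in_image[OF Suc.prems(1), of "Suc i"] Suc.prems by auto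
  \<comment> \<open>\<open>w\<close> takes its largest value \<open>Suc N\<close> at
    \<open>?a\<close>, so \<open>?a\<close> cannot be the position of an ascent.\<close>
  then have "i \<noteq> ?a" using a Suc.prems(5) by (metis not_less)
  then consider "Suc i < ?a" | "Suc i = ?a" | "?a < i" by linarith
  then show ?case
  proof cases
    case 1
    then have iu: "inv_into UNIV ?u ?M = ?a" using a by (intro inv_u) (auto simp: transpose_def)
    have c: "?u \<circ> ucyc ?a ?M = ?w \<circ> transpose i (Suc i)"
      using 1 a by (auto simp: fun_eq_iff ucyc_def transpose_def)
    have "Tprod (nform N (?w \<circ> transpose i (Suc i))) = T i * Tprod (nform N ?w) \<and>
        length (nform N (?w \<circ> transpose i (Suc i))) = Suc (length (nform N ?w))"
      using 1 a Suc.prems by (intro Suc.IH w') (auto simp: ucyc_def)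
    moreover have "T i * Tprod [?a..<?M] = Tprod [?a..<?M] * T i"
      using 1 Suc.prems a by (intro T_Tprod_commute) auto
    ultimately show ?thesis
      unfolding nform.simps iu c by (simp add: mult.assoc commute_left del: upt_Suc)
  next
    case 2
    then have iu: "inv_into UNIV ?u ?M = i" using a by (intro inv_u) auto
    have c: "?u \<circ> ucyc i ?M = ?w"
      unfolding 2[symmetric] using a Suc.prems
      by (auto simp: fun_eq_iff ucyc_def transpose_def not_less_eq_eq dest: le_antisym)
    have "[i..<?M] = i # [?a..<?M]"
      using 2 Suc.prems by (simp add: upt_conv_Cons del: upt_Suc)
    then show ?thesis
      unfolding nform.simps iu c by (simp add: mult.assoc del: upt_Suc)
  next
    case 3
    then have iu: "inv_into UNIV ?u ?M = ?a" using a by (intro inv_u) (auto simp: transpose_def)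
    have i: "Suc (i - 1) = i" using 3 by simp
    have c: "?u \<circ> ucyc ?a ?M = ?w \<circ> transpose (i - 1) (Suc (i - 1))"
      using 3 a Suc.prems by (auto simp: fun_eq_iff ucyc_def transpose_def)
    have "Tprod (nform N (?w \<circ> transpose (i - 1) (Suc (i - 1)))) = T (i - 1) * Tprod (nform N ?w) \<and>
        length (nform N (?w \<circ> transpose (i - 1) (Suc (i - 1)))) = Suc (length (nform N ?w))"
      using 3 a Suc.prems by (intro Suc.IH w') (auto simp: ucyc_def)
    moreover have "T i * Tprod [?a..<?M] = Tprod [?a..<?M] * T (i - 1)"
      using 3 Suc.prems a by (intro T_shift) auto
    ultimately show ?thesis
      unfolding nform.simps iu c by (simp add: mult.assoc[symmetric] del: upt_Suc)
  qed
qed simp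

end

lemma length_nform_transpose:
  assumes "w permutes {1..n}" "1 \<le> i" "i < n" "w i < w (Suc i)"
  shows "length (nform n (w \<circ> transpose i (Suc i))) = Suc (length (nform n w))"
proof -
  \<comment> \<open>With all generators equal to 1 the relations are trivial, and only the statement
    on lengths remains.\<close>
  interpret braid_gens "\<lambda>_. 1 :: nat" n by standard auto
  show ?thesis using nform_transpose[OF assms(1) order_refl assms(2-4)] by simp
qed

lemma length_nform_transpose_less:
  assumes "w permutes {1..n}" "1 \<le> i" "i < n" "w (Suc i) < w i"
  shows "length (nform n w) = Suc (length (nform n (w \<circ> transpose i (Suc i))))"
proof -
  have "w \<circ> transpose i (Suc i) permutes {1..n}"
    using assms by (intro permutes_compose[OF permutes_swap_id]) auto
  from length_nform_transpose[OF this assms(2,3)] assms(4)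
  show ?thesis by (simp add: comp_assoc)
qed

text \<open>Each letter of an expression changes the length of the normal form by one, upwards or
  downwards; so normal forms are reduced.\<close>

lemma length_nform_le:
  assumes "expression n w is" shows "length (nform n w) \<le> length is"
  using assms
proof (induction "is" arbitrary: w)
  case Nil
  then have w: "w = id" by (simp add: expression_def perm_of_Nil)
  have "nform n id = []"
  proof (induction n)
    case (Suc n)
    have "inv_into UNIV id (Suc n) = Suc n" by (simp add: inv_id)
    moreover have "id \<circ> ucyc (Suc n) (Suc n) = id" by (auto simp: ucyc_def)
    ultimately show ?case using Suc by (simp only: nform.simps) simp
  qed simp
  then show ?case unfolding w by (simp only: list.size)
next
  case (Cons i "is")
  let ?u = "perm_of is"
  have e: "expression n ?u is" "w = ?u \<circ> transpose i (Suc i)" "1 \<le> i" "i < n"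
    using Cons.prems by (auto simp: expression_def perm_of_Cons)
  have u: "?u permutes {1..n}" using e(1) by (intro perm_of_permutes) (simp add: expression_def)
  have "?u i \<noteq> ?u (Suc i)" using permutes_inj[OF u] by (metis injD n_not_Suc_n)
  then consider "?u i < ?u (Suc i)" | "?u (Suc i) < ?u i" by linarith
  then show ?case
    using length_nform_transpose[OF u e(3,4), folded e(2)]
      length_nform_transpose_less[OF u e(3,4), folded e(2)] Cons.IH[OF e(1)]
    by cases auto
qed

lemma reduced_expression_nform: "w permutes {1..n} \<Longrightarrow> reduced_expression n w (nform n w)"
  by (simp add: reduced_expression_def expression_nform length_nform_le)

lemma length_reduced_expression:
  "w permutes {1..n} \<Longrightarrow> reduced_expression n w is \<Longrightarrow> length is = length (nform n w)"
  by (meson expression_nform length_nform_le reduced_expression_def order_antisym)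

text \<open>Matsumoto's theorem for the symmetric group. It makes the \<open>SOME\<close> in
  \<open>hTw\<close> harmless.\<close>

lemma (in braid_gens) Tprod_reduced_expression:
  assumes "reduced_expression n w is"
  shows "Tprod is = Tprod (nform n w)"
  using assms
proof (induction "is" arbitrary: w)
  case Nil
  then have "w permutes {1..n}" by (auto simp: reduced_expression_def expression_def perm_of_Nil permutes_id)
  with length_reduced_expression[OF this Nil] show ?case by simp
next
  case (Cons i "is")
  let ?u = "perm_of is"
  have e: "expression n ?u is" "w = ?u \<circ> transpose i (Suc i)" "1 \<le> i" "i < n"
    using Cons.prems by (auto simp: reduced_expression_def expression_def perm_of_Cons)
  have u: "?u permutes {1..n}" using e(1) by (intro perm_of_permutes) (simp add: expression_def)
  have w: "w permutes {1..n}"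
    unfolding e(2) using e u by (intro permutes_compose[OF permutes_swap_id]) auto
  have red: "reduced_expression n ?u is"
    unfolding reduced_expression_def
  proof (intro conjI allI impI)
    fix js assume "expression n ?u js"
    then have "expression n w (i # js)"
      using e by (auto simp: expression_def perm_of_Cons)
    then have "length (i # is) \<le> length (i # js)"
      using Cons.prems unfolding reduced_expression_def by blast
    then show "length is \<le> length js" by simp
  qed (rule e)
  have "?u i \<noteq> ?u (Suc i)" using permutes_inj[OF u] by (metis injD n_not_Suc_n)
  \<comment> \<open>At a descent the normal form of \<open>w\<close> would be two letters shorter
    than \<open>i # is\<close>.\<close>
  moreover have "\<not> ?u (Suc i) < ?u i"
    using length_nform_transpose_less[OF u e(3,4), folded e(2)] length_reduced_expression[OF u red]
      length_reduced_expression[OF w Cons.prems] by auto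
  ultimately have "?u i < ?u (Suc i)" by linarith
  from nform_transpose[OF u order_refl e(3,4) this, folded e(2)] Cons.IH[OF red]
  show ?case by simp
qed

subsection \<open>Sums over Young subgroups\<close>

text \<open>Rows are given by a labelling of the numbers, because a labelling can simply be
  restricted in an induction on \<open>n\<close>.\<close>

definition row_young :: "nat \<Rightarrow> (nat \<Rightarrow> 'c) \<Rightarrow> (nat \<Rightarrow> nat) set" where
  "row_young n rho = {w. w permutes {1..n} \<and> (\<forall>x\<in>{1..n}. rho (w x) = rho x)}"

definition convex_rows :: "nat \<Rightarrow> (nat \<Rightarrow> 'c) \<Rightarrow> bool" where
  "convex_rows n rho \<longleftrightarrow> (\<forall>x y z. 1 \<le> x \<and> x \<le> y \<and> y \<le> z \<and> z \<le> n \<and> rho x = rho z \<longrightarrow> rho y = rho x)"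

lemma convex_rowsD:
  "convex_rows n rho \<Longrightarrow> 1 \<le> x \<Longrightarrow> x \<le> y \<Longrightarrow> y \<le> z \<Longrightarrow> z \<le> n \<Longrightarrow> rho x = rho z \<Longrightarrow> rho y = rho x"
  unfolding convex_rows_def by blast

lemma convex_rows_mono: "convex_rows n rho \<Longrightarrow> m \<le> n \<Longrightarrow> convex_rows m rho"
  unfolding convex_rows_def by (meson order_trans)

text \<open>A permutation is determined by the number \<open>a\<close> that it moves to
  \<open>Suc n\<close> and by the rest. Convexity puts all numbers from \<open>a\<close> to
  \<open>Suc n\<close> into the last row, so the cycle preserves the rows.\<close>

lemma row_young_Suc_bij:
  assumes "convex_rows (Suc n) rho"
  shows "bij_betw (\<lambda>(a, w). w \<circ> dcyc a (Suc n))
    ({a\<in>{1..Suc n}. rho a = rho (Suc n)} \<times> row_young n rho) (row_young (Suc n) rho)"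
proof (rule bij_betw_byWitness[of _ "\<lambda>w. (inv_into UNIV w (Suc n), w \<circ> ucyc (inv_into UNIV w (Suc n)) (Suc n))"])
  let ?N = "Suc n" and ?A = "{a\<in>{1..Suc n}. rho a = rho (Suc n)}"
  have const: "rho m = rho ?N" if "a \<in> ?A" "a \<le> m" "m \<le> ?N" for a m
    using convex_rowsD[OF assms, of a m ?N] that by auto
  have perm: "w \<circ> dcyc a ?N permutes {1..?N}" "w permutes {1..?N}" "w ?N = ?N"
    if "a \<in> ?A" "w \<in> row_young n rho" for a w
  proof -
    have w: "w permutes {1..n}" using that by (simp add: row_young_def)
    then show "w permutes {1..?N}" by (rule permutes_subset) auto
    then show "w \<circ> dcyc a ?N permutes {1..?N}"
      using that by (intro permutes_compose[OF dcyc_permutes]) auto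
    show "w ?N = ?N" using w by (rule permutes_not_in) auto
  qed
  have inv: "inv_into UNIV (w \<circ> dcyc a ?N) ?N = a" if "a \<in> ?A" "w \<in> row_young n rho" for a w
    using permutes_inverses(2)[OF perm(1)[OF that], of a] perm(3)[OF that] by (simp add: dcyc_def)
  show "\<forall>aw\<in>?A \<times> row_young n rho. (\<lambda>w. (inv_into UNIV w ?N, w \<circ> ucyc (inv_into UNIV w ?N) ?N)) ((\<lambda>(a, w). w \<circ> dcyc a ?N) aw) = aw"
    using inv dcyc_ucyc by (auto simp: fun_eq_iff)
  show "\<forall>w\<in>row_young ?N rho. (\<lambda>(a, w). w \<circ> dcyc a ?N) (inv_into UNIV w ?N, w \<circ> ucyc (inv_into UNIV w ?N) ?N) = w"
    using inv_last(1) ucyc_dcyc by (fastforce simp: row_young_def fun_eq_iff)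
  show "(\<lambda>(a, w). w \<circ> dcyc a ?N) ` (?A \<times> row_young n rho) \<subseteq> row_young ?N rho"
  proof clarify
    fix a w assume aw: "a \<in> {1..?N}" "rho a = rho ?N" "w \<in> row_young n rho"
    have "rho ((w \<circ> dcyc a ?N) x) = rho x" if x: "x \<in> {1..?N}" for x
    proof -
      have "rho (w y) = rho y" if "y \<in> {1..?N}" for y
        using that aw perm(3)[of a w] by (cases "y = ?N") (auto simp: row_young_def)
      moreover have "dcyc a ?N x \<in> {1..?N}"
        using permutes_in_image[OF dcyc_permutes[of a ?N]] x aw by auto
      moreover have "rho (dcyc a ?N x) = rho x"
        using const[of a x] const[of a "x - 1"] x aw by (auto simp: dcyc_def)
      ultimately show ?thesis by simp
    qed
    then show "w \<circ> dcyc a ?N \<in> row_young ?N rho"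
      using perm(1)[of a w] aw by (auto simp: row_young_def)
  qed
  show "(\<lambda>w. (inv_into UNIV w ?N, w \<circ> ucyc (inv_into UNIV w ?N) ?N)) ` row_young ?N rho \<subseteq> ?A \<times> row_young n rho"
  proof clarify
    fix w assume w: "w \<in> row_young ?N rho"
    then have p: "w permutes {1..?N}" by (simp add: row_young_def)
    note a = inv_last[OF p]
    have aA: "inv_into UNIV w ?N \<in> ?A" using w a unfolding row_young_def by force
    have "rho ((w \<circ> ucyc (inv_into UNIV w ?N) ?N) x) = rho x" if "x \<in> {1..n}" for x
      using w that const[OF aA, of x] const[OF aA, of "Suc x"]
      by (auto simp: row_young_def ucyc_def)
    then show "inv_into UNIV w ?N \<in> ?A \<and> w \<circ> ucyc (inv_into UNIV w ?N) ?N \<in> row_young n rho"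
      using aA nform_tail_permutes[OF p] by (simp add: row_young_def)
  qed
qed

text \<open>The sum over the distinguished coset representatives in one step of the chain of row
  stabilizers on \<open>{1..m}\<close>; the product of these factors is the sum over the whole Young
  subgroup.\<close>

definition row_factor :: "(nat \<Rightarrow> 'b::ring_1) \<Rightarrow> (nat \<Rightarrow> 'c) \<Rightarrow> nat \<Rightarrow> 'b" where
  "row_factor T rho m = (\<Sum>a | a \<in> {1..m} \<and> rho a = rho m. prod_list (map T [a..<m]))"

lemma sum_row_young:
  assumes "convex_rows n rho"
  shows "(\<Sum>w\<in>row_young n rho. prod_list (map T (nform n w))) = prod_list (map (row_factor T rho) (rev [1..<Suc n]))"
  using assms
proof (induction n)
  case 0
  then show ?case by (simp add: row_young_def)
next
  case (Suc n)
  let ?A = "{a\<in>{1..Suc n}. rho a = rho (Suc n)}" and ?P = "\<lambda>is. prod_list (map T is)"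
  have "(\<Sum>w\<in>row_young (Suc n) rho. ?P (nform (Suc n) w))
      = (\<Sum>(a, w)\<in>?A \<times> row_young n rho. ?P (nform (Suc n) (w \<circ> dcyc a (Suc n))))"
    using sum.reindex_bij_betw[OF row_young_Suc_bij[OF Suc.prems], of "\<lambda>w. ?P (nform (Suc n) w)"]
    by (simp add: case_prod_unfold)
  also have "\<dots> = (\<Sum>(a, w)\<in>?A \<times> row_young n rho. ?P [a..<Suc n] * ?P (nform n w))"
    by (rule sum.cong[OF refl]) (clarsimp simp: row_young_def nform_dcyc simp del: upt_Suc nform.simps)
  also have "\<dots> = row_factor T rho (Suc n) * (\<Sum>w\<in>row_young n rho. ?P (nform n w))"
    unfolding row_factor_def sum_product sum.cartesian_product by (simp del: upt_Suc)
  finally show ?case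
    using Suc.IH convex_rows_mono[OF Suc.prems] by simp
qed

subsection \<open>Diagrams and their row-reading tableaux\<close>

text \<open>Asks for just what the row-reading bijection takes, so that the shape left after
  removing a node is readily another instance.\<close>

locale row_diagram =
  fixes ell n :: nat and lam :: mpart
  assumes fin: "finite {r. lam l r \<noteq> 0}"
    and size: "(\<Sum>l=1..ell. psize (lam l)) = n"
    and card: "card (diagram ell lam) = n"
begin

abbreviation "D \<equiv> diagram ell lam"
abbreviation "t0 \<equiv> init_tab ell lam"

lemma psize_superset: "finite F \<Longrightarrow> {r. p r \<noteq> 0} \<subseteq> F \<Longrightarrow> psize p = sum p F" for p :: "nat \<Rightarrow> nat"
  unfolding psize_def by (rule sum.mono_neutral_left) auto

lemma row_sum_le_psize: "sum (lam l) {1..<Suc r} \<le> psize (lam l)"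
proof -
  have "psize (lam l) = sum (lam l) ({r. lam l r \<noteq> 0} \<union> {1..<Suc r})"
    using fin by (intro psize_superset) auto
  moreover have "sum (lam l) {1..<Suc r} \<le> sum (lam l) ({r. lam l r \<noteq> 0} \<union> {1..<Suc r})"
    using fin by (intro sum_mono2) auto
  ultimately show ?thesis by simp
qed

lemma frak_a_Suc: "1 \<le> l \<Longrightarrow> frak_a lam (Suc l) = frak_a lam l + psize (lam l)"
  by (simp add: frak_a_def)

lemma frak_a_mono: "s \<le> s' \<Longrightarrow> frak_a lam s \<le> frak_a lam s'"
  unfolding frak_a_def by (rule sum_mono2) auto

lemma frak_a_top: "frak_a lam (Suc ell) = n"
  using size by (simp add: frak_a_def atLeastLessThanSuc_atLeastAtMost)

lemma init_tab_eq: "(r, c, l) \<in> D \<Longrightarrow> t0 (r, c, l) = frak_a lam l + sum (lam l) {1..<r} + c"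
  by (simp add: init_tab_def)

lemma init_tab_bounds:
  assumes "(r, c, l) \<in> D"
  shows "frak_a lam l < t0 (r, c, l)" "t0 (r, c, l) \<le> frak_a lam (Suc l)"
proof -
  have c: "1 \<le> l" "1 \<le> r" "1 \<le> c" "c \<le> lam l r" using assms by (auto simp: diagram_def)
  then show "frak_a lam l < t0 (r, c, l)" using init_tab_eq[OF assms] by simp
  have "sum (lam l) {1..<r} + c \<le> sum (lam l) {1..<Suc r}" using c by simp
  then show "t0 (r, c, l) \<le> frak_a lam (Suc l)"
    using init_tab_eq[OF assms] row_sum_le_psize[of l r] frak_a_Suc[of l] c by simp
qed

lemma init_tab_le_frak_a:
  assumes "(r, c, l) \<in> D" shows "t0 (r, c, l) \<le> frak_a lam s \<longleftrightarrow> l < s"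
proof (cases "l < s")
  case True
  then show ?thesis using init_tab_bounds(2)[OF assms] frak_a_mono[of "Suc l" s] by simp
next
  case False
  then show ?thesis using init_tab_bounds(1)[OF assms] frak_a_mono[of s l] by simp
qed

lemma init_tab_less:
  assumes "(r, c, l) \<in> D" "(r', c', l') \<in> D"
    and "l < l' \<or> (l = l' \<and> (r < r' \<or> (r = r' \<and> c < c')))"
  shows "t0 (r, c, l) < t0 (r', c', l')"
proof -
  consider "l < l'" | "l = l'" "r < r'" | "l = l'" "r = r'" "c < c'" using assms(3) by blast
  then show ?thesis
  proof cases
    case 1
    then show ?thesis
      using init_tab_bounds(2)[OF assms(1)] init_tab_bounds(1)[OF assms(2)] frak_a_mono[of "Suc l" l'] by simp
  next
    case 2
    have c: "1 \<le> r" "c \<le> lam l r" "1 \<le> c'" using assms by (auto simp: diagram_def)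
    have "sum (lam l) {1..<r} + c \<le> sum (lam l) {1..<Suc r}" using c by simp
    also have "\<dots> \<le> sum (lam l) {1..<r'}" using 2 by (intro sum_mono2) auto
    finally show ?thesis using 2 c assms by (simp add: init_tab_eq)
  next
    case 3
    then show ?thesis using assms by (simp add: init_tab_eq)
  qed
qed

lemma init_tab_less_iff:
  assumes "(r, c, l) \<in> D" "(r', c', l') \<in> D"
  shows "t0 (r, c, l) < t0 (r', c', l') \<longleftrightarrow> l < l' \<or> (l = l' \<and> (r < r' \<or> (r = r' \<and> c < c')))"
  using init_tab_less[OF assms] init_tab_less[OF assms(2,1)] by (metis linorder_neqE_nat order_less_asym)

lemma finite_diagram: "finite D"
proof -
  have "D \<subseteq> (\<lambda>(l, r, c). (r, c, l)) ` (SIGMA l:{1..ell}. SIGMA r:{r. lam l r \<noteq> 0}. {1..lam l r})"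
    by (force simp: diagram_def)
  moreover have "finite (SIGMA l:{1..ell}. SIGMA r:{r. lam l r \<noteq> 0}. {1..lam l r})"
    by (intro finite_SigmaI finite_atLeastAtMost fin)
  ultimately show ?thesis
    using finite_imageI finite_subset by blast
qed

lemma bij_init_tab: "bij_betw t0 D {1..n}"
proof -
  have inj: "inj_on t0 D"
  proof (rule inj_onI)
    fix x y assume xy: "x \<in> D" "y \<in> D" "t0 x = t0 y"
    obtain r c l r' c' l' where e: "x = (r, c, l)" "y = (r', c', l')" by (metis prod.exhaust)
    show "x = y"
      using xy init_tab_less[of r c l r' c' l'] init_tab_less[of r' c' l' r c l] unfolding e
      by (metis less_irrefl linorder_neqE_nat)
  qed
  have "t0 ` D \<subseteq> {1..n}"
  proof clarify
    fix r c l assume x: "(r, c, l) \<in> D"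
    then have "Suc l \<le> Suc ell" by (simp add: diagram_def)
    then show "t0 (r, c, l) \<in> {1..n}"
      using init_tab_bounds[OF x] frak_a_mono[of "Suc l" "Suc ell"] by (simp add: frak_a_top)
  qed
  then have "t0 ` D = {1..n}"
    by (rule card_subset_eq[rotated]) (simp_all add: card_image[OF inj] card)
  with inj show ?thesis by (simp add: bij_betw_def)
qed

abbreviation node :: "nat \<Rightarrow> node" where "node m \<equiv> inv_into D t0 m"

lemma node_in: "m \<in> {1..n} \<Longrightarrow> node m \<in> D"
  using bij_init_tab by (metis bij_betw_imp_surj_on inv_into_into)

lemma init_tab_node: "m \<in> {1..n} \<Longrightarrow> t0 (node m) = m"
  using bij_init_tab by (metis bij_betw_inv_into_right)

lemma node_init_tab: "x \<in> D \<Longrightarrow> node (t0 x) = x"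
  using bij_init_tab by (metis bij_betw_inv_into_left)

lemma init_tab_in: "x \<in> D \<Longrightarrow> t0 x \<in> {1..n}"
  using bij_init_tab by (metis bij_betwE)

text \<open>With the component first, the lexicographic order of the pairs is the order in which the
  rows are read.\<close>

definition row_of :: "nat \<Rightarrow> nat \<times> nat" where
  "row_of m = (case node m of (r, c, l) \<Rightarrow> (l, r))"

lemma row_of_init_tab: "(r, c, l) \<in> D \<Longrightarrow> row_of (t0 (r, c, l)) = (l, r)"
  by (simp add: row_of_def node_init_tab)

lemma row_of_mono:
  assumes "1 \<le> x" "x \<le> y" "y \<le> n"
  shows "fst (row_of x) < fst (row_of y) \<or> fst (row_of x) = fst (row_of y) \<and> snd (row_of x) \<le> snd (row_of y)"
proof -
  obtain r c l r' c' l' where e: "node x = (r, c, l)" "node y = (r', c', l')" by (metis prod.exhaust)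
  have D: "(r, c, l) \<in> D" "(r', c', l') \<in> D" "t0 (r, c, l) = x" "t0 (r', c', l') = y"
    using node_in[of x] node_in[of y] init_tab_node[of x] init_tab_node[of y] assms e by auto
  show ?thesis
    using init_tab_less_iff[OF D(2,1)] D(3,4) assms by (auto simp: row_of_def e)
qed

lemma convex_row_of: "convex_rows n row_of"
  unfolding convex_rows_def
proof clarify
  fix x y z :: nat assume "1 \<le> x" "x \<le> y" "y \<le> z" "z \<le> n" "row_of x = row_of z"
  then show "row_of y = row_of x"
    using row_of_mono[of x y] row_of_mono[of y z] by (auto intro!: prod_eqI)
qed

lemma row_of_frak_a: "m \<in> {1..n} \<Longrightarrow> m \<le> frak_a lam s \<longleftrightarrow> fst (row_of m) < s"
  using init_tab_le_frak_a node_in[of m] init_tab_node[of m]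
  by (cases "node m") (auto simp: row_of_def)

lemma row_entries_eq: "row_entries ell lam l r = {m \<in> {1..n}. row_of m = (l, r)}"
proof (intro equalityI subsetI)
  fix m assume "m \<in> row_entries ell lam l r"
  then obtain c where "(r, c, l) \<in> D" "m = t0 (r, c, l)" by (auto simp: row_entries_def)
  then show "m \<in> {m \<in> {1..n}. row_of m = (l, r)}" using init_tab_in row_of_init_tab by auto
next
  fix m assume m: "m \<in> {m \<in> {1..n}. row_of m = (l, r)}"
  obtain r' c' l' where e: "node m = (r', c', l')" by (metis prod.exhaust)
  then have "(r, c', l) \<in> D" "t0 (r, c', l) = m"
    using node_in[of m] init_tab_node[of m] m by (auto simp: row_of_def)
  then show "m \<in> row_entries ell lam l r"
    unfolding row_entries_def by (intro image_eqI[of _ _ "(r, c', l)"]) auto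
qed

lemma young_eq: "young ell n lam = row_young n row_of"
proof (intro equalityI subsetI)
  fix w assume w: "w \<in> young ell n lam"
  have "row_of (w x) = row_of x" if "x \<in> {1..n}" for x
  proof -
    have "x \<in> row_entries ell lam (fst (row_of x)) (snd (row_of x))"
      using that by (simp add: row_entries_eq)
    moreover have "w ` row_entries ell lam l r = row_entries ell lam l r" for l r
      using w by (simp add: young_def)
    ultimately have "w x \<in> row_entries ell lam (fst (row_of x)) (snd (row_of x))"
      by (metis imageI)
    then show ?thesis by (simp add: row_entries_eq)
  qed
  then show "w \<in> row_young n row_of" using w by (simp add: young_def row_young_def)
next
  fix w assume w: "w \<in> row_young n row_of"
  have "w ` row_entries ell lam l r = row_entries ell lam l r" for l r
  proof (rule card_subset_eq)
    have p: "w permutes {1..n}" using w by (simp add: row_young_def)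
    show "w ` row_entries ell lam l r \<subseteq> row_entries ell lam l r"
      using w permutes_in_image[OF p] by (auto simp: row_entries_eq row_young_def)
    show "card (w ` row_entries ell lam l r) = card (row_entries ell lam l r)"
      using permutes_inj_on[OF p] by (rule card_image)
    show "finite (row_entries ell lam l r)" by (simp add: row_entries_eq)
  qed
  then show "w \<in> young ell n lam" using w by (simp add: young_def row_young_def)
qed

lemma tab_perm_eqI:
  assumes "w permutes {1..n}" "\<And>x. x \<in> D \<Longrightarrow> t x = w (t0 x)"
  shows "tab_perm ell n lam t = w"
  unfolding tab_perm_def
proof (rule the_equality)
  show "w permutes {1..n} \<and> (\<forall>x\<in>D. t x = w (t0 x))" using assms by blast
  fix v assume v: "v permutes {1..n} \<and> (\<forall>x\<in>D. t x = v (t0 x))"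
  show "v = w"
  proof
    fix m
    show "v m = w m"
    proof (cases "m \<in> {1..n}")
      case True
      then show ?thesis using v assms(2) node_in[OF True] init_tab_node[OF True] by metis
    next
      case False
      then show ?thesis using v assms(1) by (metis permutes_not_in)
    qed
  qed
qed

lemma tab_perm:
  assumes "bij_betw t D {1..n}"
  shows "tab_perm ell n lam t permutes {1..n}" "x \<in> D \<Longrightarrow> t x = tab_perm ell n lam t (t0 x)"
proof -
  let ?w = "\<lambda>m. if m \<in> {1..n} then t (node m) else m"
  have "bij_betw (t \<circ> node) {1..n} {1..n}"
    using bij_betw_inv_into[OF bij_init_tab] assms by (rule bij_betw_trans)
  then have "bij_betw ?w {1..n} {1..n}"
    by (rule bij_betw_cong[THEN iffD1, rotated]) simp
  then have w: "?w permutes {1..n}"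
    by (rule bij_imp_permutes) auto
  have t: "t x = ?w (t0 x)" if "x \<in> D" for x
    using init_tab_in[OF that] node_init_tab[OF that] by simp
  have "tab_perm ell n lam t = ?w" using w t by (rule tab_perm_eqI)
  then show "tab_perm ell n lam t permutes {1..n}" "x \<in> D \<Longrightarrow> t x = tab_perm ell n lam t (t0 x)"
    using w t[of x] by simp_all
qed

end

lemma row_diagram_multipartition:
  assumes "lam \<in> multipartitions ell n" "t \<in> Std ell n lam"
  shows "row_diagram ell n lam"
proof
  show "finite {r. lam l r \<noteq> 0}" for l
    using assms(1) by (cases "l \<in> {1..ell}") (auto simp: multipartitions_def is_partition_def)
  show "(\<Sum>l=1..ell. psize (lam l)) = n"
    using assms(1) by (simp add: multipartitions_def)
  have "bij_betw t (diagram ell lam) {1..n}"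
    using assms(2) by (simp add: Std_def tableaux_def)
  then show "card (diagram ell lam) = n"
    using bij_betw_same_card by fastforce
qed

text \<open>\<open>x = (r, c, l)\<close> is the node of the largest entry of a standard tableau.\<close>

locale last_node = row_diagram ell n lam for ell n lam +
  fixes r c l :: nat and mu :: mpart
  assumes x: "(r, c, l) \<in> diagram ell lam" and c: "c = lam l r"
    and n: "1 \<le> n"
  defines "mu \<equiv> \<lambda>l' r'. if l' = l \<and> r' = r then lam l r - 1 else lam l' r'"
begin

abbreviation a :: nat where "a \<equiv> init_tab ell lam (r, c, l)"

lemma diagram_mu: "diagram ell mu = D - {(r, c, l)}"
  using x c by (auto simp: diagram_def mu_def)

lemma lr: "1 \<le> l" "l \<le> ell" "1 \<le> r" "1 \<le> lam l r"
  using x c by (auto simp: diagram_def)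

lemma sum_mu: "sum (mu l') R = sum (lam l') R - (if l' = l \<and> r \<in> R then 1 else 0)" if "finite R"
proof (cases "l' = l \<and> r \<in> R")
  case True
  then have "sum (mu l') R = mu l r + sum (mu l') (R - {r})" "sum (lam l') R = lam l r + sum (lam l') (R - {r})"
    using that by (auto simp: sum.remove)
  moreover have "sum (mu l') (R - {r}) = sum (lam l') (R - {r})"
    by (rule sum.cong) (auto simp: mu_def)
  ultimately show ?thesis using True lr by (simp add: mu_def)
next
  case False
  then have "sum (mu l') R = sum (lam l') R" by (intro sum.cong) (auto simp: mu_def)
  then show ?thesis using False by auto
qed

lemma psize_mu: "psize (mu l') = psize (lam l') - (if l' = l then 1 else 0)"
proof -
  have "psize (mu l') = sum (mu l') {r. lam l' r \<noteq> 0}"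
    using fin[of l'] by (intro psize_superset) (auto simp: mu_def split: if_splits)
  then show ?thesis using fin[of l'] lr by (simp add: sum_mu psize_def)
qed

lemma psize_pos: "1 \<le> psize (lam l)"
proof -
  have "lam l r \<le> sum (lam l) {1..<Suc r}" using lr by simp
  also have "\<dots> \<le> psize (lam l)" by (rule row_sum_le_psize)
  finally show ?thesis using lr by simp
qed

lemma sum_psize_mu:
  "finite S \<Longrightarrow> (\<Sum>l'\<in>S. psize (mu l')) = (\<Sum>l'\<in>S. psize (lam l')) - (if l \<in> S then 1 else 0)"
proof (cases "l \<in> S")
  case True
  assume S: "finite S"
  have "(\<Sum>l'\<in>S - {l}. psize (mu l')) = (\<Sum>l'\<in>S - {l}. psize (lam l'))"
    by (rule sum.cong) (auto simp: psize_mu)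
  then show ?thesis
    using True S psize_pos by (simp add: sum.remove[OF S True] psize_mu)
qed (auto simp: psize_mu intro!: sum.cong)

lemma frak_a_mu: "frak_a mu s = frak_a lam s - (if l < s then 1 else 0)"
  using lr by (auto simp: frak_a_def sum_psize_mu)

sublocale mu: row_diagram ell "n - 1" mu
proof
  fix l'
  have "{r'. mu l' r' \<noteq> 0} \<subseteq> {r'. lam l' r' \<noteq> 0}"
    by (auto simp: mu_def split: if_splits)
  then show "finite {r'. mu l' r' \<noteq> 0}" using fin by (rule finite_subset)
next
  show "(\<Sum>l' = 1..ell. psize (mu l')) = n - 1"
    using lr size by (simp add: sum_psize_mu)
  show "card (diagram ell mu) = n - 1"
    using x card finite_diagram by (simp add: diagram_mu)
qed

lemma a_range: "1 \<le> a" "a \<le> n"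
  using init_tab_in[OF x] by auto

text \<open>Removing the node numbered \<open>a\<close> lowers the later numbers by one. As the node
  ends its row, no other node of that row is shifted.\<close>

lemma init_tab_mu:
  assumes "y \<in> diagram ell mu"
  shows "init_tab ell mu y = dcyc a n (t0 y)"
proof -
  obtain r' c' l' where y: "y = (r', c', l')" by (metis prod.exhaust)
  have D: "(r', c', l') \<in> D" "(r', c', l') \<noteq> (r, c, l)" using assms by (auto simp: diagram_mu y)
  have yn: "t0 y \<le> n" "t0 y \<noteq> a"
  proof -
    show "t0 y \<le> n" using init_tab_in[OF D(1)] by (simp add: y)
    show "t0 y \<noteq> a"
      using node_init_tab[OF D(1)] node_init_tab[OF x] D(2) unfolding y by metis
  qed
  have c': "r' = r \<Longrightarrow> l' = l \<Longrightarrow> c' < c"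
    using D c by (auto simp: diagram_def)
  have eq: "init_tab ell mu y = frak_a mu l' + sum (mu l') {1..<r'} + c'"
    using mu.init_tab_eq assms by (simp add: y)
  have eq': "t0 y = frak_a lam l' + sum (lam l') {1..<r'} + c'"
    using init_tab_eq D by (simp add: y)
  show ?thesis
  proof (cases "l < l' \<or> (l = l' \<and> r < r')")
    case True
    then have less: "a < t0 y"
      using init_tab_less[OF x D(1)] by (auto simp: y)
    have "init_tab ell mu y = t0 y - 1"
    proof (cases "l = l'")
      case False
      then have "1 \<le> frak_a lam l'"
        using True init_tab_bounds[OF x] frak_a_mono[of "Suc l" l'] by auto
      then show ?thesis using True False eq eq' by (simp add: frak_a_mu sum_mu)
    next
      case l: True
      then have "r \<in> {1..<r'}" using True lr by auto
      then have "lam l r \<le> sum (lam l) {1..<r'}" by (intro member_le_sum) auto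
      then show ?thesis using True l eq eq' lr by (simp add: frak_a_mu sum_mu)
    qed
    then show ?thesis using less yn by (simp add: dcyc_def)
  next
    case False
    then have less: "t0 y < a"
      using init_tab_less[OF D(1) x] D c' by (fastforce simp: y)
    have "init_tab ell mu y = t0 y"
      using False eq eq' by (auto simp: frak_a_mu sum_mu)
    then show ?thesis using less yn by (simp add: dcyc_def)
  qed
qed

lemma row_of_mu:
  assumes "m \<in> {1..n - 1}"
  shows "mu.row_of m = row_of (if m < a then m else Suc m)"
proof -
  let ?y = "mu.node m"
  have y: "?y \<in> diagram ell mu" "init_tab ell mu ?y = m"
    using mu.node_in mu.init_tab_node assms by auto
  then have "dcyc a n (t0 ?y) = m" using init_tab_mu by simp
  then have "t0 ?y = ucyc a n m" using ucyc_dcyc[OF a_range(2)] by metis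
  also have "\<dots> = (if m < a then m else Suc m)" using assms a_range by (auto simp: ucyc_def)
  finally have "t0 ?y = (if m < a then m else Suc m)" .
  moreover have "row_of (t0 ?y) = mu.row_of m"
    using y(1) by (cases ?y) (simp add: mu.row_of_def row_of_init_tab diagram_mu)
  ultimately show ?thesis by simp
qed

lemma row_of_a: "row_of a = (l, r)"
  using x by (rule row_of_init_tab)

text \<open>The node numbered \<open>a\<close> ends its row, so the cut after \<open>a\<close> falls
  between two rows.\<close>

lemma row_of_after_a:
  assumes "1 \<le> y" "y \<le> a" "a < z" "z \<le> n" shows "row_of y \<noteq> row_of z"
proof
  assume e: "row_of y = row_of z"
  then have "row_of a = row_of y"
    using convex_rowsD[OF convex_row_of, of y a z] assms by simp
  then have z: "row_of z = (l, r)" using row_of_a e by simp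
  obtain r' c' l' where node: "node z = (r', c', l')" by (metis prod.exhaust)
  then have D: "(r, c', l) \<in> D" "t0 (r, c', l) = z"
    using node_in[of z] init_tab_node[of z] z assms by (auto simp: row_of_def)
  then have "c' \<le> c" using c by (auto simp: diagram_def)
  then show False
    using D(2) assms init_tab_less_iff[OF x D(1)] by auto
qed

lemma frak_a_vs_a: "a \<le> frak_a lam s \<longleftrightarrow> l < s"
  using x by (rule init_tab_le_frak_a)

text \<open>Composing with \<open>ucyc a n\<close> makes \<open>n\<close> a fixed point. What
  remains belongs to the restricted tableau, since \<open>init_tab_mu\<close> renumbers the nodes by
  the inverse cycle.\<close>

lemma tab_perm_sub:
  assumes t: "bij_betw t D {1..n}" "t (r, c, l) = n"
  defines "w \<equiv> tab_perm ell n lam t" and "w' \<equiv> tab_perm ell (n - 1) mu (sub_tab ell lam (n - 1) t)"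
  shows "w' permutes {1..n - 1}" "w = w' \<circ> dcyc a n"
proof -
  note w = tab_perm[OF t(1), folded w_def]
  have le: "t y \<le> n - 1 \<longleftrightarrow> y \<noteq> (r, c, l)" if "y \<in> D" for y
  proof -
    have "t y \<in> {1..n}" using t(1) that by (metis bij_betwE)
    moreover have "t y = n \<longleftrightarrow> y = (r, c, l)"
      using t that x by (metis bij_betw_def inj_onD)
    ultimately show ?thesis using n by auto
  qed
  let ?v = "w \<circ> ucyc a n"
  have N: "n = Suc (n - 1)" using n by simp
  have "?v permutes {1..n}"
    using w(1) a_range by (intro permutes_compose[OF ucyc_permutes]) auto
  moreover have "?v n = n" using w(2)[OF x] t(2) by (simp add: ucyc_def)
  ultimately have v: "?v permutes {1..n - 1}"
    using permutes_fixed_last[of ?v "n - 1"] N by simp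
  have "w' = ?v"
    unfolding w'_def
  proof (rule mu.tab_perm_eqI[OF v])
    fix y assume y: "y \<in> diagram ell mu"
    then have "y \<in> D" "y \<noteq> (r, c, l)" by (auto simp: diagram_mu)
    then have "sub_tab ell lam (n - 1) t y = t y" using le by (simp add: sub_tab_def)
    also have "\<dots> = ?v (init_tab ell mu y)"
      using w(2)[OF \<open>y \<in> D\<close>] ucyc_dcyc[OF a_range(2)] by (simp add: init_tab_mu[OF y])
    finally show "sub_tab ell lam (n - 1) t y = ?v (init_tab ell mu y)" .
  qed
  then show "w' permutes {1..n - 1}" using v by simp
  show "w = w' \<circ> dcyc a n"
    using ucyc_dcyc[OF a_range(2)] by (simp add: \<open>w' = ?v\<close> fun_eq_iff)
qed

end

lemma Std_last_node:
  assumes "lam \<in> multipartitions ell n" "t \<in> Std ell n lam" "1 \<le> n"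
    and "node_of ell lam t n = (r, c, l)"
  shows "last_node ell n lam r c l" "t (r, c, l) = n" "bij_betw t (diagram ell lam) {1..n}"
    "n_of ell n lam t = init_tab ell lam (r, c, l)" "comp_of ell lam t n = l"
    "sub_shape ell lam (n - 1) t = (\<lambda>l' r'. if l' = l \<and> r' = r then lam l r - 1 else lam l' r')"
proof -
  interpret row_diagram ell n lam by (rule row_diagram_multipartition[OF assms(1,2)])
  show t: "bij_betw t D {1..n}"
    using assms(2) by (simp add: Std_def tableaux_def)
  have n: "n \<in> {1..n}" using assms(3) by simp
  have x: "(r, c, l) \<in> D" "t (r, c, l) = n"
    using t n assms(4) unfolding node_of_def
    by (metis bij_betw_imp_surj_on inv_into_into, metis bij_betw_inv_into_right)
  then show "t (r, c, l) = n" by simp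
  have le: "t y \<le> n" if "y \<in> D" for y using t that bij_betwE by fastforce
  \<comment> \<open>A further node in the row would carry an entry larger than
    \<open>n\<close>.\<close>
  have "(r, Suc c, l) \<notin> D"
  proof
    assume y: "(r, Suc c, l) \<in> D"
    then have "t (r, c, l) < t (r, Suc c, l)" using assms(2) x unfolding Std_def by blast
    then show False using le[OF y] x by simp
  qed
  then have c: "c = lam l r" using x(1) by (auto simp: diagram_def)
  show "last_node ell n lam r c l"
    using x c assms(3) row_diagram_axioms by (simp add: last_node_def last_node_axioms_def)
  show "n_of ell n lam t = t0 (r, c, l)"
    unfolding n_of_def
  proof (rule the_equality)
    show "t0 (r, c, l) \<in> {1..n} \<and> node_of ell lam t n = node_of ell lam t0 (t0 (r, c, l))"
      using init_tab_in[OF x(1)] node_init_tab[OF x(1)] assms(4) by (simp add: node_of_def)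
    fix m assume "m \<in> {1..n} \<and> node_of ell lam t n = node_of ell lam t0 m"
    then show "m = t0 (r, c, l)" using init_tab_node assms(4) by (metis node_of_def)
  qed
  show "comp_of ell lam t n = l" using assms(4) by (simp add: comp_of_def)
  have lt: "t y \<le> n - 1 \<longleftrightarrow> y \<noteq> (r, c, l)" if "y \<in> D" for y
  proof -
    have "t y = n \<longleftrightarrow> y = (r, c, l)"
      using t that x by (metis bij_betw_def inj_onD)
    then show ?thesis using le[OF that] assms(3) by auto
  qed
  show "sub_shape ell lam (n - 1) t = (\<lambda>l' r'. if l' = l \<and> r' = r then lam l r - 1 else lam l' r')"
  proof (intro ext)
    fix l' r'
    have "{c'. (r', c', l') \<in> D \<and> t (r', c', l') \<le> n - 1} = {c'. (r', c', l') \<in> D \<and> (r', c', l') \<noteq> (r, c, l)}"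
      using lt by auto
    also have "\<dots> = {1..if l' = l \<and> r' = r then lam l r - 1 else lam l' r'}"
    proof (cases "1 \<le> l' \<and> l' \<le> ell \<and> 1 \<le> r'")
      case True
      then show ?thesis using c by (auto simp: diagram_def)
    next
      case False
      \<comment> \<open>Multipartitions are 0 at all other indices, row 0 included;
        \<open>sub_shape\<close> gives 0 there as the size of an empty set.\<close>
      have "lam l' r' = 0"
        using False assms(1)
        by (cases "l' \<in> {1..ell}"; cases r') (auto simp: multipartitions_def is_partition_def)
      then show ?thesis using False by (auto simp: diagram_def)
    qed
    finally show "sub_shape ell lam (n - 1) t l' r' = (if l' = l \<and> r' = r then lam l r - 1 else lam l' r')"
      by (simp add: sub_shape_def)
  qed
qed

text \<open>Serves to split the product over \<open>s\<close> by the boundaries \<open>A s\<close>,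
  which increase weakly with \<open>s\<close>.\<close>

lemma filter_le_Suc_sorted:
  "sorted (map f xs) \<Longrightarrow> filter (\<lambda>s. f s \<le> Suc i) xs = filter (\<lambda>s. f s \<le> i) xs @ filter (\<lambda>s. f s = Suc i) xs"
  for f :: "'c \<Rightarrow> nat"
proof (induction xs)
  case (Cons x xs)
  then have IH: "filter (\<lambda>s. f s \<le> Suc i) xs = filter (\<lambda>s. f s \<le> i) xs @ filter (\<lambda>s. f s = Suc i) xs"
    by simp
  show ?case
  proof (cases "f x \<le> i")
    case False
    then have "filter (\<lambda>s. f s \<le> i) xs = []" using Cons.prems by (auto simp: filter_empty_conv)
    then show ?thesis using IH False by auto
  qed (use IH in auto)
qed simp

text \<open>No row straddles the cut between \<open>a\<close> and \<open>a + 1\<close>.\<close>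

definition row_separated :: "(nat \<Rightarrow> 'c) \<Rightarrow> nat \<Rightarrow> nat \<Rightarrow> bool" where
  "row_separated rho n a \<longleftrightarrow> (\<forall>y z. 1 \<le> y \<and> y \<le> a \<and> a < z \<and> z \<le> n \<longrightarrow> rho y \<noteq> rho z)"

definition drop_entry :: "(nat \<Rightarrow> 'c) \<Rightarrow> nat \<Rightarrow> nat \<Rightarrow> 'c" where
  "drop_entry rho a m = rho (if m < a then m else Suc m)"

context hecke_gens
begin

sublocale braid_gens T k
  by standard (rule T_comm, assumption+, rule T_braid, assumption+)

lemma Tprod_sub: "set js \<subseteq> {..<m} \<Longrightarrow> Tprod js \<in> sub m"
  by (rule sub_prod_list) (auto intro: sub_gen)

lemma commute_prod_list:
  "(\<And>y. y \<in> set ys \<Longrightarrow> x * y = y * x) \<Longrightarrow> x * prod_list ys = prod_list ys * x" for x :: 'b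
proof (induction ys)
  case (Cons y ys)
  then have c: "x * y = y * x" by simp
  show ?case using Cons by (simp add: mult.assoc commute_left[OF c])
qed simp

lemma prod_list_commute: "(\<And>y. y \<in> set ys \<Longrightarrow> y * x = x * y) \<Longrightarrow> prod_list ys * x = x * prod_list ys" for x :: 'b
  by (rule commute_prod_list[symmetric]) simp

subsection \<open>Products of Jucys--Murphy elements\<close>

definition Lfac :: "nat \<Rightarrow> nat \<Rightarrow> 'b" where "Lfac s j = L j - S (Q s)"

definition Uf :: "nat \<Rightarrow> nat \<Rightarrow> 'b" where "Uf m s = prod_list (map (Lfac s) [1..<Suc m])"

lemma Uf_Suc: "Uf (Suc m) s = Uf m s * Lfac s (Suc m)"
  by (simp add: Uf_def)

lemma Uf_sub: "m \<le> i \<Longrightarrow> Uf m s \<in> sub i"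
  unfolding Uf_def Lfac_def by (rule sub_prod_list) (auto intro!: sub_diff sub_L sub_S)

lemma T_comm_Lfac: "1 \<le> i \<Longrightarrow> i < k \<Longrightarrow> 1 \<le> j \<Longrightarrow> j \<le> k \<Longrightarrow> i \<noteq> j \<Longrightarrow> Suc i \<noteq> j \<Longrightarrow> T i * Lfac s j = Lfac s j * T i"
  using T_comm_L[of i j] S_central[of "Q s" "T i"] by (simp add: Lfac_def left_diff_distrib right_diff_distrib)

text \<open>The product is symmetric in \<open>L 1, ..., L m\<close>. Only \<open>T m\<close> mixes
  an element inside this range with one outside.\<close>

lemma T_comm_Uf:
  assumes "1 \<le> i" "i < k" "m \<le> k" "i \<noteq> m"
  shows "T i * Uf m s = Uf m s * T i"
proof -
  have low: "T i * Uf m s = Uf m s * T i" if "m < i" for m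
    unfolding Uf_def using that assms by (intro commute_prod_list) (auto intro: T_comm_Lfac)
  have high: "T i * Uf m s = Uf m s * T i" if "Suc i \<le> m" "m \<le> k" for m
    using that
  proof (induction m rule: dec_induct)
    case base
    obtain j where j: "i = Suc j" using assms(1) by (cases i) auto
    have "Uf (Suc i) s = Uf j s * (Lfac s i * Lfac s (Suc i))"
      by (simp add: Uf_Suc j mult.assoc)
    moreover have c: "T i * Uf j s = Uf j s * T i" using low[of j] j by simp
    ultimately show ?case
      using T_comm_L_pair[OF assms(1,2), of "Q s"]
      by (simp add: commute_left[OF c] mult.assoc Lfac_def)
  next
    case (step m)
    have "T i * Lfac s (Suc m) = Lfac s (Suc m) * T i"
      using step assms by (intro T_comm_Lfac) auto
    moreover have c: "T i * Uf m s = Uf m s * T i" using step by simp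
    ultimately show ?case by (simp add: Uf_Suc commute_left[OF c] mult.assoc)
  qed
  show ?thesis
    using low[of m] high[of m] assms by (cases "m < i") auto
qed

lemma Tprod_comm_Uf:
  assumes "m \<le> k" "set js \<subseteq> {1..<k}" "m \<notin> set js"
  shows "Tprod js * Uf m s = Uf m s * Tprod js"
  using assms by (intro prod_list_commute) (auto intro!: T_comm_Uf)

text \<open>In \<open>Uf (Suc i) s = Uf i s * Lfac s (Suc i)\<close> the first factor lies in the
  smaller algebra, and the second gives \<open>- Q s\<close> at the cost of one degree.\<close>

lemma desc_mult_Uf:
  assumes "i < k" "desc i d z c"
  shows "desc i (d + length ss) (z * prod_list (map (Uf (Suc i)) ss))
    (c * prod_list (map (\<lambda>s. S (- Q s) * Uf i s) ss))"
  using assms(2)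
proof (induction ss arbitrary: d z c)
  case (Cons s ss)
  have "desc i d (z * Uf i s) (c * Uf i s)"
    using assms(1) Cons.prems by (intro desc_right Uf_sub) auto
  from desc_mult_L[OF assms(1) this, of "Q s"]
  have "desc i (Suc d) (z * Uf (Suc i) s) (c * (S (- Q s) * Uf i s))"
    by (simp add: Uf_Suc Lfac_def mult.assoc S_uminus S_left_commute[of c])
  from Cons.IH[OF this] show ?case by (simp add: mult.assoc)
qed simp

context
  fixes A :: "nat \<Rightarrow> nat"
  assumes A_sorted: "sorted (map A [2..<Suc ell])"
begin

definition u_upto :: "nat \<Rightarrow> 'b" where
  "u_upto i = prod_list (map (\<lambda>s. Uf (A s) s) (filter (\<lambda>s. A s \<le> i) [2..<Suc ell]))"

text \<open>What is left of \<open>u_upto i\<close> after the descent: for each boundary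
  \<open>A s >= m\<close> the last factor \<open>L (A s) - S (Q s)\<close> has become
  \<open>S (- Q s)\<close>.\<close>

definition v_upto :: "nat \<Rightarrow> nat \<Rightarrow> 'b" where
  "v_upto m i = prod_list (map (\<lambda>s. if A s < m then Uf (A s) s else S (- Q s) * Uf (A s - 1) s)
     (filter (\<lambda>s. A s \<le> i) [2..<Suc ell]))"

lemma u_upto_sub: "u_upto i \<in> sub i"
  unfolding u_upto_def by (rule sub_prod_list) (auto intro: Uf_sub)

lemma u_upto_Suc:
  "u_upto (Suc i) = u_upto i * prod_list (map (Uf (Suc i)) (filter (\<lambda>s. A s = Suc i) [2..<Suc ell]))"
proof -
  have eq: "map (\<lambda>s. Uf (A s) s) (filter (\<lambda>s. A s = Suc i) [2..<Suc ell])
      = map (Uf (Suc i)) (filter (\<lambda>s. A s = Suc i) [2..<Suc ell])"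
    by (rule map_cong) auto
  show ?thesis
    unfolding u_upto_def filter_le_Suc_sorted[OF A_sorted] map_append prod_list.append eq ..
qed

lemma v_upto_Suc:
  assumes "m \<le> Suc i"
  shows "v_upto m (Suc i) = v_upto m i
    * prod_list (map (\<lambda>s. S (- Q s) * Uf i s) (filter (\<lambda>s. A s = Suc i) [2..<Suc ell]))"
proof -
  have eq: "map (\<lambda>s. if A s < m then Uf (A s) s else S (- Q s) * Uf (A s - 1) s) (filter (\<lambda>s. A s = Suc i) [2..<Suc ell])
      = map (\<lambda>s. S (- Q s) * Uf i s) (filter (\<lambda>s. A s = Suc i) [2..<Suc ell])"
    using assms by (intro map_cong) auto
  show ?thesis
    unfolding v_upto_def filter_le_Suc_sorted[OF A_sorted] map_append prod_list.append eq ..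
qed

text \<open>
  The factors \<open>L\<^sub>j - Q\<^sub>s\<close> with \<open>j \<le> A s = i + 1\<close> form a product commuting with \<open>T\<^sub>1, \<dots>, T\<^sub>i\<close>; hence they can be
  postponed until the conjugation by \<open>T\<^sub>i\<close>, where only \<open>L\<^sub>i\<^sub>+\<^sub>1 - Q\<^sub>s\<close> is not in the smaller algebra.
\<close>

lemma desc_chain:
  assumes ab: "1 \<le> a" "1 \<le> b" "a \<le> Suc j" "b \<le> Suc j"
    and base: "desc j 0 (Tprod (rev [b..<Suc j]) * y * u_upto j * Tprod [a..<Suc j]) (c * v_upto (Suc j) j)"
    and i: "j \<le> i" "i < k"
  shows "desc i (length (filter (\<lambda>s. A s \<le> Suc i) [2..<Suc ell]))
    (Tprod (rev [b..<Suc i]) * y * u_upto (Suc i) * Tprod [a..<Suc i])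
    (S (q ^ (i - j)) * (c * v_upto (Suc j) (Suc i)))"
  using i
proof (induction i rule: dec_induct)
  case base
  let ?ss = "filter (\<lambda>s. A s = Suc j) [2..<Suc ell]"
  let ?E = "prod_list (map (Uf (Suc j)) ?ss)"
  \<comment> \<open>The letters of the word are at most \<open>j\<close>, and
    \<open>Uf (Suc j) s\<close> fails to commute only with \<open>T (Suc j)\<close>.\<close>
  have "Tprod [a..<Suc j] * ?E = ?E * Tprod [a..<Suc j]"
    using base ab by (intro commute_prod_list) (auto intro!: Tprod_comm_Uf simp del: upt_Suc)
  then have z: "Tprod (rev [b..<Suc j]) * y * u_upto (Suc j) * Tprod [a..<Suc j]
      = Tprod (rev [b..<Suc j]) * y * u_upto j * Tprod [a..<Suc j] * ?E"
    by (simp add: u_upto_Suc mult.assoc del: upt_Suc)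
  have "desc j (length ?ss) (Tprod (rev [b..<Suc j]) * y * u_upto (Suc j) * Tprod [a..<Suc j])
      (c * v_upto (Suc j) (Suc j))"
    using desc_mult_Uf[OF base \<open>desc j 0 _ _\<close>, of ?ss]
    unfolding z by (simp add: v_upto_Suc mult.assoc del: upt_Suc)
  then have "desc j (length (filter (\<lambda>s. A s \<le> Suc j) [2..<Suc ell]))
     (Tprod (rev [b..<Suc j]) * y * u_upto (Suc j) * Tprod [a..<Suc j]) (c * v_upto (Suc j) (Suc j))"
    by (rule desc_mono) (simp add: filter_le_Suc_sorted[OF A_sorted] del: upt_Suc)
  then show ?case by (simp add: S_one del: upt_Suc)
next
  case (step i)
  let ?ss = "filter (\<lambda>s. A s = Suc (Suc i)) [2..<Suc ell]"
  let ?E = "prod_list (map (Uf (Suc (Suc i))) ?ss)" and ?t = "T (Suc i)"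
  let ?z = "Tprod (rev [b..<Suc i]) * y * u_upto (Suc i) * Tprod [a..<Suc i]"
  have up: "[a..<Suc (Suc i)] = [a..<Suc i] @ [Suc i]" "rev [b..<Suc (Suc i)] = Suc i # rev [b..<Suc i]"
    using ab step by auto
  have "Tprod [a..<Suc (Suc i)] * ?E = ?E * Tprod [a..<Suc (Suc i)]"
    using step ab by (intro commute_prod_list) (auto intro!: Tprod_comm_Uf simp del: upt_Suc)
  then have z: "Tprod (rev [b..<Suc (Suc i)]) * y * u_upto (Suc (Suc i)) * Tprod [a..<Suc (Suc i)] = ?t * ?z * ?t * ?E"
    unfolding u_upto_Suc[of "Suc i"] mult.assoc by (simp add: up mult.assoc del: upt_Suc)
  have "desc (Suc i) (length (filter (\<lambda>s. A s \<le> Suc i) [2..<Suc ell])) (?t * ?z * ?t)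
      (S q * (S (q ^ (i - j)) * (c * v_upto (Suc j) (Suc i))))"
    using step by (intro desc_T_conj) auto
  from desc_mult_Uf[OF step.prems this, of ?ss]
  show ?case
    using step.hyps unfolding z filter_le_Suc_sorted[OF A_sorted, of "Suc i"]
    by (simp add: v_upto_Suc[of "Suc j" "Suc i"] mult.assoc S_mult[symmetric] Suc_diff_le del: upt_Suc flip: mult.assoc[of "S q"])
qed

end

subsection \<open>Row factors\<close>

lemma row_factor_sub: "row_factor T rho m \<in> sub m"
  unfolding row_factor_def by (intro sub_sum Tprod_sub) auto

lemma row_factor_commute:
  assumes "\<And>j. 1 \<le> j \<Longrightarrow> j \<le> m \<Longrightarrow> rho j = rho m \<Longrightarrow> Tprod [j..<m] * x = x * Tprod [j..<m]"
  shows "row_factor T rho m * x = x * row_factor T rho m"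
  unfolding row_factor_def sum_distrib_left sum_distrib_right
  by (rule sum.cong[OF refl]) (use assms in auto)

lemma row_prod_sub: "set ms \<subseteq> {..m} \<Longrightarrow> prod_list (map (row_factor T rho) ms) \<in> sub m"
  by (rule sub_prod_list) (auto intro: sub_mono[OF row_factor_sub])

lemma Tprod_shift:
  assumes "1 \<le> a" "n \<le> k" "a < j" "m \<le> n"
  shows "Tprod [j..<m] * Tprod [a..<n] = Tprod [a..<n] * Tprod [j - 1..<m - 1]"
proof -
  have "Tprod is * Tprod [a..<n] = Tprod [a..<n] * Tprod (map (\<lambda>i. i - 1) is)" if "set is \<subseteq> {a<..<n}" for "is"
    using that
  proof (induction "is")
    case (Cons i "is")
    then have "T i * Tprod [a..<n] = Tprod [a..<n] * T (i - 1)"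
      using assms by (intro T_shift) auto
    then show ?case using Cons by (simp add: mult.assoc) (simp flip: mult.assoc)
  qed simp
  moreover have "map (\<lambda>i. i - 1) [j..<m] = [j - 1..<m - 1]"
    using assms by (intro nth_equalityI) auto
  moreover have "set [j..<m] \<subseteq> {a<..<n}" using assms by auto
  ultimately show ?thesis by metis
qed

lemma Tprod_shift_rev:
  assumes "1 \<le> a" "n \<le> k" "a < j" "m \<le> n"
  shows "Tprod (rev [a..<n]) * Tprod [j..<m] = Tprod [j - 1..<m - 1] * Tprod (rev [a..<n])"
proof -
  have "Tprod (rev [a..<n]) * Tprod is = Tprod (map (\<lambda>i. i - 1) is) * Tprod (rev [a..<n])" if "set is \<subseteq> {a<..<n}" for "is"
    using that
  proof (induction "is")
    case (Cons i "is")
    then have "Tprod (rev [a..<n]) * T i = T (i - 1) * Tprod (rev [a..<n])"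
      using assms by (intro T_shift_rev) auto
    then show ?case using Cons by (simp flip: mult.assoc) (simp add: mult.assoc)
  qed simp
  moreover have "map (\<lambda>i. i - 1) [j..<m] = [j - 1..<m - 1]"
    using assms by (intro nth_equalityI) auto
  moreover have "set [j..<m] \<subseteq> {a<..<n}" using assms by auto
  ultimately show ?thesis by metis
qed

text \<open>For \<open>m > a\<close> the part of the row up to \<open>m\<close> lies beyond
  \<open>a\<close>, so dropping \<open>a\<close> lowers all its indices by one. This is the shift
  undergone in passing the word \<open>[a..<n]\<close>.\<close>

lemma row_factor_drop_entry:
  assumes sep: "row_separated rho n a" and m: "1 \<le> a" "a < m" "m \<le> n"
  shows "row_factor T (drop_entry rho a) (m - 1) = (\<Sum>j | j \<in> {1..m} \<and> rho j = rho m. Tprod [j - 1..<m - 1])"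
    and "\<And>j. j \<in> {1..m} \<Longrightarrow> rho j = rho m \<Longrightarrow> a < j"
proof -
  have sep': "rho j \<noteq> rho m" if "1 \<le> j" "j \<le> a" for j
    using sep that m unfolding row_separated_def by blast
  then show after: "a < j" if "j \<in> {1..m}" "rho j = rho m" for j
    using that by (metis atLeastAtMost_iff not_less)
  show "row_factor T (drop_entry rho a) (m - 1) = (\<Sum>j | j \<in> {1..m} \<and> rho j = rho m. Tprod [j - 1..<m - 1])"
    unfolding row_factor_def
  proof (rule sum.reindex_bij_witness[of _ "\<lambda>j. j - 1" Suc])
    fix j assume j: "j \<in> {j \<in> {1..m - 1}. drop_entry rho a j = drop_entry rho a (m - 1)}"
    then have "\<not> j < a" using sep'[of j] m by (auto simp: drop_entry_def split: if_splits)
    then show "Suc j \<in> {j \<in> {1..m}. rho j = rho m}"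
      using j m by (auto simp: drop_entry_def)
  next
    fix j assume "j \<in> {j \<in> {1..m}. rho j = rho m}"
    then show "j - 1 \<in> {j \<in> {1..m - 1}. drop_entry rho a j = drop_entry rho a (m - 1)}" "Suc (j - 1) = j"
      using after[of j] m by (auto simp: drop_entry_def)
  qed auto
qed

lemma row_factor_shift:
  assumes "row_separated rho n a" "1 \<le> a" "a < m" "m \<le> n" "n \<le> k"
  shows "row_factor T rho m * Tprod [a..<n] = Tprod [a..<n] * row_factor T (drop_entry rho a) (m - 1)"
  unfolding row_factor_drop_entry(1)[OF assms(1-4)]
  unfolding row_factor_def sum_distrib_left sum_distrib_right
  using assms row_factor_drop_entry(2)[OF assms(1-4)] by (intro sum.cong refl Tprod_shift) auto

lemma row_factor_shift_rev:
  assumes "row_separated rho n a" "1 \<le> a" "a < m" "m \<le> n" "n \<le> k"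
  shows "Tprod (rev [a..<n]) * row_factor T rho m = row_factor T (drop_entry rho a) (m - 1) * Tprod (rev [a..<n])"
  unfolding row_factor_drop_entry(1)[OF assms(1-4)]
  unfolding row_factor_def sum_distrib_left sum_distrib_right
  using assms row_factor_drop_entry(2)[OF assms(1-4)] by (intro sum.cong refl Tprod_shift_rev) auto

lemma row_prod_shift:
  assumes "row_separated rho n a" "1 \<le> a" "n \<le> k" "set ms \<subseteq> {a<..n}"
  shows "prod_list (map (row_factor T rho) ms) * Tprod [a..<n]
    = Tprod [a..<n] * prod_list (map (\<lambda>m. row_factor T (drop_entry rho a) (m - 1)) ms)"
  using assms(4)
proof (induction ms)
  case (Cons m ms)
  then have "row_factor T rho m * Tprod [a..<n] = Tprod [a..<n] * row_factor T (drop_entry rho a) (m - 1)"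
    using assms by (intro row_factor_shift) auto
  then show ?case using Cons by (simp add: mult.assoc) (simp flip: mult.assoc)
qed simp

lemma row_prod_shift_rev:
  assumes "row_separated rho n a" "1 \<le> a" "n \<le> k" "set ms \<subseteq> {a<..n}"
  shows "Tprod (rev [a..<n]) * prod_list (map (row_factor T rho) ms)
    = prod_list (map (\<lambda>m. row_factor T (drop_entry rho a) (m - 1)) ms) * Tprod (rev [a..<n])"
  using assms(4)
proof (induction ms)
  case (Cons m ms)
  then have "Tprod (rev [a..<n]) * row_factor T rho m = row_factor T (drop_entry rho a) (m - 1) * Tprod (rev [a..<n])"
    using assms by (intro row_factor_shift_rev) auto
  then show ?case using Cons by (simp flip: mult.assoc) (simp add: mult.assoc)
qed simp

end

section \<open>Descending the products of \<open>x\<close> and \<open>u\<close>\<close>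

context hecke_gens
begin

definition x_prod :: "(nat \<Rightarrow> 'c) \<Rightarrow> nat \<Rightarrow> 'b" where
  "x_prod rho n = prod_list (map (row_factor T rho) (rev [1..<Suc n]))"

definition u_prod :: "(nat \<Rightarrow> nat) \<Rightarrow> 'b" where
  "u_prod A = prod_list (map (\<lambda>s. Uf (A s) s) [2..<Suc ell])"

lemma x_prod_sub: "n \<le> m \<Longrightarrow> x_prod rho n \<in> sub m"
  unfolding x_prod_def by (rule row_prod_sub) auto

lemma x_prod_split:
  "a \<le> n \<Longrightarrow> x_prod rho n = prod_list (map (row_factor T rho) (rev [Suc a..<Suc n])) * x_prod rho a"
proof -
  assume "a \<le> n"
  then have "[1..<Suc n] = [1..<Suc a] @ [Suc a..<Suc n]"
    using upt_add_eq_append[of 1 "Suc a" "n - a"] by simp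
  then show ?thesis by (simp add: x_prod_def del: upt_Suc)
qed

text \<open>Every representative other than the empty word ends in \<open>T j\<close> and thus lies
  in the kernel.\<close>

lemma desc_row_factor:
  assumes "Suc j < Suc k" shows "desc j 0 (row_factor T rho (Suc j)) 1"
proof -
  let ?I = "{i \<in> {1..Suc j}. rho i = rho (Suc j)}"
  have "row_factor T rho (Suc j) = Tprod [Suc j..<Suc j] + (\<Sum>i\<in>?I - {Suc j}. Tprod [i..<Suc j])"
    unfolding row_factor_def by (rule sum.remove) auto
  then have "row_factor T rho (Suc j) - 1 = (\<Sum>i\<in>?I - {Suc j}. Tprod [i..<Suc j])"
    by (simp del: upt_Suc)
  also have "\<dots> \<in> AP j 0"
  proof (rule AP_sum)
    fix i assume i: "i \<in> ?I - {Suc j}"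
    then have "Tprod [i..<Suc j] = Tprod [i..<j] * T j * 1" by auto
    also have "\<dots> \<in> AP j 0"
      using i by (intro AP_T' sub_one Tprod_sub) auto
    finally show "Tprod [i..<Suc j] \<in> AP j 0" .
  qed
  finally show ?thesis by (simp add: desc_def sub_one)
qed

context
  fixes A :: "nat \<Rightarrow> nat" and rho :: "nat \<Rightarrow> 'c"
  assumes A_sorted: "sorted (map A [2..<Suc ell])"
    and A_le: "\<And>s. s \<in> {2..ell} \<Longrightarrow> A s \<le> k"
    and A_sep: "\<And>s. s \<in> {2..ell} \<Longrightarrow> row_separated rho k (A s)"
begin

lemma u_prod_eq: "u_prod A = u_upto A k"
proof -
  have "filter (\<lambda>s. A s \<le> k) [2..<Suc ell] = [2..<Suc ell]"
    using A_le by (intro filter_True) auto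
  then show ?thesis by (simp add: u_prod_def u_upto_def[OF A_sorted] del: upt_Suc)
qed

text \<open>A row does not straddle a boundary \<open>A s\<close>, so its words avoid the letter
  \<open>A s\<close>, the only one that obstructs commutation with
  \<open>Uf (A s) s\<close>.\<close>

lemma row_factor_comm_u_prod:
  assumes "1 \<le> m" "m \<le> k"
  shows "row_factor T rho m * u_prod A = u_prod A * row_factor T rho m"
proof (rule row_factor_commute)
  fix j assume j: "1 \<le> j" "j \<le> m" "rho j = rho m"
  show "Tprod [j..<m] * u_prod A = u_prod A * Tprod [j..<m]"
    unfolding u_prod_def
  proof (rule commute_prod_list)
    fix y assume "y \<in> set (map (\<lambda>s. Uf (A s) s) [2..<Suc ell])"
    then obtain s where s: "y = Uf (A s) s" "s \<in> {2..ell}" by (auto simp del: upt_Suc)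
    have "A s \<notin> set [j..<m]"
      using A_sep[OF s(2)] j assms unfolding row_separated_def by auto
    then show "Tprod [j..<m] * y = y * Tprod [j..<m]"
      unfolding s(1) using A_le[OF s(2)] j assms by (intro Tprod_comm_Uf) auto
  qed
qed

lemma row_prod_comm_u_prod:
  "set ms \<subseteq> {1..k} \<Longrightarrow> prod_list (map (row_factor T rho) ms) * u_prod A = u_prod A * prod_list (map (row_factor T rho) ms)"
  by (rule prod_list_commute) (clarsimp, rule row_factor_comm_u_prod, auto)

lemma length_filter_A: "length (filter P [2..<Suc ell]) \<le> ell - 1"
  using length_filter_le[of P "[2..<Suc ell]"] by (simp del: upt_Suc)

text \<open>The row factors beyond \<open>a\<close> leave to the left through the word, with indices
  lowered by one. The factor of \<open>a\<close> descends to 1, and the earlier ones lie in the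
  smaller algebra; the rest is \<open>desc_chain\<close>.\<close>

lemma desc_same_row:
  assumes a: "1 \<le> a" "a \<le> k" and sep: "row_separated rho k a"
  shows "desc (k - 1) (ell - 1) (Tprod (rev [a..<k]) * (x_prod rho k * u_prod A) * Tprod [a..<k])
    (S (q ^ (k - a) * (\<Prod>s=2..ell. if A s < a then 1 else - Q s))
      * (x_prod (drop_entry rho a) (k - 1) * u_prod (\<lambda>s. if A s < a then A s else A s - 1)))"
proof -
  obtain j where j: "a = Suc j" using a by (cases a) auto
  have k: "Suc (k - 1) = k" using a by simp
  let ?R = "row_factor T rho" and ?R' = "row_factor T (drop_entry rho a)"
  let ?X = "prod_list (map ?R (rev [Suc a..<Suc k]))"
  let ?X' = "prod_list (map (\<lambda>m. ?R' (m - 1)) (rev [Suc a..<Suc k]))"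
  have X': "?X' \<in> sub (k - 1)"
    by (rule sub_prod_list) (auto intro!: sub_mono[OF row_factor_sub] simp del: upt_Suc)
  \<comment> \<open>The chain starts at \<open>j = a - 1\<close>, where both words are empty and
    only the row factor of \<open>a\<close> is outside \<open>sub j\<close>.\<close>
  have "desc j 0 (row_factor T rho a * (x_prod rho j * u_upto A j)) (1 * (x_prod rho j * u_upto A j))"
    unfolding j using a j by (intro desc_right desc_row_factor sub_mult x_prod_sub u_upto_sub[OF A_sorted]) auto
  moreover have "x_prod rho a = row_factor T rho a * x_prod rho j"
    unfolding j x_prod_def by simp
  \<comment> \<open>Boundaries up to \<open>j\<close> are below \<open>a\<close>, so none of their
    factors has been cut.\<close>
  moreover have v_u: "v_upto A (Suc j) j = u_upto A j"
    unfolding v_upto_def[OF A_sorted] u_upto_def[OF A_sorted] by (rule arg_cong[of _ _ prod_list], rule map_cong) auto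
  ultimately have "desc j 0 (Tprod (rev [a..<Suc j]) * x_prod rho a * u_upto A j * Tprod [a..<Suc j])
      (x_prod rho j * v_upto A (Suc j) j)"
    by (simp add: j mult.assoc)
  then have "desc (k - 1) (length (filter (\<lambda>s. A s \<le> Suc (k - 1)) [2..<Suc ell]))
      (Tprod (rev [a..<Suc (k - 1)]) * x_prod rho a * u_upto A (Suc (k - 1)) * Tprod [a..<Suc (k - 1)])
      (S (q ^ (k - 1 - j)) * (x_prod rho j * v_upto A (Suc j) (Suc (k - 1))))"
    using a j by (intro desc_chain[OF A_sorted]) auto
  moreover have "k - 1 - j = k - a" using j by simp
  ultimately have "desc (k - 1) (ell - 1) (Tprod (rev [a..<k]) * x_prod rho a * u_prod A * Tprod [a..<k])
     (S (q ^ (k - a)) * (x_prod rho j * v_upto A a k))"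
    unfolding k u_prod_eq j[symmetric] by (intro desc_mono[OF _ length_filter_A]) (simp only:)
  from desc_left[OF this X']
  have "desc (k - 1) (ell - 1) (?X' * (Tprod (rev [a..<k]) * x_prod rho a * u_prod A * Tprod [a..<k]))
     (?X' * (S (q ^ (k - a)) * (x_prod rho j * v_upto A a k)))" .
  moreover have "?X' * (Tprod (rev [a..<k]) * x_prod rho a * u_prod A * Tprod [a..<k])
      = Tprod (rev [a..<k]) * (x_prod rho k * u_prod A) * Tprod [a..<k]"
  proof -
    have "Tprod (rev [a..<k]) * ?X = ?X' * Tprod (rev [a..<k])"
      by (rule row_prod_shift_rev[OF sep a(1) order_refl]) auto
    then show ?thesis
      unfolding x_prod_split[OF a(2)] by (simp add: mult.assoc[symmetric])
  qed
  moreover have "v_upto A a k = S (\<Prod>s=2..ell. if A s < a then 1 else - Q s) * u_prod (\<lambda>s. if A s < a then A s else A s - 1)"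
  proof -
    have f: "filter (\<lambda>s. A s \<le> k) [2..<Suc ell] = [2..<Suc ell]"
      using A_le by (intro filter_True) auto
    have "prod_list (map (\<lambda>s. if A s < a then Uf (A s) s else S (- Q s) * Uf (A s - 1) s) ss)
        = S (prod_list (map (\<lambda>s. if A s < a then 1 else - Q s) ss))
          * prod_list (map (\<lambda>s. Uf (if A s < a then A s else A s - 1) s) ss)" for ss
    proof (induction ss)
      case (Cons s ss)
      then show ?case
        using S_central[of "prod_list (map (\<lambda>s. if A s < a then 1 else - Q s) ss)"]
        by (simp add: S_mult mult.assoc S_one)
    qed (simp add: S_one)
    moreover have "prod_list (map h [2..<Suc ell]) = (\<Prod>s=2..ell. h s)" for h :: "nat \<Rightarrow> 'a"
      by (simp add: prod.distinct_set_conv_list[symmetric] atLeastLessThanSuc_atLeastAtMost del: upt_Suc)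
    ultimately show ?thesis unfolding v_upto_def[OF A_sorted] f u_prod_def by simp
  qed
  moreover have "x_prod (drop_entry rho a) (k - 1) = ?X' * x_prod rho j"
  proof -
    have "x_prod (drop_entry rho a) j = x_prod rho j"
    proof -
      have "?R' m = ?R m" if "m \<le> j" for m
        unfolding row_factor_def using that j
        by (intro sum.cong) (auto simp: drop_entry_def)
      then show ?thesis unfolding x_prod_def by (intro arg_cong[of _ _ prod_list] map_cong) auto
    qed
    moreover have "map (\<lambda>m. ?R' (m - 1)) (rev [Suc a..<Suc k]) = map ?R' (rev [a..<k])"
    proof -
      have "[Suc a..<Suc k] = map Suc [a..<k]" by (simp only: map_Suc_upt)
      then show ?thesis by (simp add: rev_map comp_def del: upt_Suc)
    qed
    moreover have "x_prod (drop_entry rho a) (k - 1) = prod_list (map ?R' (rev [a..<k])) * x_prod (drop_entry rho a) j"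
      using x_prod_split[of j "k - 1" "drop_entry rho a"] a j unfolding k by simp
    ultimately show ?thesis by simp
  qed
  moreover have "X * (S p * (x * (S h * u))) = S (p * h) * (X * x * u)" for X x u p h
    by (simp add: S_mult mult.assoc S_left_commute[of X] S_left_commute[of x])
  ultimately show ?thesis by (simp only:)
qed

text \<open>All of \<open>x\<close> is first moved into the smaller algebra. With \<open>c\<close>
  the smaller of \<open>a\<close> and \<open>b\<close>, the row factors beyond \<open>c\<close>
  leave on the side of the word starting at \<open>c\<close>, with shifted indices; those up to
  \<open>c\<close> commute with the other word and leave on its side.\<close>

lemma desc_other_row:
  assumes a: "1 \<le> a" "a \<le> k" and b: "1 \<le> b" "b \<le> k" and "a \<noteq> b"
    and sep: "row_separated rho k a" "row_separated rho k b"
  shows "desc (k - 1) (ell - 1) (Tprod (rev [b..<k]) * (x_prod rho k * u_prod A) * Tprod [a..<k]) 0"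
proof -
  let ?R = "row_factor T rho"
  let ?X = "\<lambda>a. prod_list (map ?R (rev [Suc a..<Suc k]))"
  let ?X' = "\<lambda>a. prod_list (map (\<lambda>m. row_factor T (drop_entry rho a) (m - 1)) (rev [Suc a..<Suc k]))"
  have k: "Suc (k - 1) = k" using a by simp
  have X': "?X' a \<in> sub (k - 1)" for a
    by (rule sub_prod_list) (auto intro!: sub_mono[OF row_factor_sub] simp del: upt_Suc)
  have chain: "desc (k - 1) (ell - 1) (Tprod (rev [b..<k]) * u_prod A * Tprod [a..<k]) 0"
    if "Suc j = max a b" "desc j 0 (Tprod (rev [b..<Suc j]) * u_upto A j * Tprod [a..<Suc j]) 0" for j
  proof -
    \<comment> \<open>With \<open>y = 1\<close> and \<open>c = 0\<close> the chain merely carries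
      membership in the kernel upwards.\<close>
    have "desc j 0 (Tprod (rev [b..<Suc j]) * 1 * u_upto A j * Tprod [a..<Suc j]) (0 * v_upto A (Suc j) j)"
      using that(2) by simp
    moreover have "a \<le> Suc j" "b \<le> Suc j" "j \<le> k - 1" "k - 1 < k"
      using that(1) a b by auto
    ultimately have "desc (k - 1) (length (filter (\<lambda>s. A s \<le> Suc (k - 1)) [2..<Suc ell]))
        (Tprod (rev [b..<Suc (k - 1)]) * 1 * u_upto A (Suc (k - 1)) * Tprod [a..<Suc (k - 1)])
        (S (q ^ (k - 1 - j)) * (0 * v_upto A (Suc j) (Suc (k - 1))))"
      using a b by (intro desc_chain[OF A_sorted]) auto
    then show ?thesis
      unfolding k u_prod_eq by (intro desc_mono[OF _ length_filter_A]) (simp only: mult_zero_left mult_zero_right mult_1_right)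
  qed
  have comm: "x * Tprod [i..<j] = Tprod [i..<j] * x" "x * Tprod (rev [i..<j]) = Tprod (rev [i..<j]) * x"
    if "x \<in> sub m" "m < i" "j \<le> k" for x m i j
    using that by (auto intro!: commute_prod_list sub_comm_T)
  show ?thesis
  proof (cases "a < b")
    case True
    obtain j where j: "b = Suc j" using b by (cases b) auto
    \<comment> \<open>At \<open>j = b - 1\<close> the left word is empty, while the right one ends
      in an unpaired \<open>T j\<close>.\<close>
    have "u_upto A j * Tprod [a..<Suc j] = (u_upto A j * Tprod [a..<j]) * T j * 1"
      using True j by (simp add: mult.assoc)
    also have "\<dots> \<in> AP j 0"
      using True j a by (intro AP_T' sub_mult sub_one u_upto_sub[OF A_sorted] Tprod_sub) auto
    finally have "desc j 0 (Tprod (rev [b..<Suc j]) * u_upto A j * Tprod [a..<Suc j]) 0"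
      by (simp add: desc_def sub_zero j del: upt_Suc)
    then have "desc (k - 1) (ell - 1) (Tprod (rev [b..<k]) * u_prod A * Tprod [a..<k]) 0"
      using True j by (intro chain[of j]) (simp_all del: upt_Suc)
    then have "desc (k - 1) (ell - 1) (x_prod rho a * (Tprod (rev [b..<k]) * u_prod A * Tprod [a..<k]) * ?X' a) (x_prod rho a * 0 * ?X' a)"
      using True b by (intro desc_right desc_left X' x_prod_sub) auto
    moreover have "x_prod rho a * (Tprod (rev [b..<k]) * u_prod A * Tprod [a..<k]) * ?X' a
        = Tprod (rev [b..<k]) * (x_prod rho k * u_prod A) * Tprod [a..<k]"
    proof -
      have x: "x_prod rho a \<in> sub a" by (simp add: x_prod_sub)
      have "x_prod rho a * ?R m = ?R m * x_prod rho a" if "a < m" "m \<le> k" for m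
      proof (rule row_factor_commute[symmetric])
        fix i assume "1 \<le> i" "i \<le> m" "rho i = rho m"
        then have "a < i"
          using sep(1) that unfolding row_separated_def by (metis not_less)
        then show "Tprod [i..<m] * x_prod rho a = x_prod rho a * Tprod [i..<m]"
          using comm(1)[OF x] that by simp
      qed
      then have xX: "x_prod rho a * ?X a = ?X a * x_prod rho a"
        by (intro commute_prod_list) (auto simp del: upt_Suc)
      have Xu: "?X a * u_prod A = u_prod A * ?X a"
        by (rule row_prod_comm_u_prod) auto
      have XT: "?X a * Tprod [a..<k] = Tprod [a..<k] * ?X' a"
        by (rule row_prod_shift[OF sep(1) a(1) order_refl]) auto
      have xT: "x_prod rho a * Tprod (rev [b..<k]) = Tprod (rev [b..<k]) * x_prod rho a"
        using comm(2)[OF x True] by simp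
      have "x_prod rho a * (Tprod (rev [b..<k]) * u_prod A * Tprod [a..<k]) * ?X' a
          = (x_prod rho a * Tprod (rev [b..<k])) * u_prod A * (Tprod [a..<k] * ?X' a)"
        by (simp only: mult.assoc)
      also have "\<dots> = Tprod (rev [b..<k]) * (x_prod rho a * (u_prod A * ?X a)) * Tprod [a..<k]"
        unfolding xT XT[symmetric] by (simp only: mult.assoc)
      also have "x_prod rho a * (u_prod A * ?X a) = x_prod rho a * ?X a * u_prod A"
        unfolding Xu[symmetric] by (simp only: mult.assoc)
      finally show ?thesis
        unfolding xX x_prod_split[OF a(2)] .
    qed
    ultimately show ?thesis by simp
  next
    case False
    then have ba: "b < a" using \<open>a \<noteq> b\<close> by simp
    obtain j where j: "a = Suc j" using a by (cases a) auto
    have "Tprod (rev [b..<Suc j]) * u_upto A j = 1 * T j * (Tprod (rev [b..<j]) * u_upto A j)"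
      using ba j by (simp add: mult.assoc)
    also have "\<dots> \<in> AP j 0"
      using ba j b by (intro AP_T' sub_mult sub_one u_upto_sub[OF A_sorted] Tprod_sub) auto
    finally have "desc j 0 (Tprod (rev [b..<Suc j]) * u_upto A j * Tprod [a..<Suc j]) 0"
      by (simp add: desc_def sub_zero j del: upt_Suc)
    then have "desc (k - 1) (ell - 1) (Tprod (rev [b..<k]) * u_prod A * Tprod [a..<k]) 0"
      using ba j by (intro chain[of j]) (simp_all del: upt_Suc)
    then have "desc (k - 1) (ell - 1) (?X' b * (Tprod (rev [b..<k]) * u_prod A * Tprod [a..<k]) * x_prod rho b) (?X' b * 0 * x_prod rho b)"
      using ba a by (intro desc_right desc_left X' x_prod_sub) auto
    moreover have "?X' b * (Tprod (rev [b..<k]) * u_prod A * Tprod [a..<k]) * x_prod rho b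
        = Tprod (rev [b..<k]) * (x_prod rho k * u_prod A) * Tprod [a..<k]"
    proof -
      have x: "x_prod rho b \<in> sub b" by (simp add: x_prod_sub)
      have XT: "Tprod (rev [b..<k]) * ?X b = ?X' b * Tprod (rev [b..<k])"
        by (rule row_prod_shift_rev[OF sep(2) b(1) order_refl]) auto
      have xu: "x_prod rho b * u_prod A = u_prod A * x_prod rho b"
        unfolding x_prod_def using b by (intro row_prod_comm_u_prod) auto
      have xT: "x_prod rho b * Tprod [a..<k] = Tprod [a..<k] * x_prod rho b"
        using comm(1)[OF x ba] by simp
      have "?X' b * (Tprod (rev [b..<k]) * u_prod A * Tprod [a..<k]) * x_prod rho b
          = (?X' b * Tprod (rev [b..<k])) * u_prod A * (Tprod [a..<k] * x_prod rho b)"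
        by (simp only: mult.assoc)
      also have "\<dots> = Tprod (rev [b..<k]) * (?X b * (u_prod A * x_prod rho b)) * Tprod [a..<k]"
        unfolding xT[symmetric] XT[symmetric] by (simp only: mult.assoc)
      also have "?X b * (u_prod A * x_prod rho b) = ?X b * x_prod rho b * u_prod A"
        unfolding xu[symmetric] by (simp only: mult.assoc)
      finally show ?thesis
        unfolding x_prod_split[OF b(2)] .
    qed
    ultimately show ?thesis by simp
  qed
qed

end

end

subsection \<open>The anti-automorphism\<close>

interpretation lrev: free_action "\<lambda>c v. const c * v :: 'a::idom free" "\<lambda>i v. gen i * v"
proof
  fix a b :: 'a and u v :: "'a free" and i :: nat
  show "gen i * (const a * v) = const a * (gen i * v)"
    by (rule commute_left) (rule const_central[symmetric])
qed (simp_all add: const_add const_mult distrib_left distrib_right mult.assoc)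

text \<open>Left multiplication read as a right action places each new letter in front, so words
  come out reversed.\<close>

definition free_rev :: "'a::idom free \<Rightarrow> 'a free" where "free_rev x = lrev.act x 1"

lemma lrev_act: "lrev.act x v = free_rev x * v"
proof (induction x arbitrary: v rule: free_induct)
  case (const c)
  then show ?case by (simp add: free_rev_def)
next
  case (snoc x i)
  have free_rev_snoc: "free_rev (x * gen i) = gen i * free_rev x"
    by (simp add: free_rev_def lrev.act_mult_gen)
  show ?case
    by (simp add: snoc free_rev_snoc lrev.act_mult_gen mult.assoc)
next
  case (add x y)
  have "free_rev (x + y) = free_rev x + free_rev y" by (simp add: free_rev_def lrev.act_add_left)
  then show ?case by (simp add: add lrev.act_add_left distrib_right)
qed

lemma free_rev_add: "free_rev (x + y) = free_rev x + free_rev y"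
  by (simp add: free_rev_def lrev.act_add_left)

lemma free_rev_diff: "free_rev (x - y) = free_rev x - free_rev y"
  by (simp add: free_rev_def lrev.act_diff_left)

lemma free_rev_zero: "free_rev 0 = 0"
  by (simp add: free_rev_def)

lemma free_rev_const: "free_rev (const c) = const c"
  by (simp add: free_rev_def)

lemma free_rev_gen: "free_rev (gen i) = gen i"
  by (simp add: free_rev_def)

lemma free_rev_one: "free_rev 1 = 1"
  by (simp add: free_rev_def)

lemma free_rev_mult: "free_rev (x * y) = free_rev y * free_rev x"
proof -
  have "free_rev (x * y) = lrev.act y (lrev.act x 1)" by (simp add: free_rev_def lrev.act_mult)
  then show ?thesis by (simp add: lrev_act)
qed

lemma free_rev_prod_list: "free_rev (prod_list xs) = prod_list (map free_rev (rev xs))"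
  by (induction xs) (simp_all add: free_rev_one free_rev_mult)

lemma free_rev_rev: "free_rev (free_rev x) = x"
  by (induction x rule: free_induct) (simp_all add: free_rev_const free_rev_mult free_rev_gen free_rev_add)

lemma free_rev_carrier: "x \<in> free_carrier k \<Longrightarrow> free_rev x \<in> free_carrier k"
  by (induction rule: free_carrier_induct)
     (auto simp: free_rev_const free_rev_mult free_rev_gen free_rev_add intro!: free_carrier_mult free_carrier_gen)

subsection \<open>Murphy elements in the free algebra\<close>

abbreviation gens :: "nat list \<Rightarrow> 'a::idom free" where "gens is \<equiv> prod_list (map gen is)"

definition free_x :: "nat \<Rightarrow> nat \<Rightarrow> mpart \<Rightarrow> 'a::idom free" where
  "free_x ell k lam = (\<Sum>w\<in>young ell k lam. gens (nform k w))"

definition free_u :: "nat \<Rightarrow> 'a \<Rightarrow> (nat \<Rightarrow> 'a) \<Rightarrow> mpart \<Rightarrow> 'a::idom free" where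
  "free_u ell qi Q lam =
     prod_list (concat (map (\<lambda>s. map (\<lambda>j. free_L qi j - const (Q s)) [1..<Suc (frak_a lam s)]) [2..<Suc ell]))"

text \<open>Taking permutations instead of tableaux allows \<open>desc_nform\<close> to strip the
  cycles from them; \<open>rev\<close> is the effect of the anti-automorphism on a word.\<close>

definition free_murphy ::
  "nat \<Rightarrow> 'a \<Rightarrow> (nat \<Rightarrow> 'a) \<Rightarrow> nat \<Rightarrow> mpart \<Rightarrow> (nat \<Rightarrow> nat) \<Rightarrow> (nat \<Rightarrow> nat) \<Rightarrow> 'a::idom free" where
  "free_murphy ell qi Q k lam w v =
     gens (rev (nform k w)) * (free_x ell k lam * free_u ell qi Q lam) * gens (nform k v)"

lemma gens_carrier: "set is \<subseteq> {..<k} \<Longrightarrow> (gens is :: 'a::idom free) \<in> free_carrier k"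
  by (rule free_carrier_prod_list) (auto intro: free_carrier_gen)

lemma gens_nform_carrier: "w permutes {1..k} \<Longrightarrow> (gens (nform k w) :: 'a::idom free) \<in> free_carrier k"
  using set_nform[of w k] by (intro gens_carrier) auto

lemma finite_young: "finite (young ell k lam)"
  by (rule finite_subset[OF _ finite_permutations[of "{1..k}"]]) (auto simp: young_def)

lemma free_x_carrier: "(free_x ell k lam :: 'a::idom free) \<in> free_carrier k"
  unfolding free_x_def by (intro free_carrier_sum gens_nform_carrier) (auto simp: young_def)

context
  fixes ell :: nat and q qi :: "'a::idom" and Q :: "nat \<Rightarrow> 'a"
  assumes q_qi: "q * qi = 1" and ell: "1 \<le> ell"
begin

lemma free_rev_cyclotomic:
  "free_rev (prod_list (map (\<lambda>i. gen 0 - const (Q i)) xs)) = prod_list (map (\<lambda>i. gen 0 - const (Q i)) xs)"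
proof (induction xs)
  case Nil
  show ?case by (simp add: free_rev_one)
next
  case (Cons j xs)
  have c: "gen 0 * const b = const b * gen 0" for b :: 'a by (rule const_central[symmetric])
  have qq: "const a * const b = const b * const a" for a b :: 'a by (rule const_central)
  have *: "(gen 0 - const a) * (gen 0 - const b) = (gen 0 - const b) * (gen 0 - const a)" for a b :: 'a
    unfolding left_diff_distrib right_diff_distrib c qq[of a b] by simp
  have "(gen 0 - const (Q j)) * prod_list (map (\<lambda>i. gen 0 - const (Q i)) xs)
      = prod_list (map (\<lambda>i. gen 0 - const (Q i)) xs) * (gen 0 - const (Q j))"
  proof (induction xs)
    case (Cons i xs)
    show ?case
      using Cons unfolding list.map prod_list.Cons mult.assoc[symmetric] *[of "Q j" "Q i"]
      by (simp only: mult.assoc)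
  qed simp
  then show ?case
    using Cons by (simp only: list.map prod_list.Cons free_rev_mult free_rev_diff free_rev_gen free_rev_const)
qed

text \<open>Reversal fixes every relator up to sign: the factors of the cyclotomic and quadratic
  relators commute, braid words are palindromes, and the other two relators change sign.\<close>

lemma free_rev_hecke_rels:
  assumes "x \<in> hecke_rels ell q Q k"
  shows "free_rev x \<in> hecke_rels ell q Q k \<or> - free_rev x \<in> hecke_rels ell q Q k"
proof -
  note fr = free_rev_mult free_rev_diff free_rev_add free_rev_gen free_rev_const free_rev_one
  consider (cyc) "1 \<le> k" "x = prod_list (map (\<lambda>i. gen 0 - const (Q i)) [1..<Suc ell])"
    | (four) "2 \<le> k" "x = gen 0 * gen 1 * gen 0 * gen 1 - gen 1 * gen 0 * gen 1 * gen 0"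
    | (quad) i where "1 \<le> i" "i < k" "x = (gen i - const q) * (gen i + 1)"
    | (comm) i j where "i + 1 < j" "j < k" "x = gen i * gen j - gen j * gen i"
    | (braid) i where "1 \<le> i" "i + 1 < k"
        "x = gen i * gen (i + 1) * gen i - gen (i + 1) * gen i * gen (i + 1)"
    using assms unfolding hecke_rels_def
    by (elim UnE) (auto simp del: upt_Suc split: if_splits)
  then show ?thesis
  proof cases
    case cyc
    then have "free_rev x = x" by (simp only: free_rev_cyclotomic)
    then show ?thesis using assms by simp
  next
    case four
    then have "- free_rev x = x" by (simp add: fr mult.assoc)
    then show ?thesis using assms by simp
  next
    case quad
    have c: "gen i * const q = const q * gen i" by (rule const_central[symmetric])
    have "free_rev x = x"
      unfolding quad fr by (simp add: left_diff_distrib right_diff_distrib distrib_left distrib_right c)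
    then show ?thesis using assms by simp
  next
    case comm
    then have "- free_rev x = x" by (simp add: fr)
    then show ?thesis using assms by simp
  next
    case braid
    then have "free_rev x = x" by (simp add: fr mult.assoc)
    then show ?thesis using assms by simp
  qed
qed

lemma free_rev_hecke_ideal: "x \<in> hecke_ideal ell q Q k \<Longrightarrow> free_rev x \<in> hecke_ideal ell q Q k"
proof (induction rule: hecke_ideal_induct)
  case (rel x)
  interpret J: ideal "hecke_ideal ell q Q k" "free_alg k :: 'a free ring" by (rule hecke_ideal_ideal)
  from free_rev_hecke_rels[OF rel] show ?case
  proof
    assume "- free_rev x \<in> hecke_rels ell q Q k"
    then have "- free_rev x \<in> hecke_ideal ell q Q k" using hecke_rels_ideal by blast
    from J.I_l_closed[OF this, of "- 1"] show ?thesis by (simp add: free_carrier_uminus)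
  qed (use hecke_rels_ideal in blast)
next
  case zero
  then show ?case by (simp add: free_rev_zero hecke_ideal_zero)
next
  case (add x y)
  then show ?case by (simp add: free_rev_add hecke_ideal_add)
next
  case (left x y)
  interpret J: ideal "hecke_ideal ell q Q k" "free_alg k :: 'a free ring" by (rule hecke_ideal_ideal)
  show ?case using J.I_r_closed[OF left(3), of "free_rev y"] left by (simp add: free_rev_mult free_rev_carrier)
next
  case (right x y)
  interpret J: ideal "hecke_ideal ell q Q k" "free_alg k :: 'a free ring" by (rule hecke_ideal_ideal)
  show ?case using J.I_l_closed[OF right(3), of "free_rev y"] right by (simp add: free_rev_mult free_rev_carrier)
qed

text \<open>The \<open>THE\<close> in \<open>hstar\<close> requires existence, by reversal of
  representatives, and uniqueness, since the values at scalars and generators fix an additive map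
  that reverses products.\<close>

lemma hstar_hcoset:
  assumes x: "x \<in> free_carrier k"
  shows "hstar ell q Q k (hcoset ell q Q k x) = hcoset ell q Q k (free_rev x)"
proof -
  \<comment> \<open>Restriction to the carrier is what \<open>extensional\<close> demands; that the
    chosen representative does not matter is \<open>F\<close> below.\<close>
  define F where "F = (\<lambda>X\<in>carrier (hecke ell q Q k). hcoset ell q Q k (free_rev (SOME x. x \<in> free_carrier k \<and> X = hcoset ell q Q k x)))"
  have F: "F (hcoset ell q Q k x) = hcoset ell q Q k (free_rev x)" if x: "x \<in> free_carrier k" for x
  proof -
    define y where "y = (SOME y. y \<in> free_carrier k \<and> hcoset ell q Q k x = hcoset ell q Q k y)"
    have y: "y \<in> free_carrier k" "hcoset ell q Q k x = hcoset ell q Q k y"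
      unfolding y_def using someI[of "\<lambda>y. y \<in> free_carrier k \<and> hcoset ell q Q k x = hcoset ell q Q k y" x] x by auto
    then have "x - y \<in> hecke_ideal ell q Q k" using hcoset_eq_iff[OF x y(1)] by simp
    then have "free_rev x - free_rev y \<in> hecke_ideal ell q Q k"
      using free_rev_hecke_ideal[of "x - y" k] by (simp only: free_rev_diff)
    then have "hcoset ell q Q k (free_rev x) = hcoset ell q Q k (free_rev y)"
      using hcoset_eq_iff[OF free_rev_carrier[OF x] free_rev_carrier[OF y(1)]] by simp
    then show ?thesis using x by (simp add: F_def y_def)
  qed
  let ?P = "\<lambda>f. f \<in> extensional (carrier (hecke ell q Q k)) \<and> bij_betw f (carrier (hecke ell q Q k)) (carrier (hecke ell q Q k)) \<and>
        f \<one>\<^bsub>hecke ell q Q k\<^esub> = \<one>\<^bsub>hecke ell q Q k\<^esub> \<and>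
        (\<forall>x\<in>carrier (hecke ell q Q k). \<forall>y\<in>carrier (hecke ell q Q k). f (x \<oplus>\<^bsub>hecke ell q Q k\<^esub> y) = f x \<oplus>\<^bsub>hecke ell q Q k\<^esub> f y) \<and>
        (\<forall>x\<in>carrier (hecke ell q Q k). \<forall>y\<in>carrier (hecke ell q Q k). f (x \<otimes>\<^bsub>hecke ell q Q k\<^esub> y) = f y \<otimes>\<^bsub>hecke ell q Q k\<^esub> f x) \<and>
        (\<forall>c. \<forall>x\<in>carrier (hecke ell q Q k). f (hsmult ell q Q k c x) = hsmult ell q Q k c (f x)) \<and>
        (\<forall>i<k. f (hT ell q Q k i) = hT ell q Q k i)"
  have "hstar ell q Q k = F"
    unfolding hstar_def
  proof (rule the_equality)
    have one: "F \<one>\<^bsub>hecke ell q Q k\<^esub> = \<one>\<^bsub>hecke ell q Q k\<^esub>"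
      using F[of 1] by (simp add: hcoset_one free_rev_one)
    have add: "\<forall>x\<in>carrier (hecke ell q Q k). \<forall>y\<in>carrier (hecke ell q Q k). F (x \<oplus>\<^bsub>hecke ell q Q k\<^esub> y) = F x \<oplus>\<^bsub>hecke ell q Q k\<^esub> F y"
      by (auto simp: carrier_hecke F free_carrier_add free_rev_add free_rev_carrier simp flip: hcoset_add)
    have mult: "\<forall>x\<in>carrier (hecke ell q Q k). \<forall>y\<in>carrier (hecke ell q Q k). F (x \<otimes>\<^bsub>hecke ell q Q k\<^esub> y) = F y \<otimes>\<^bsub>hecke ell q Q k\<^esub> F x"
      by (auto simp: carrier_hecke F free_carrier_mult free_rev_mult free_rev_carrier simp flip: hcoset_mult)
    have smult: "\<forall>c. \<forall>x\<in>carrier (hecke ell q Q k). F (hsmult ell q Q k c x) = hsmult ell q Q k c (F x)"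
    proof (intro allI ballI)
      fix c X assume "X \<in> carrier (hecke ell q Q k)"
      then obtain x where x: "x \<in> free_carrier k" and X: "X = hcoset ell q Q k x" by (auto simp: carrier_hecke)
      have "free_rev (const c * x) = const c * free_rev x"
        by (simp only: free_rev_mult free_rev_const const_central[of c "free_rev x"])
      then show "F (hsmult ell q Q k c X) = hsmult ell q Q k c (F X)"
        using x by (simp add: X F hsmult_hcoset free_carrier_mult free_rev_carrier)
    qed
    have gens: "\<forall>i<k. F (hT ell q Q k i) = hT ell q Q k i"
      by (auto simp: hT_eq F free_carrier_gen free_rev_gen)
    have FF: "F X \<in> carrier (hecke ell q Q k) \<and> F (F X) = X" if "X \<in> carrier (hecke ell q Q k)" for X
      using that by (auto simp: carrier_hecke F free_rev_carrier free_rev_rev)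
    have "bij_betw F (carrier (hecke ell q Q k)) (carrier (hecke ell q Q k))"
      by (rule bij_betw_byWitness[of _ F]) (use FF in auto)
    then show "?P F"
      using one add mult smult gens by (simp add: F_def)
  next
    fix f assume f: "?P f"
    have "f (hcoset ell q Q k x) = hcoset ell q Q k (free_rev x)" if "x \<in> free_carrier k" for x
      using that
    proof (induction rule: free_carrier_induct)
      case (const c)
      have "hcoset ell q Q k (const c) = hsmult ell q Q k c \<one>\<^bsub>hecke ell q Q k\<^esub>"
        using hsmult_hcoset[of 1 k ell q Q c] by (simp add: hcoset_one)
      moreover have "\<one>\<^bsub>hecke ell q Q k\<^esub> \<in> carrier (hecke ell q Q k)" by (simp flip: hcoset_one)
      ultimately show ?case using f by (metis free_rev_const)
    next
      case (snoc x i)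
      have "f (hcoset ell q Q k (x * gen i)) = f (hT ell q Q k i) \<otimes>\<^bsub>hecke ell q Q k\<^esub> f (hcoset ell q Q k x)"
        using snoc f by (simp add: hcoset_mult free_carrier_gen hT_eq)
      then show ?case
        using snoc f by (simp add: free_rev_mult free_rev_gen hcoset_mult free_carrier_gen free_rev_carrier hT_eq)
    next
      case (add x y)
      then show ?case using f by (simp add: hcoset_add free_rev_add free_rev_carrier)
    qed
    then have "f X = F X" if "X \<in> carrier (hecke ell q Q k)" for X
      using that F by (auto simp: carrier_hecke)
    moreover have "F \<in> extensional (carrier (hecke ell q Q k))" by (simp add: F_def)
    ultimately show "f = F" using f extensionalityI[of f "carrier (hecke ell q Q k)" F] by blast
  qed
  then show ?thesis using F x by simp
qed

text \<open>Independence of the reduced expression is applied in the family, where products live in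
  a monoid type, and then projected to the component.\<close>

lemma hTw_eq:
  assumes w: "w permutes {1..k}"
  shows "hTw ell q Q k w = hcoset ell q Q k (gens (nform k w))"
proof -
  interpret hecke_gens hS "hfT k ell q Q" q qi Q ell k
    by (rule hecke_gens_hfam[OF q_qi ell])
  let ?is = "SOME is. reduced_expression k w is"
  have r: "reduced_expression k w ?is"
    by (rule someI[of _ "nform k w"]) (rule reduced_expression_nform[OF w])
  then have s: "set ?is \<subseteq> {..<k}" by (auto simp: reduced_expression_def expression_def)
  have ev_gens: "ev (gens is) = Tprod is" for "is" by (simp add: ev_prod_list comp_def)
  have "hTw ell q Q k w = hcoset ell q Q k (gens ?is)"
  proof -
    have "map (hT ell q Q k) ?is = map (hcoset ell q Q k) (map gen ?is)"
      by (simp add: hT_eq)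
    moreover have "set (map gen ?is) \<subseteq> (free_carrier k :: 'a free set)"
      using s by (auto intro: free_carrier_gen)
    ultimately show ?thesis unfolding hTw_def by (simp only: hcoset_prod_list)
  qed
  also have "\<dots> = hproj (ev (gens ?is)) (k, ell, q, Q)"
    by (rule hproj_ev[OF q_qi ell gens_carrier[OF s], symmetric])
  also have "ev (gens ?is) = ev (gens (nform k w))"
    unfolding ev_gens by (rule Tprod_reduced_expression[OF r])
  also have "hproj \<dots> (k, ell, q, Q) = hcoset ell q Q k (gens (nform k w))"
    by (rule hproj_ev[OF q_qi ell gens_nform_carrier[OF w]])
  finally show ?thesis .
qed

lemma free_u_carrier:
  assumes "\<And>s. s \<in> {2..ell} \<Longrightarrow> frak_a lam s \<le> k"
  shows "free_u ell qi Q lam \<in> free_carrier k"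
  unfolding free_u_def using assms
  by (intro free_carrier_prod_list) (fastforce intro!: free_carrier_diff free_L_carrier simp del: upt_Suc)

lemma free_murphy_carrier:
  assumes "\<And>s. s \<in> {2..ell} \<Longrightarrow> frak_a lam s \<le> k" "w permutes {1..k}" "v permutes {1..k}"
  shows "free_murphy ell qi Q k lam w v \<in> free_carrier k"
  unfolding free_murphy_def
  using set_nform[OF assms(2)] set_nform[OF assms(3)]
  by (intro free_carrier_mult free_x_carrier free_u_carrier gens_carrier assms(1)) auto

lemma murphy_eq:
  assumes A: "\<And>s. s \<in> {2..ell} \<Longrightarrow> frak_a lam s \<le> k"
    and w: "tab_perm ell k lam s permutes {1..k}" and v: "tab_perm ell k lam t permutes {1..k}"
  shows "murphy ell q Q k lam s t = hcoset ell q Q k (free_murphy ell qi Q k lam (tab_perm ell k lam s) (tab_perm ell k lam t))"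
proof -
  interpret R: ring "hecke ell q Q k" by (rule hecke_ring)
  have x: "x_elt ell q Q k lam = hcoset ell q Q k (free_x ell k lam)"
  proof -
    have c: "gens (nform k w) \<in> free_carrier k" "hTw ell q Q k w = hcoset ell q Q k (gens (nform k w))"
      if "w \<in> young ell k lam" for w
      using that gens_nform_carrier[of w k] hTw_eq[of w k] by (simp_all add: young_def)
    have "x_elt ell q Q k lam = (\<Oplus>\<^bsub>hecke ell q Q k\<^esub>w\<in>young ell k lam. hcoset ell q Q k (gens (nform k w)))"
      unfolding x_elt_def
    proof (rule R.finsum_cong'[OF refl])
      show "(\<lambda>w. hcoset ell q Q k (gens (nform k w))) \<in> young ell k lam \<rightarrow> carrier (hecke ell q Q k)"
        by (rule Pi_I) (rule hcoset_carrier[OF c(1)])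
    qed (rule c(2))
    also have "\<dots> = hcoset ell q Q k (free_x ell k lam)"
      unfolding free_x_def by (rule hcoset_sum[OF finite_young c(1), symmetric])
    finally show ?thesis .
  qed
  have u: "u_elt ell q Q k lam = hcoset ell q Q k (free_u ell qi Q lam)"
  proof -
    have c: "free_L qi j - const (Q s) \<in> free_carrier k"
      if "s \<in> {2..ell}" "j \<in> {1..frak_a lam s}" for s j
    proof -
      have "j \<le> k" using A[OF that(1)] that(2) by simp
      then show ?thesis by (intro free_carrier_diff free_L_carrier free_carrier_const)
    qed
    have f: "hL ell q Q k j \<ominus>\<^bsub>hecke ell q Q k\<^esub> hsmult ell q Q k (Q s) \<one>\<^bsub>hecke ell q Q k\<^esub> = hcoset ell q Q k (free_L qi j - const (Q s))"
      if "s \<in> {2..ell}" "j \<in> {1..frak_a lam s}" for s j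
    proof -
      have j: "j \<le> k" using A[OF that(1)] that(2) by simp
      have "hsmult ell q Q k (Q s) \<one>\<^bsub>hecke ell q Q k\<^esub> = hcoset ell q Q k (const (Q s))"
        using hsmult_hcoset[of 1 k ell q Q "Q s"] by (simp add: hcoset_one)
      then show ?thesis
        using j by (simp add: hL_eq[OF q_qi ell] hcoset_diff free_L_carrier)
    qed
    let ?fs = "map (\<lambda>s. map (\<lambda>j. free_L qi j - const (Q s)) [1..<Suc (frak_a lam s)]) [2..<Suc ell]"
    have "map (\<lambda>s. map (\<lambda>j. hL ell q Q k j \<ominus>\<^bsub>hecke ell q Q k\<^esub> hsmult ell q Q k (Q s) \<one>\<^bsub>hecke ell q Q k\<^esub>) [1..<Suc (frak_a lam s)]) [2..<Suc ell]
        = map (\<lambda>s. map (\<lambda>j. hcoset ell q Q k (free_L qi j - const (Q s))) [1..<Suc (frak_a lam s)]) [2..<Suc ell]"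
      by (intro map_cong refl f) auto
    also have "\<dots> = map (map (hcoset ell q Q k)) ?fs"
      by (simp only: map_map comp_def)
    finally have "u_elt ell q Q k lam = list_mult (hecke ell q Q k) (map (hcoset ell q Q k) (concat ?fs))"
      unfolding u_elt_def map_concat by (rule arg_cong)
    also have "\<dots> = hcoset ell q Q k (prod_list (concat ?fs))"
    proof (rule hcoset_prod_list[symmetric])
      show "set (concat ?fs) \<subseteq> free_carrier k"
      proof
        fix x assume "x \<in> set (concat ?fs)"
        then obtain s j where "s \<in> {2..ell}" "j \<in> {1..frak_a lam s}" "x = free_L qi j - const (Q s)"
          by (auto simp: less_Suc_eq_le simp del: upt_Suc)
        then show "x \<in> free_carrier k" using c by simp
      qed
    qed
    finally show ?thesis unfolding free_u_def .
  qed
  have sw: "set (nform k (tab_perm ell k lam s)) \<subseteq> {..<k}"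
    using set_nform[OF w] by auto
  have "hstar ell q Q k (hTw ell q Q k (tab_perm ell k lam s)) = hcoset ell q Q k (gens (rev (nform k (tab_perm ell k lam s))))"
    unfolding hTw_eq[OF w] hstar_hcoset[OF gens_nform_carrier[OF w]]
    by (simp add: free_rev_prod_list comp_def free_rev_gen rev_map)
  moreover have "(gens (rev (nform k (tab_perm ell k lam s))) :: 'a free) \<in> free_carrier k"
    using sw by (intro gens_carrier) auto
  moreover have "(gens (nform k (tab_perm ell k lam t)) :: 'a free) \<in> free_carrier k"
    by (rule gens_nform_carrier[OF v])
  moreover have "(free_x ell k lam :: 'a free) \<in> free_carrier k"
    by (rule free_x_carrier)
  ultimately show ?thesis
    unfolding murphy_def m_elt_def x u hTw_eq[OF v] free_murphy_def
    using free_u_carrier[OF A] by (simp add: hcoset_mult free_carrier_mult)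
qed

end

subsection \<open>Descending Murphy elements\<close>

context row_diagram
begin

lemma sorted_frak_a: "sorted (map (frak_a lam) [2..<Suc ell])"
  unfolding sorted_map by (rule sorted_wrt_mono_rel[OF _ sorted_upt]) (rule frak_a_mono)

lemma frak_a_le: "s \<in> {2..ell} \<Longrightarrow> frak_a lam s \<le> n"
  using frak_a_mono[of s "Suc ell"] frak_a_top by simp

lemma row_separated_frak_a: "row_separated row_of n (frak_a lam s)"
  unfolding row_separated_def
proof (intro allI impI notI)
  fix y z assume yz: "1 \<le> y \<and> y \<le> frak_a lam s \<and> frak_a lam s < z \<and> z \<le> n" "row_of y = row_of z"
  then show False using row_of_frak_a[of y s] row_of_frak_a[of z s] by simp
qed

end

context last_node
begin

lemma row_separated_a: "row_separated row_of n a"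
  using row_of_after_a by (auto simp: row_separated_def)

lemma frak_a_mu': "frak_a mu s = (if frak_a lam s < a then frak_a lam s else frak_a lam s - 1)"
  using frak_a_mu[of s] frak_a_vs_a[of s] by auto

text \<open>The boundary of \<open>s\<close> is at least \<open>a\<close> exactly for
  \<open>l < s\<close>, and \<open>l >= 1\<close> makes \<open>l + 1\<close> fall within the range
  from 2. This gives the product over the later components.\<close>

lemma prod_frak_a:
  fixes f :: "nat \<Rightarrow> 'b::comm_monoid_mult"
  shows "(\<Prod>s=2..ell. if frak_a lam s < a then 1 else f s) = (\<Prod>i=l+1..ell. f i)"
proof -
  have "{s \<in> {2..ell}. \<not> frak_a lam s < a} = {l + 1..ell}"
    unfolding not_less frak_a_vs_a using lr(1) by auto
  moreover have "(\<Prod>s=2..ell. if frak_a lam s < a then 1 else f s)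
      = (\<Prod>s=2..ell. if \<not> frak_a lam s < a then f s else 1)"
    by (rule prod.cong) auto
  ultimately show ?thesis by (simp add: prod.inter_filter[symmetric])
qed

end

section \<open>From the descended products to Murphy elements\<close>

context hecke_gens
begin

lemma x_prod_cong: "(\<And>m. m \<in> {1..n} \<Longrightarrow> rho m = sigma m) \<Longrightarrow> x_prod rho n = x_prod sigma n"
  unfolding x_prod_def row_factor_def
  by (intro arg_cong[of _ _ prod_list] map_cong refl sum.cong) auto

lemma ev_gens: "ev (gens is) = Tprod is"
  by (simp add: ev_prod_list comp_def)

lemma ev_free_x:
  assumes "row_diagram ell n lam"
  shows "ev (free_x ell n lam) = x_prod (row_diagram.row_of ell lam) n"
proof -
  interpret row_diagram ell n lam by (rule assms)
  show ?thesis
    unfolding free_x_def ev_sum ev_gens young_eq x_prod_def by (rule sum_row_young[OF convex_row_of])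
qed

lemma ev_free_u: "ev (free_u ell qi Q lam) = u_prod (frak_a lam)"
proof -
  have *: "ev (prod_list (concat xss)) = prod_list (map (\<lambda>xs. prod_list (map ev xs)) xss)" for xss
    by (induction xss) (simp_all add: ev_mult ev_prod_list)
  have L: "Lfac s = (\<lambda>j. L j - S (Q s))" for s by (rule ext) (rule Lfac_def)
  show ?thesis
    unfolding free_u_def * u_prod_def Uf_def L map_map comp_def ev_diff ev_free_L ev_const ..
qed

lemma ev_free_murphy:
  assumes "row_diagram ell n lam"
  shows "ev (free_murphy ell qi Q n lam w v)
    = Tprod (rev (nform n w)) * (x_prod (row_diagram.row_of ell lam) n * u_prod (frak_a lam)) * Tprod (nform n v)"
  unfolding free_murphy_def ev_mult ev_gens ev_free_x[OF assms] ev_free_u ..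

text \<open>After the first blocks, the normal forms use only letters below \<open>k - 1\<close>;
  these words lie in the smaller algebra and can be pulled out on either side.\<close>

lemma desc_nform:
  assumes "desc (k - 1) d (Tprod (rev [b..<k]) * z * Tprod [a..<k]) y" "1 \<le> k"
    and "w permutes {1..k - 1}" "v permutes {1..k - 1}" "b \<in> {1..k}" "a \<in> {1..k}"
  shows "desc (k - 1) d (Tprod (rev (nform k (w \<circ> dcyc b k))) * z * Tprod (nform k (v \<circ> dcyc a k)))
    (Tprod (rev (nform (k - 1) w)) * y * Tprod (nform (k - 1) v))"
proof -
  have k: "Suc (k - 1) = k" using assms(2) by simp
  have w: "nform k (w \<circ> dcyc b k) = [b..<k] @ nform (k - 1) w"
    using nform_dcyc[OF assms(3), of b] assms(5) unfolding k by simp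
  have v: "nform k (v \<circ> dcyc a k) = [a..<k] @ nform (k - 1) v"
    using nform_dcyc[OF assms(4), of a] assms(6) unfolding k by simp
  have sub: "Tprod (rev (nform (k - 1) w)) \<in> sub (k - 1)" "Tprod (nform (k - 1) v) \<in> sub (k - 1)"
    using set_nform[OF assms(3)] set_nform[OF assms(4)] by (auto intro!: Tprod_sub)
  have "desc (k - 1) d
      (Tprod (rev (nform (k - 1) w)) * (Tprod (rev [b..<k]) * z * Tprod [a..<k]) * Tprod (nform (k - 1) v))
      (Tprod (rev (nform (k - 1) w)) * y * Tprod (nform (k - 1) v))"
    using assms(1,2) sub by (intro desc_right desc_left) auto
  then show ?thesis
    unfolding w v by (simp add: mult.assoc)
qed

lemma desc_murphy_same:
  assumes node: "last_node ell k lam r c l"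
    and mu: "mu = (\<lambda>l' r'. if l' = l \<and> r' = r then lam l r - 1 else lam l' r')"
    and a: "a = init_tab ell lam (r, c, l)"
    and w: "w permutes {1..k - 1}" and v: "v permutes {1..k - 1}"
  shows "desc (k - 1) (ell - 1) (ev (free_murphy ell qi Q k lam (w \<circ> dcyc a k) (v \<circ> dcyc a k)))
    (ev (const (q ^ (k - a) * (\<Prod>i=l+1..ell. - Q i)) * free_murphy ell qi Q (k - 1) mu w v))"
proof -
  interpret last_node ell k lam r c l mu
    by (rule node) (rule eq_reflection[OF mu])
  let ?c = "q ^ (k - a) * (\<Prod>i=l+1..ell. - Q i)"
  note a' = a_range[folded a]
  have "x_prod mu.row_of (k - 1) = x_prod (drop_entry row_of a) (k - 1)"
    by (rule x_prod_cong) (simp only: row_of_mu drop_entry_def a)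
  moreover have "frak_a mu = (\<lambda>s. if frak_a lam s < a then frak_a lam s else frak_a lam s - 1)"
    by (rule ext) (simp only: frak_a_mu' a)
  ultimately have "desc (k - 1) (ell - 1)
      (Tprod (rev [a..<k]) * (x_prod row_of k * u_prod (frak_a lam)) * Tprod [a..<k])
      (S ?c * (x_prod mu.row_of (k - 1) * u_prod (frak_a mu)))"
    using desc_same_row[OF sorted_frak_a frak_a_le row_separated_frak_a a' row_separated_a[folded a]]
    by (simp only: prod_frak_a[folded a])
  from desc_nform[OF this n w v] a' have "desc (k - 1) (ell - 1)
      (ev (free_murphy ell qi Q k lam (w \<circ> dcyc a k) (v \<circ> dcyc a k)))
      (Tprod (rev (nform (k - 1) w)) * (S ?c * (x_prod mu.row_of (k - 1) * u_prod (frak_a mu)))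
        * Tprod (nform (k - 1) v))"
    by (simp add: ev_free_murphy[OF row_diagram_axioms])
  then show ?thesis
    unfolding ev_mult ev_const ev_free_murphy[OF mu.row_diagram_axioms]
    by (simp only: mult.assoc S_left_commute[of "Tprod (rev (nform (k - 1) w))"])
qed

lemma desc_murphy_other:
  assumes node: "last_node ell k lam r c l" "last_node ell k lam r' c' l'"
    and a: "a = init_tab ell lam (r, c, l)" and b: "b = init_tab ell lam (r', c', l')"
    and "a \<noteq> b"
    and w: "w permutes {1..k - 1}" and v: "v permutes {1..k - 1}"
  shows "desc (k - 1) (ell - 1) (ev (free_murphy ell qi Q k lam (w \<circ> dcyc b k) (v \<circ> dcyc a k))) 0"
proof -
  interpret last_node ell k lam r c l "\<lambda>l' r'. if l' = l \<and> r' = r then lam l r - 1 else lam l' r'"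
    by (rule node(1)) (rule reflexive)
  interpret N: last_node ell k lam r' c' l' "\<lambda>l r. if l = l' \<and> r = r' then lam l' r' - 1 else lam l r"
    by (rule node(2)) (rule reflexive)
  note a' = a_range[folded a] and b' = N.a_range[folded b]
  have "desc (k - 1) (ell - 1)
      (Tprod (rev [b..<k]) * (x_prod row_of k * u_prod (frak_a lam)) * Tprod [a..<k]) 0"
    by (rule desc_other_row[OF sorted_frak_a frak_a_le row_separated_frak_a a' b' \<open>a \<noteq> b\<close>
        row_separated_a[folded a] N.row_separated_a[folded b]])
  from desc_nform[OF this n w v] a' b' show ?thesis
    by (simp add: ev_free_murphy[OF row_diagram_axioms])
qed

end

theorem proposition3p18:
  fixes ell n :: nat and q :: "'a::idom" and Q :: "nat \<Rightarrow> 'a"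
    and lam :: mpart and s t :: tableau
  assumes "ell \<ge> 1" and "n \<ge> 1"
    and "q dvd 1" and "q \<noteq> 1"
    and "lam \<in> multipartitions ell n"
    and "s \<in> Std ell n lam" and "t \<in> Std ell n lam"
  shows "descend ell q Q n (murphy ell q Q n lam s t) =
    (if n_of ell n lam s = n_of ell n lam t
     then hsmult ell q Q (n - 1)
            (q ^ (n - n_of ell n lam t) * (\<Prod>i = comp_of ell lam t n + 1..ell. - Q i))
            (murphy ell q Q (n - 1) (sub_shape ell lam (n - 1) t)
               (sub_tab ell lam (n - 1) s) (sub_tab ell lam (n - 1) t))
     else \<zero>\<^bsub>hecke ell q Q (n - 1)\<^esub>)"
proof -
  note ell = assms(1) and n = assms(2)
  obtain qi where qi: "q * qi = 1" using assms(3) by (metis dvdE)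
  obtain r c l where nt: "node_of ell lam t n = (r, c, l)" by (rule prod_cases3)
  obtain r' c' l' where ns: "node_of ell lam s n = (r', c', l')" by (rule prod_cases3)
  note T = Std_last_node[OF assms(5,7) n nt] and S = Std_last_node[OF assms(5,6) n ns]
  define mu where "mu = (\<lambda>l' r'. if l' = l \<and> r' = r then lam l r - 1 else lam l' r')"
  note mu = mu_def
  \<comment> \<open>The shape without the last node of \<open>s\<close>; it may differ from
    \<open>mu\<close>, and then serves to factor the permutation of \<open>s\<close>.\<close>
  define mu' where "mu' = (\<lambda>l r. if l = l' \<and> r = r' then lam l' r' - 1 else lam l r)"
  interpret last_node ell n lam r c l mu by (rule T(1)) (rule eq_reflection[OF mu_def])
  interpret N: last_node ell n lam r' c' l' mu' by (rule S(1)) (rule eq_reflection[OF mu'_def])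
  interpret hecke_gens hS "hfT n ell q Q" q qi Q ell n by (rule hecke_gens_hfam[OF qi ell])
  \<comment> \<open>\<open>ell - 1\<close> is the degree bound from one factor for each
    \<open>s = 2, ..., ell\<close>.\<close>
  have n': "n = Suc (n - 1)" "ell - 1 < ell" using n ell by auto
  let ?v = "tab_perm ell (n - 1) mu (sub_tab ell lam (n - 1) t)"
  let ?w' = "tab_perm ell (n - 1) mu' (sub_tab ell lam (n - 1) s)"
  note v = tab_perm_sub[OF T(3,2)] and w' = N.tab_perm_sub[OF S(3,2)]
  have murphy_n: "murphy ell q Q n lam s t
      = hcoset ell q Q n (free_murphy ell qi Q n lam (tab_perm ell n lam s) (tab_perm ell n lam t))"
    by (rule murphy_eq[OF qi ell _ tab_perm(1)[OF S(3)] tab_perm(1)[OF T(3)]]) (rule frak_a_le)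
  have carrier: "free_murphy ell qi Q n lam (tab_perm ell n lam s) (tab_perm ell n lam t) \<in> free_carrier n"
    by (rule free_murphy_carrier[OF qi ell frak_a_le tab_perm(1)[OF S(3)] tab_perm(1)[OF T(3)]])
  show ?thesis
  proof (cases "n_of ell n lam s = n_of ell n lam t")
    case True
    \<comment> \<open>The initial tableau is injective, so equal positions mean equal nodes and
      \<open>mu\<close> is the shape for both restricted tableaux.\<close>
    then have "(r', c', l') = (r, c, l)"
      using T(4) S(4) node_init_tab[OF x] node_init_tab[OF N.x] by metis
    then have s: "s (r, c, l) = n" using S(2) by simp
    let ?w = "tab_perm ell (n - 1) mu (sub_tab ell lam (n - 1) s)"
    note w = tab_perm_sub[OF S(3) s]
    let ?y = "free_murphy ell qi Q (n - 1) mu ?w ?v"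
    let ?k = "q ^ (n - a) * (\<Prod>i=l+1..ell. - Q i)"
    have y: "?y \<in> free_carrier (n - 1)"
      by (rule free_murphy_carrier[OF qi ell mu.frak_a_le w(1) v(1)])
    have murphy_m: "murphy ell q Q (n - 1) mu (sub_tab ell lam (n - 1) s) (sub_tab ell lam (n - 1) t)
        = hcoset ell q Q (n - 1) ?y"
      by (rule murphy_eq[OF qi ell _ w(1) v(1)]) (rule mu.frak_a_le)
    have "descend ell q Q n (murphy ell q Q n lam s t) = hcoset ell q Q (n - 1) (const ?k * ?y)"
      unfolding murphy_n
    proof (rule descend_desc[OF qi ell _ n' carrier])
      show "desc (n - 1) (ell - 1) (ev (free_murphy ell qi Q n lam (tab_perm ell n lam s) (tab_perm ell n lam t)))
          (ev (const ?k * ?y))"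
        unfolding w(2) v(2) by (rule desc_murphy_same[OF T(1) mu refl w(1) v(1)])
    qed (intro free_carrier_mult free_carrier_const y)
    also have "\<dots> = hsmult ell q Q (n - 1) ?k (murphy ell q Q (n - 1) mu (sub_tab ell lam (n - 1) s) (sub_tab ell lam (n - 1) t))"
      unfolding murphy_m by (rule hsmult_hcoset[OF y, symmetric])
    finally show ?thesis
      using True T(4,5,6) by (simp add: mu)
  next
    case False
    then have "a \<noteq> N.a" using T(4) S(4) by simp
    have "descend ell q Q n (murphy ell q Q n lam s t) = hcoset ell q Q (n - 1) 0"
      unfolding murphy_n
    proof (rule descend_desc[OF qi ell _ n' carrier])
      show "desc (n - 1) (ell - 1)
          (ev (free_murphy ell qi Q n lam (tab_perm ell n lam s) (tab_perm ell n lam t))) (ev 0)"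
        unfolding w'(2) v(2) ev_zero
        by (rule desc_murphy_other[OF T(1) S(1) refl refl \<open>a \<noteq> N.a\<close> w'(1) v(1)])
    qed (rule free_carrier_zero)
    then show ?thesis using False by (simp add: hcoset_zero)
  qed
qed

end
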